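(* Let $G$ be a finite group with $\pi_e(G)\subseteq\{1,2,3,4,6\}$ that has precisely three cyclic subgroups of order $6$. Then there exist two cyclic subgroups of order $6$ in $G$ whose intersection has order $3$ if and only if $G$ is isomorphic to one of the groups with GAP SmallGroup identifiers $[12,5]\cong\mathbb{Z}_2\times\mathbb{Z}_6$, $[18,3]\cong\mathbb{Z}_3\times S_3$, $[24,7]\cong\mathbb{Z}_2\times(\mathbb{Z}_3\rtimes\mathbb{Z}_4)$, $[24,8]\cong(\mathbb{Z}_6\times\mathbb{Z}_2)\rtimes\mathbb{Z}_2$, $[24,14]\cong\mathbb{Z}_2\times\mathbb{Z}_2\times S_3$, $[36,11]\cong\mathbb{Z}_3\times A_4$, $[72,43]\cong(\mathbb{Z}_3\times A_4)\rtimes\mathbb{Z}_2$.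
   Context: $\pi_e(G)$ is the set of orders of elements of $G$. The GAP identifier $[n,m]$ denotes the $m$-th group of order $n$ in the GAP SmallGroups library, which determines the semidirect products listed. *)

theory Defs
  imports "HOL-Algebra.Sym_Groups" "HOL-Algebra.Elementary_Groups" "HOL-Algebra.Multiplicative_Group"
begin

definition elem_orders :: "('a, 'b) monoid_scheme \<Rightarrow> nat set" where
  "elem_orders G = {group.ord G x | x. x \<in> carrier G}"

definition cyclic_subgroups_of_order :: "('a, 'b) monoid_scheme \<Rightarrow> nat \<Rightarrow> 'a set set" where
  "cyclic_subgroups_of_order G n =
     {H. subgroup H G \<and> cyclic_group (G\<lparr>carrier := H\<rparr>) \<and> card H = n}"

abbreviation Zn :: "nat \<Rightarrow> int monoid" where
  "Zn n \<equiv> integer_mod_group n"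

definition semidirect_prod ::
  "('a, 'c) monoid_scheme \<Rightarrow> ('b, 'd) monoid_scheme \<Rightarrow> ('b \<Rightarrow> 'a \<Rightarrow> 'a) \<Rightarrow> ('a \<times> 'b) monoid" where
  "semidirect_prod N H phi =
     \<lparr> carrier = carrier N \<times> carrier H,
       mult = (\<lambda>(n1, h1) (n2, h2). (n1 \<otimes>\<^bsub>N\<^esub> phi h1 n2, h1 \<otimes>\<^bsub>H\<^esub> h2)),
       one = (\<one>\<^bsub>N\<^esub>, \<one>\<^bsub>H\<^esub>) \<rparr>"

definition SG_12_5 :: "(int \<times> int) monoid" where
  "SG_12_5 = Zn 2 \<times>\<times> Zn 6"

definition SG_18_3 :: "(int \<times> (nat \<Rightarrow> nat)) monoid" where
  "SG_18_3 = Zn 3 \<times>\<times> sym_group 3"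

definition Dic3 :: "(int \<times> int) monoid" where
  "Dic3 = semidirect_prod (Zn 3) (Zn 4) (\<lambda>b a. if even b then a else (- a) mod 3)"

definition SG_24_7 :: "(int \<times> (int \<times> int)) monoid" where
  "SG_24_7 = Zn 2 \<times>\<times> Dic3"

text \<open>[24,8] = (Z_6 x Z_2) \<rtimes> Z_2, the generator of Z_2 acting by the involutive
  automorphism (u,v) \<mapsto> (-u, v+u); it inverts the Z_3 part and swaps (3,0) and (3,1).\<close>
definition SG_24_8 :: "((int \<times> int) \<times> int) monoid" where
  "SG_24_8 = semidirect_prod (Zn 6 \<times>\<times> Zn 2) (Zn 2)
     (\<lambda>b (u, v). if b = 0 then (u, v) else ((- u) mod 6, (v + u) mod 2))"

definition SG_24_14 :: "((int \<times> int) \<times> (nat \<Rightarrow> nat)) monoid" where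
  "SG_24_14 = (Zn 2 \<times>\<times> Zn 2) \<times>\<times> sym_group 3"

definition SG_36_11 :: "(int \<times> (nat \<Rightarrow> nat)) monoid" where
  "SG_36_11 = Zn 3 \<times>\<times> alt_group 4"

text \<open>[72,43] = (Z_3 x A_4) \<rtimes> Z_2, the generator of Z_2 inverting Z_3 and acting on A_4
  by conjugation with the transposition (1 2) (so the group is the subgroup of S_3 x S_4
  of pairs of equal sign).\<close>
definition SG_72_43 :: "((int \<times> (nat \<Rightarrow> nat)) \<times> int) monoid" where
  "SG_72_43 = semidirect_prod (Zn 3 \<times>\<times> alt_group 4) (Zn 2)
     (\<lambda>b (a, p). if b = 0 then (a, p)
                 else ((- a) mod 3, Transposition.transpose 1 2 \<circ> p \<circ> Transposition.transpose 1 2))"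

end

theory Submission
  imports Defs
begin

text \<open>
  If two cyclic subgroups of order 6 meet in a subgroup \<open>P = \<langle>z\<rangle>\<close> of order 3, then their involutions
  \<open>s\<close> and \<open>t\<close> centralise \<open>z\<close>, and so does a third involution (\<open>st\<close> if \<open>s\<close> and \<open>t\<close> commute, \<open>sts\<close>
  otherwise). Hence the three cyclic subgroups of order 6 are \<open>\<langle>zs\<rangle>\<close>, \<open>\<langle>zt\<rangle>\<close>, \<open>\<langle>zu\<rangle>\<close>, conjugation
  preserves \<open>P\<close> and permutes \<open>T = {s, t, u}\<close>, and the absence of elements of order 12 and of further
  elements of order 6 makes everything rigid: an element of \<open>C(z)\<close> that commutes with a member of \<open>T\<close> lies in
  \<open>P \<times> \<langle>s, t\<rangle>\<close> when \<open>s\<close> and \<open>t\<close> commute, and an element inverting \<open>z\<close> has order 2 or 4, so it cannot act on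
  \<open>T\<close> as a 3-cycle.

  If \<open>s\<close> and \<open>t\<close> do not commute, \<open>G = P \<times> \<langle>s, t\<rangle> = \<int>\<^sub>3 \<times> S\<^sub>3\<close>. Otherwise \<open>V = {1, s, t, u}\<close> is a Klein
  four-group, and \<open>G\<close> is determined by whether \<open>C(z)\<close> contains a 3-cycle on \<open>T\<close>, whether some \<open>x\<close> inverts \<open>z\<close>,
  how \<open>x\<close> acts on \<open>T\<close>, and whether \<open>x\<^sup>2 = 1\<close>.
\<close>

section \<open>Semidirect products and cyclic groups\<close>

text \<open>Elements of order 6 carry the information: the cube of \<open>z \<otimes> x\<close> is
  \<open>x\<close> and its fourth power is \<open>z\<close>. A conjugate of it is again one of the
  six elements of order 6, and so shows what conjugation does to \<open>x\<close> and to
  \<open>z\<close>; this is why \<open>P\<close> is preserved and \<open>T\<close> permuted. Words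
  are computed without inverses: conjugation reads \<open>g \<otimes> y = y' \<otimes> g\<close>,
  inverses of elements of order 3 are squares, and words are right-associated, so that relations act
  as rewrite rules. Each group is recognised by a normal form of its elements. Existence comes from
  correcting an arbitrary element until it centralises \<open>z\<close> and fixes a member of
  \<open>T\<close>; uniqueness comes from the different ways in which the factors act on
  \<open>z\<close> and on \<open>T\<close>. The delicate point is the choice of generators: an
  inverting element or a 3-cycle found in \<open>G\<close> need not satisfy the relations of the
  target and may have to be replaced by a better one.\<close>

lemma carrier_Zn: 
  "carrier (Zn 2) = {0, 1}" "carrier (Zn 3) = {0, 1, 2}"
  "carrier (Zn 4) = {0, 1, 2, 3}" "carrier (Zn 6) = {0, 1, 2, 3, 4, 5}"
  by (auto simp: carrier_integer_mod_group)

text \<open>With the trivial action, direct products fall under the lemmas on semidirect products,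
  so that the seven targets share one recognition criterion.\<close>

lemma DirProd_eq_semidirect_prod: "N \<times>\<times> H = semidirect_prod N H (\<lambda>_ n. n)"
  by (simp add: DirProd_def semidirect_prod_def)

lemma carrier_semidirect_prod [simp]:
  "carrier (semidirect_prod N H phi) = carrier N \<times> carrier H"
  by (simp add: semidirect_prod_def)

lemma mult_semidirect_prod [simp]:
  "(n, h) \<otimes>\<^bsub>semidirect_prod N H phi\<^esub> (n', h') = (n \<otimes>\<^bsub>N\<^esub> phi h n', h \<otimes>\<^bsub>H\<^esub> h')"
  by (simp add: semidirect_prod_def)

lemma one_semidirect_prod [simp]:
  "\<one>\<^bsub>semidirect_prod N H phi\<^esub> = (\<one>\<^bsub>N\<^esub>, \<one>\<^bsub>H\<^esub>)"
  by (simp add: semidirect_prod_def)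

lemma group_semidirect_prod:
  assumes "group N" "group H"
    and hom: "\<And>h. h \<in> carrier H \<Longrightarrow> phi h \<in> hom N N"
    and one: "\<And>n. n \<in> carrier N \<Longrightarrow> phi \<one>\<^bsub>H\<^esub> n = n"
    and mult: "\<And>h h' n. h \<in> carrier H \<Longrightarrow> h' \<in> carrier H \<Longrightarrow> n \<in> carrier N \<Longrightarrow>
      phi (h \<otimes>\<^bsub>H\<^esub> h') n = phi h (phi h' n)"
  shows "group (semidirect_prod N H phi)"
proof -
  interpret N: group N by fact
  interpret H: group H by fact
  have cl: "phi h n \<in> carrier N" if "h \<in> carrier H" "n \<in> carrier N" for h n
    using hom[OF that(1)] that(2) by (auto simp: hom_def)
  have hm: "phi h (n \<otimes>\<^bsub>N\<^esub> n') = phi h n \<otimes>\<^bsub>N\<^esub> phi h n'"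
    if "h \<in> carrier H" "n \<in> carrier N" "n' \<in> carrier N" for h n n'
    using hom[OF that(1)] that by (auto simp: hom_def)
  show ?thesis
  proof (rule groupI)
    show "\<one>\<^bsub>semidirect_prod N H phi\<^esub> \<in> carrier (semidirect_prod N H phi)"
      by simp
  next
    fix p q r assume "p \<in> carrier (semidirect_prod N H phi)" "q \<in> carrier (semidirect_prod N H phi)"
      "r \<in> carrier (semidirect_prod N H phi)"
    then show "p \<otimes>\<^bsub>semidirect_prod N H phi\<^esub> q \<otimes>\<^bsub>semidirect_prod N H phi\<^esub> r =
        p \<otimes>\<^bsub>semidirect_prod N H phi\<^esub> (q \<otimes>\<^bsub>semidirect_prod N H phi\<^esub> r)"
      by (cases p; cases q; cases r) (simp add: hm mult cl N.m_assoc H.m_assoc)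
  next
    fix p assume "p \<in> carrier (semidirect_prod N H phi)"
    then obtain n h where p: "p = (n, h)" and nh: "n \<in> carrier N" "h \<in> carrier H" by auto
    \<comment> \<open>First component of the left inverse of \<open>(n, h)\<close>; the second is
      the inverse of \<open>h\<close>.\<close>
    let ?m = "phi (inv\<^bsub>H\<^esub> h) (inv\<^bsub>N\<^esub> n)"
    have "?m \<otimes>\<^bsub>N\<^esub> phi (inv\<^bsub>H\<^esub> h) n = phi (inv\<^bsub>H\<^esub> h) \<one>\<^bsub>N\<^esub>"
      using nh by (simp flip: hm)
    also have "\<dots> = \<one>\<^bsub>N\<^esub>"
      using hom_one[OF hom assms(1) assms(1)] nh by simp
    finally show "\<exists>q\<in>carrier (semidirect_prod N H phi).
        q \<otimes>\<^bsub>semidirect_prod N H phi\<^esub> p = \<one>\<^bsub>semidirect_prod N H phi\<^esub>"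
      using nh cl p by (intro bexI[of _ "(?m, inv\<^bsub>H\<^esub> h)"]) auto
  qed (auto simp: cl one)
qed

section \<open>Maps from a semidirect product into a group\<close>

context group
begin

lemma hom_semidirect_prod:
  assumes f: "f \<in> hom N G" and g: "g \<in> hom H G"
    and phi: "\<And>n h. n \<in> carrier N \<Longrightarrow> h \<in> carrier H \<Longrightarrow> phi h n \<in> carrier N"
    and conj: "\<And>n h. n \<in> carrier N \<Longrightarrow> h \<in> carrier H \<Longrightarrow> g h \<otimes> f n = f (phi h n) \<otimes> g h"
  shows "(\<lambda>(n, h). f n \<otimes> g h) \<in> hom (semidirect_prod N H phi) G"
proof (rule homI; clarsimp)
  have cl: "\<And>n. n \<in> carrier N \<Longrightarrow> f n \<in> carrier G" "\<And>h. h \<in> carrier H \<Longrightarrow> g h \<in> carrier G"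
    using f g by (auto simp: hom_def)
  show "f n \<otimes> g h \<in> carrier G" if "n \<in> carrier N" "h \<in> carrier H" for n h
    using that cl by auto
  fix n h n' h' assume a: "n \<in> carrier N" "h \<in> carrier H" "n' \<in> carrier N" "h' \<in> carrier H"
  have "f (n \<otimes>\<^bsub>N\<^esub> phi h n') \<otimes> g (h \<otimes>\<^bsub>H\<^esub> h') = f n \<otimes> (f (phi h n') \<otimes> g h) \<otimes> g h'"
    using a f g cl phi by (simp add: hom_mult m_assoc)
  also have "\<dots> = f n \<otimes> g h \<otimes> (f n' \<otimes> g h')"
    using a cl by (simp add: m_assoc flip: conj)
  finally show "f (n \<otimes>\<^bsub>N\<^esub> phi h n') \<otimes> g (h \<otimes>\<^bsub>H\<^esub> h') = f n \<otimes> g h \<otimes> (f n' \<otimes> g h')" .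
qed

text \<open>Since \<open>f\<close> and \<open>g\<close> are homomorphisms separately, an equality
  \<open>f n \<otimes> g h = f n' \<otimes> g h'\<close> becomes
  \<open>f (n'^-1 n) \<otimes> g (h h'^-1) = \<one>\<close>, to which \<open>ker\<close> applies.
  The multiplication of the semidirect product does not enter.\<close>

lemma inj_on_semidirect_prod:
  assumes "group N" "group H" and f: "f \<in> hom N G" and g: "g \<in> hom H G"
    and ker: "\<And>n h. n \<in> carrier N \<Longrightarrow> h \<in> carrier H \<Longrightarrow> f n \<otimes> g h = \<one> \<Longrightarrow> n = \<one>\<^bsub>N\<^esub> \<and> h = \<one>\<^bsub>H\<^esub>"
  shows "inj_on (\<lambda>(n, h). f n \<otimes> g h) (carrier N \<times> carrier H)"
proof (rule inj_onI, clarify)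
  interpret N: group N by fact
  interpret H: group H by fact
  interpret f: group_hom N G f by unfold_locales fact
  interpret g: group_hom H G g by unfold_locales fact
  fix n h n' h' assume a: "n \<in> carrier N" "h \<in> carrier H" "n' \<in> carrier N" "h' \<in> carrier H"
    and eq: "f n \<otimes> g h = f n' \<otimes> g h'"
  have "f (inv\<^bsub>N\<^esub> n' \<otimes>\<^bsub>N\<^esub> n) \<otimes> g (h \<otimes>\<^bsub>H\<^esub> inv\<^bsub>H\<^esub> h') = inv (f n') \<otimes> (f n \<otimes> g h) \<otimes> inv (g h')"
    using a by (simp add: m_assoc)
  also have "\<dots> = \<one>"
    unfolding eq using a by (simp add: m_assoc flip: m_assoc[of "inv (f n')" "f n'"])
  finally have "f (inv\<^bsub>N\<^esub> n' \<otimes>\<^bsub>N\<^esub> n) \<otimes> g (h \<otimes>\<^bsub>H\<^esub> inv\<^bsub>H\<^esub> h') = \<one>" .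
  then have "inv\<^bsub>N\<^esub> n' \<otimes>\<^bsub>N\<^esub> n = \<one>\<^bsub>N\<^esub>" "h \<otimes>\<^bsub>H\<^esub> inv\<^bsub>H\<^esub> h' = \<one>\<^bsub>H\<^esub>"
    using ker[of "inv\<^bsub>N\<^esub> n' \<otimes>\<^bsub>N\<^esub> n" "h \<otimes>\<^bsub>H\<^esub> inv\<^bsub>H\<^esub> h'"] a by blast+
  then show "n = n' \<and> h = h'"
    using a by (metis N.inv_closed N.inv_equality N.inv_inv H.inv_closed H.inv_equality H.inv_inv)
qed

text \<open>The criterion behind all seven recognition lemmas: \<open>surj\<close> is existence and
  \<open>ker\<close> uniqueness of the normal form \<open>f n \<otimes> g h\<close>, while
  \<open>conj\<close> identifies \<open>phi\<close> with conjugation in the group.\<close>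

lemma is_iso_semidirect_prod:
  assumes "group N" "group H" and f: "f \<in> hom N G" and g: "g \<in> hom H G"
    and phi: "\<And>n h. n \<in> carrier N \<Longrightarrow> h \<in> carrier H \<Longrightarrow> phi h n \<in> carrier N"
    and conj: "\<And>n h. n \<in> carrier N \<Longrightarrow> h \<in> carrier H \<Longrightarrow> g h \<otimes> f n = f (phi h n) \<otimes> g h"
    and ker: "\<And>n h. n \<in> carrier N \<Longrightarrow> h \<in> carrier H \<Longrightarrow> f n \<otimes> g h = \<one> \<Longrightarrow> n = \<one>\<^bsub>N\<^esub> \<and> h = \<one>\<^bsub>H\<^esub>"
    and surj: "\<And>y. y \<in> carrier G \<Longrightarrow> \<exists>n \<in> carrier N. \<exists>h \<in> carrier H. y = f n \<otimes> g h"
  shows "G \<cong> semidirect_prod N H phi"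
proof -
  let ?S = "semidirect_prod N H phi" and ?F = "\<lambda>(n, h). f n \<otimes> g h"
  interpret N: group N by fact
  interpret H: group H by fact
  have hom: "?F \<in> hom ?S G"
    by (rule hom_semidirect_prod[where phi = phi, OF f g]) (use phi conj in blast)+
  have "?F ` carrier ?S = carrier G"
  proof (intro subset_antisym subsetI)
    fix y assume "y \<in> ?F ` carrier ?S"
    then show "y \<in> carrier G" using hom_in_carrier[OF hom] by blast
  next
    fix y assume "y \<in> carrier G"
    then obtain n h where "n \<in> carrier N" "h \<in> carrier H" "y = f n \<otimes> g h"
      using surj by blast
    then show "y \<in> ?F ` carrier ?S" by (intro image_eqI[of _ _ "(n, h)"]) simp_all
  qed
  moreover have "inj_on ?F (carrier ?S)"
    unfolding carrier_semidirect_prod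
    by (rule inj_on_semidirect_prod[OF assms(1-4)]) (use ker in blast)+
  ultimately have bij: "bij_betw ?F (carrier ?S) (carrier G)"
    by (simp add: bij_betw_def)
  have closed: "p \<otimes>\<^bsub>?S\<^esub> q \<in> carrier ?S" if "p \<in> carrier ?S" "q \<in> carrier ?S" for p q
    using that phi by (cases p; cases q) auto
  \<comment> \<open>Checked directly from bijectivity and closure, since \<open>?S\<close> has not
    been shown to be a group here.\<close>
  have "inv_into (carrier ?S) ?F \<in> hom G ?S"
  proof (rule homI)
    fix x y assume xy: "x \<in> carrier G" "y \<in> carrier G"
    let ?k = "inv_into (carrier ?S) ?F"
    have k: "?k w \<in> carrier ?S" "?F (?k w) = w" if "w \<in> carrier G" for w
      using that bij by (auto simp: bij_betw_def inv_into_into f_inv_into_f)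
    show "?k x \<in> carrier ?S" using k xy by blast
    show "?k (x \<otimes> y) = ?k x \<otimes>\<^bsub>?S\<^esub> ?k y"
      using bij closed k xy hom_mult[OF hom, of "?k x" "?k y"]
      by (intro inv_into_f_eq) (auto simp: bij_betw_def)
  qed
  then show ?thesis
    using bij_betw_inv_into[OF bij] by (auto simp: is_iso_def iso_def)
qed

section \<open>Powers, and rewriting of words in generators\<close>

lemma hom_Zn:
  assumes "a \<in> carrier G" "a [^] k = \<one>" "k > 0"
  shows "(\<lambda>i. a [^] i) \<in> hom (Zn k) G"
proof (rule homI)
  fix i j assume "i \<in> carrier (Zn k)" "j \<in> carrier (Zn k)"
  have "a [^] (n mod int k) = a [^] n" for n :: int
  proof -
    have "a [^] n = a [^] (int k * (n div int k)) \<otimes> a [^] (n mod int k)"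
      using assms(1) by (simp flip: int_pow_mult)
    also have "a [^] (int k * (n div int k)) = (a [^] int k) [^] (n div int k)"
      using assms(1) by (simp only: int_pow_pow)
    also have "\<dots> = \<one>"
      using assms by (simp add: int_pow_int)
    finally show ?thesis
      using assms(1) by simp
  qed
  then show "a [^] (i \<otimes>\<^bsub>Zn k\<^esub> j) = a [^] i \<otimes> a [^] j"
    using assms by (simp add: int_pow_mult)
qed (use assms in simp)

lemma int_pow_numerals:
  assumes "a \<in> carrier G"
  shows "a [^] (1::int) = a" "a [^] (2::int) = a \<otimes> a" "a [^] (3::int) = a \<otimes> (a \<otimes> a)"
    "a [^] (4::int) = a \<otimes> (a \<otimes> (a \<otimes> a))" "a [^] (5::int) = a \<otimes> (a \<otimes> (a \<otimes> (a \<otimes> a)))"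
  using assms by (simp_all add: int_pow_def2 numeral_eq_Suc m_assoc)

text \<open>The relation \<open>a \<otimes> (a \<otimes> a) = \<one>\<close> in the form that fires
  in front of a further factor; \<open>m_assoc_subst\<close> only treats relations with two letters
  on the left.\<close>

lemma cube_cancel:
  "a \<otimes> (a \<otimes> a) = \<one> \<Longrightarrow> a \<in> carrier G \<Longrightarrow> d \<in> carrier G \<Longrightarrow> a \<otimes> (a \<otimes> (a \<otimes> d)) = d"
  by (metis l_one m_assoc m_closed)

lemma left_cancel:
  "x \<in> carrier G \<Longrightarrow> y \<in> carrier G \<Longrightarrow> w \<in> carrier G \<Longrightarrow> x \<otimes> y = x \<otimes> w \<longleftrightarrow> y = w"
  by (metis Units_eq Units_l_cancel)

text \<open>Turns a relation \<open>ab = c\<close> into a rewrite rule that applies inside right-associated words.\<close>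

lemma m_assoc_subst:
  "a \<otimes> b = c \<Longrightarrow> a \<in> carrier G \<Longrightarrow> b \<in> carrier G \<Longrightarrow> d \<in> carrier G \<Longrightarrow> a \<otimes> (b \<otimes> d) = c \<otimes> d"
  by (simp flip: m_assoc)

end

section \<open>Homomorphisms from the symmetric group of degree 3 and the alternating group of degree 4\<close>

text \<open>In \<open>A4_model\<close> the exponents of \<open>s\<^sup>i t\<^sup>j\<close> are transformed by the 3-cycle \<open>s \<mapsto> t \<mapsto> st\<close>.\<close>

definition S3_model :: "(int \<times> int) monoid" where
  "S3_model = semidirect_prod (Zn 3) (Zn 2) (\<lambda>b a. if b = 0 then a else (- a) mod 3)"

definition A4_model :: "((int \<times> int) \<times> int) monoid" where
  "A4_model = semidirect_prod (Zn 2 \<times>\<times> Zn 2) (Zn 3)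
     (\<lambda>k (i, j). if k = 0 then (i, j) else if k = 1 then (j, (i + j) mod 2) else ((i + j) mod 2, i))"

lemma group_S3_model: "group S3_model"
  unfolding S3_model_def by (rule group_semidirect_prod) (auto simp: carrier_Zn hom_def)

lemma group_A4_model: "group A4_model"
  unfolding A4_model_def
  by (rule group_semidirect_prod) (auto simp: carrier_Zn hom_def DirProd_group)

lemma group_Dic3: "group Dic3"
  unfolding Dic3_def by (rule group_semidirect_prod) (auto simp: carrier_Zn hom_def)

context group
begin

text \<open>The relations move \<open>x\<close> to the right past \<open>r\<close> and write the
  inverse of \<open>r\<close> as a square; used as rewrite rules they bring every word to the form
  \<open>r^i x^j\<close>.\<close>

lemma hom_S3_model:
  assumes [simp]: "r \<in> carrier G" "x \<in> carrier G"
    and r: "r \<otimes> (r \<otimes> r) = \<one>" and x: "x \<otimes> x = \<one>" and xr: "x \<otimes> r = r \<otimes> (r \<otimes> x)"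
  shows "(\<lambda>(i, j). r [^] i \<otimes> x [^] j) \<in> hom S3_model G"
  unfolding S3_model_def
proof (rule hom_semidirect_prod)
  show "(\<lambda>i. r [^] i) \<in> hom (Zn 3) G" "(\<lambda>i. x [^] i) \<in> hom (Zn 2) G"
    by (rule hom_Zn; simp add: numeral_eq_Suc r x m_assoc)+
next
  fix i j assume "i \<in> carrier (Zn 3)" "j \<in> carrier (Zn 2)"
  then show "x [^] j \<otimes> r [^] i = r [^] (if j = 0 then i else (- i) mod 3) \<otimes> x [^] j"
    by (auto simp: carrier_Zn int_pow_numerals m_assoc r x xr
      cube_cancel[OF r] m_assoc_subst[OF x] m_assoc_subst[OF xr])
qed (auto simp: carrier_Zn)

text \<open>If \<open>r^i x\<close> were trivial, \<open>x\<close> would be a power of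
  \<open>r\<close> and commute with it, and the relation \<open>xr\<close> would then give
  \<open>r = \<one>\<close>.\<close>

lemma inj_S3_model:
  assumes [simp]: "r \<in> carrier G" "x \<in> carrier G"
    and r: "r \<otimes> (r \<otimes> r) = \<one>" and x: "x \<otimes> x = \<one>" and xr: "x \<otimes> r = r \<otimes> (r \<otimes> x)"
    and ne: "r \<noteq> \<one>" "x \<noteq> \<one>"
  shows "inj_on (\<lambda>(i, j). r [^] i \<otimes> x [^] j) (carrier S3_model)"
  unfolding S3_model_def carrier_semidirect_prod
proof (rule inj_on_semidirect_prod)
  show "(\<lambda>i. r [^] i) \<in> hom (Zn 3) G" "(\<lambda>i. x [^] i) \<in> hom (Zn 2) G"
    by (rule hom_Zn; simp add: numeral_eq_Suc r x m_assoc)+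
next
  fix i j assume ij: "i \<in> carrier (Zn 3)" "j \<in> carrier (Zn 2)" and eq: "r [^] i \<otimes> x [^] j = \<one>"
  have j: "j = 0"
  proof (rule ccontr)
    assume "j \<noteq> 0"
    then have "r [^] i \<otimes> x = \<one>" using ij eq by (auto simp: carrier_Zn int_pow_numerals)
    then have "x = inv (r [^] i)" by (metis assms(1,2) int_pow_closed inv_equality inv_inv)
    then have "x \<otimes> r = r \<otimes> x"
      by (metis assms(1) int_pow_neg int_pow_mult int_pow_1 add.commute)
    then show False using xr ne by (metis assms(1,2) left_cancel m_closed r_cancel_one r_one m_assoc)
  qed
  with eq have "r [^] i = \<one>" by simp
  then have "i = 0"
    using ij ne r by (auto simp: carrier_Zn int_pow_numerals)
  with j show "i = \<one>\<^bsub>Zn 3\<^esub> \<and> j = \<one>\<^bsub>Zn 2\<^esub>" by simp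
qed simp_all

lemma hom_V4:
  assumes [simp]: "s \<in> carrier G" "t \<in> carrier G"
    and s: "s \<otimes> s = \<one>" and t: "t \<otimes> t = \<one>" and ts: "t \<otimes> s = s \<otimes> t"
  shows "(\<lambda>(i, j). s [^] i \<otimes> t [^] j) \<in> hom (Zn 2 \<times>\<times> Zn 2) G"
  unfolding DirProd_eq_semidirect_prod
proof (rule hom_semidirect_prod)
  show "(\<lambda>i. s [^] i) \<in> hom (Zn 2) G" "(\<lambda>i. t [^] i) \<in> hom (Zn 2) G"
    by (rule hom_Zn; simp add: numeral_eq_Suc s t m_assoc)+
qed (auto simp: carrier_Zn int_pow_numerals ts)

lemma hom_A4_model:
  assumes [simp]: "s \<in> carrier G" "t \<in> carrier G" "r \<in> carrier G"
    and s: "s \<otimes> s = \<one>" and t: "t \<otimes> t = \<one>" and ts: "t \<otimes> s = s \<otimes> t"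
    and r: "r \<otimes> (r \<otimes> r) = \<one>" and rs: "r \<otimes> s = t \<otimes> r" and rt: "r \<otimes> t = s \<otimes> (t \<otimes> r)"
  shows "(\<lambda>((i, j), k). (s [^] i \<otimes> t [^] j) \<otimes> r [^] k) \<in> hom A4_model G"
proof -
  have "(\<lambda>(p, k). (case p of (i, j) \<Rightarrow> s [^] i \<otimes> t [^] j) \<otimes> r [^] k) \<in> hom A4_model G"
    unfolding A4_model_def
  proof (rule hom_semidirect_prod)
    show "(\<lambda>(i, j). s [^] i \<otimes> t [^] j) \<in> hom (Zn 2 \<times>\<times> Zn 2) G"
      by (rule hom_V4) (simp_all add: s t ts)
    show "(\<lambda>i. r [^] i) \<in> hom (Zn 3) G"
      by (rule hom_Zn; simp add: numeral_eq_Suc r m_assoc)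
  next
    fix p k assume "p \<in> carrier (Zn 2 \<times>\<times> Zn 2)" "k \<in> carrier (Zn 3)"
    then show "r [^] k \<otimes> (case p of (i, j) \<Rightarrow> s [^] i \<otimes> t [^] j) =
        (case (case p of (i, j) \<Rightarrow> if k = 0 then (i, j) else if k = 1 then (j, (i + j) mod 2)
          else ((i + j) mod 2, i)) of (i, j) \<Rightarrow> s [^] i \<otimes> t [^] j) \<otimes> r [^] k"
      by (auto simp: carrier_Zn int_pow_numerals m_assoc s t ts r rs rt
        m_assoc_subst[OF s] m_assoc_subst[OF t] m_assoc_subst[OF ts]
        cube_cancel[OF r] m_assoc_subst[OF rs] m_assoc_subst[OF rt])
  qed (auto simp: carrier_Zn)
  then show ?thesis by (simp add: case_prod_unfold)
qed

lemma inj_A4_model: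
  assumes [simp]: "s \<in> carrier G" "t \<in> carrier G" "r \<in> carrier G"
    and s: "s \<otimes> s = \<one>" and t: "t \<otimes> t = \<one>" and ts: "t \<otimes> s = s \<otimes> t"
    and r: "r \<otimes> (r \<otimes> r) = \<one>" and rs: "r \<otimes> s = t \<otimes> r" and rt: "r \<otimes> t = s \<otimes> (t \<otimes> r)"
    and ne: "s \<noteq> \<one>" "t \<noteq> \<one>" "s \<noteq> t"
  shows "inj_on (\<lambda>((i, j), k). (s [^] i \<otimes> t [^] j) \<otimes> r [^] k) (carrier A4_model)"
proof -
  have "inj_on (\<lambda>(p, k). (case p of (i, j) \<Rightarrow> s [^] i \<otimes> t [^] j) \<otimes> r [^] k) (carrier A4_model)"
    unfolding A4_model_def carrier_semidirect_prod
  proof (rule inj_on_semidirect_prod)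
    show "(\<lambda>(i, j). s [^] i \<otimes> t [^] j) \<in> hom (Zn 2 \<times>\<times> Zn 2) G"
      by (rule hom_V4) (simp_all add: s t ts)
    show "(\<lambda>i. r [^] i) \<in> hom (Zn 3) G"
      by (rule hom_Zn; simp add: numeral_eq_Suc r m_assoc)
  next
    fix p k assume pk: "p \<in> carrier (Zn 2 \<times>\<times> Zn 2)" "k \<in> carrier (Zn 3)"
      and eq: "(case p of (i, j) \<Rightarrow> s [^] i \<otimes> t [^] j) \<otimes> r [^] k = \<one>"
    obtain i j where p: "p = (i, j)" by force
    have st: "s \<otimes> t \<noteq> \<one>" using ne s by (metis assms(1,2) left_cancel)
    have k: "k = 0"
    proof (rule ccontr)
      assume "k \<noteq> 0"
      \<comment> \<open>For \<open>k \<noteq> 0\<close> this word conjugates \<open>s\<close> to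
        \<open>t\<close> or to \<open>s \<otimes> t\<close>, because its first factor commutes with
        all of these; the identity does neither.\<close>
      let ?w = "(s [^] i \<otimes> t [^] j) \<otimes> r [^] k"
      have "?w \<otimes> s = s" using eq p by simp
      moreover have "?w \<otimes> s = t \<otimes> ?w \<or> ?w \<otimes> s = (s \<otimes> t) \<otimes> ?w"
        using pk p \<open>k \<noteq> 0\<close> 
        by (auto simp: carrier_Zn int_pow_numerals m_assoc s t ts r rs rt
          m_assoc_subst[OF s] m_assoc_subst[OF t] m_assoc_subst[OF ts]
          cube_cancel[OF r] m_assoc_subst[OF rs] m_assoc_subst[OF rt])
      ultimately have "s = t \<or> s = s \<otimes> t" using eq p by auto
      then show False using ne by simp
    qed
    with eq p have "s [^] i \<otimes> t [^] j = \<one>" by simp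
    then have "i = 0 \<and> j = 0"
      using pk ne st by (auto simp: p carrier_Zn int_pow_numerals)
    with k p show "p = \<one>\<^bsub>Zn 2 \<times>\<times> Zn 2\<^esub> \<and> k = \<one>\<^bsub>Zn 3\<^esub>" by simp
  qed (simp_all add: DirProd_group)
  then show ?thesis by (simp add: case_prod_unfold)
qed

end

text \<open>The models play the role of presentations: a homomorphism is built on the model, where
  words are explicit, and carried over to the permutation group.\<close>

lemma hom_extend_along_iso:
  assumes "group S" and F: "F \<in> iso S A" and h: "h \<in> hom S G"
  obtains f where "f \<in> hom A G" "\<And>p. p \<in> carrier S \<Longrightarrow> f (F p) = h p"
    "inj_on h (carrier S) \<Longrightarrow> inj_on f (carrier A)"
proof -
  interpret S: group S by fact
  let ?k = "inv_into (carrier S) F"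
  have bij: "bij_betw F (carrier S) (carrier A)" using F by (simp add: iso_def)
  have k: "?k \<in> iso A S" using S.iso_set_sym[OF F] .
  then have "h \<circ> ?k \<in> hom A G" using h by (auto simp: iso_def intro: hom_compose)
  moreover have "(h \<circ> ?k) (F p) = h p" if "p \<in> carrier S" for p
    using bij that by (simp add: bij_betw_def)
  moreover have "inj_on (h \<circ> ?k) (carrier A)" if "inj_on h (carrier S)"
    using k that by (auto simp: iso_def bij_betw_def intro: comp_inj_on)
  ultimately show ?thesis using that by blast
qed

text \<open>The cycle 1 -> 3 -> 2 -> 1. Of the two 3-cycles on {1, 2, 3} it is the one that
  conjugates \<open>v1\<close> to \<open>v2\<close> and \<open>v2\<close> to
  \<open>v1 \<circ> v2\<close>, as \<open>A4_model\<close> demands; \<open>tau\<close> is the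
  transposition in \<open>SG_72_43\<close>.\<close>

definition rho :: "nat \<Rightarrow> nat" where "rho = transpose 1 3 \<circ> transpose 2 3"
definition tau :: "nat \<Rightarrow> nat" where "tau = transpose 1 2"
definition v1 :: "nat \<Rightarrow> nat" where "v1 = transpose 1 2 \<circ> transpose 3 4"
definition v2 :: "nat \<Rightarrow> nat" where "v2 = transpose 1 3 \<circ> transpose 2 4"

lemma perm_relations:
  "rho \<circ> (rho \<circ> rho) = id" "tau \<circ> tau = id" "tau \<circ> rho = rho \<circ> (rho \<circ> tau)"
  "v1 \<circ> v1 = id" "v2 \<circ> v2 = id" "v2 \<circ> v1 = v1 \<circ> v2" "rho \<circ> v1 = v2 \<circ> rho"
  "rho \<circ> v2 = v1 \<circ> (v2 \<circ> rho)"
  "tau \<circ> v1 = v1 \<circ> tau" "tau \<circ> v2 = v1 \<circ> (v2 \<circ> tau)"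
  by (auto simp: rho_def tau_def v1_def v2_def fun_eq_iff transpose_def)

lemma perm_distinct: "rho \<noteq> id" "tau \<noteq> id" "v1 \<noteq> id" "v2 \<noteq> id" "v1 \<noteq> v2"
proof -
  show "rho \<noteq> id" "tau \<noteq> id" "v1 \<noteq> id" "v2 \<noteq> id"
    by (auto dest!: fun_cong[of _ _ 1] simp: rho_def tau_def v1_def v2_def transpose_def)
  have "v1 1 \<noteq> v2 1" by (simp add: v1_def v2_def transpose_def)
  then show "v1 \<noteq> v2" by metis
qed

lemma perm_in_carrier:
  "rho \<in> carrier (sym_group 3)" "tau \<in> carrier (sym_group 3)"
  "v1 \<in> carrier (alt_group 4)" "v2 \<in> carrier (alt_group 4)" "rho \<in> carrier (alt_group 4)"
  by (auto simp: rho_def tau_def v1_def v2_def sym_group_carrier alt_group_carrier evenperm_comp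
    permutation_swap_id evenperm_swap intro!: permutes_compose permutes_swap_id)

lemma iso_sym_group_3:
  "(\<lambda>(i, j). rho [^]\<^bsub>sym_group 3\<^esub> (i::int) \<otimes>\<^bsub>sym_group 3\<^esub> tau [^]\<^bsub>sym_group 3\<^esub> (j::int)) \<in> iso S3_model (sym_group 3)"
    (is "?F \<in> _")
proof -
  interpret S: group "sym_group 3" by (rule sym_group_is_group)
  have hom: "?F \<in> hom S3_model (sym_group 3)"
    by (rule S.hom_S3_model) (auto simp: perm_in_carrier perm_relations sym_group_mult sym_group_one)
  have inj: "inj_on ?F (carrier S3_model)"
    by (rule S.inj_S3_model)
      (auto simp: perm_in_carrier perm_relations sym_group_mult sym_group_one perm_distinct)
  have "?F ` carrier S3_model = carrier (sym_group 3)"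
  proof (rule card_subset_eq)
    have c: "card (carrier (sym_group 3)) = 6" by (simp add: sym_group_card_carrier fact_numeral)
    \<comment> \<open>An infinite set has \<open>card\<close> 0, so a nonzero cardinality already
      gives finiteness.\<close>
    then show "finite (carrier (sym_group 3))" by (metis card.infinite zero_neq_numeral)
    show "?F ` carrier S3_model \<subseteq> carrier (sym_group 3)"
      by (rule image_subsetI, rule hom_in_carrier[OF hom])
    show "card (?F ` carrier S3_model) = card (carrier (sym_group 3))"
      using inj by (simp add: c card_image) (simp add: S3_model_def carrier_Zn card_cartesian_product)
  qed
  with hom inj show ?thesis by (simp add: iso_def bij_betw_def)
qed

lemma iso_alt_group_4:
  "(\<lambda>((i, j), k). (v1 [^]\<^bsub>alt_group 4\<^esub> (i::int) \<otimes>\<^bsub>alt_group 4\<^esub> v2 [^]\<^bsub>alt_group 4\<^esub> (j::int))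
     \<otimes>\<^bsub>alt_group 4\<^esub> rho [^]\<^bsub>alt_group 4\<^esub> (k::int)) \<in> iso A4_model (alt_group 4)" (is "?F \<in> _")
proof -
  interpret S: group "alt_group 4" by (rule alt_group_is_group)
  have hom: "?F \<in> hom A4_model (alt_group 4)"
    by (rule S.hom_A4_model) (auto simp: perm_in_carrier perm_relations alt_group_mult alt_group_one)
  have inj: "inj_on ?F (carrier A4_model)"
    by (rule S.inj_A4_model)
      (auto simp: perm_in_carrier perm_relations alt_group_mult alt_group_one perm_distinct)
  have "?F ` carrier A4_model = carrier (alt_group 4)"
  proof (rule card_subset_eq)
    have c: "card (carrier (alt_group 4)) = 12"
      using alt_group_card_carrier[of 4] by (simp add: fact_numeral)
    then show "finite (carrier (alt_group 4))" by (metis card.infinite zero_neq_numeral)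
    show "?F ` carrier A4_model \<subseteq> carrier (alt_group 4)"
      by (rule image_subsetI, rule hom_in_carrier[OF hom])
    show "card (?F ` carrier A4_model) = card (carrier (alt_group 4))"
      using inj by (simp add: c card_image) (simp add: A4_model_def carrier_Zn card_cartesian_product)
  qed
  with hom inj show ?thesis by (simp add: iso_def bij_betw_def)
qed

context group
begin

text \<open>The image is listed as a set of words because the recognition lemmas read it both ways:
  to write \<open>f p\<close> as a word, and to find a preimage of a given word.\<close>

lemma obtain_sym_group_3_hom:
  assumes "r \<in> carrier G" "x \<in> carrier G"
    and "r \<otimes> (r \<otimes> r) = \<one>" "x \<otimes> x = \<one>" "x \<otimes> r = r \<otimes> (r \<otimes> x)" "r \<noteq> \<one>" "x \<noteq> \<one>"
  obtains f where "f \<in> hom (sym_group 3) G" "inj_on f (carrier (sym_group 3))"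
    "f ` carrier (sym_group 3) = (\<lambda>(i, j). r [^] i \<otimes> x [^] j) ` ({0, 1, 2::int} \<times> {0, 1::int})"
proof -
  let ?h = "\<lambda>(i, j). r [^] i \<otimes> x [^] j"
  let ?F = "\<lambda>(i, j). rho [^]\<^bsub>sym_group 3\<^esub> i \<otimes>\<^bsub>sym_group 3\<^esub> tau [^]\<^bsub>sym_group 3\<^esub> j"
  obtain f where f: "f \<in> hom (sym_group 3) G" "\<And>p. p \<in> carrier S3_model \<Longrightarrow> f (?F p) = ?h p"
    "inj_on ?h (carrier S3_model) \<Longrightarrow> inj_on f (carrier (sym_group 3))"
    using hom_extend_along_iso[OF group_S3_model iso_sym_group_3 hom_S3_model[OF assms(1-5)]] by blast
  have "carrier (sym_group 3) = ?F ` carrier S3_model"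
    using iso_sym_group_3 by (simp add: iso_def bij_betw_def)
  then have "f ` carrier (sym_group 3) = (\<lambda>p. f (?F p)) ` carrier S3_model"
    by (simp add: image_image)
  also have "\<dots> = ?h ` carrier S3_model"
    using f(2) by (rule image_cong[OF refl])
  also have "\<dots> = (\<lambda>(i, j). r [^] i \<otimes> x [^] j) ` ({0, 1, 2::int} \<times> {0, 1::int})"
    by (simp add: S3_model_def carrier_Zn)
  finally show ?thesis
    using that f inj_S3_model[OF assms] by blast
qed

text \<open>The values on the generators are recorded for \<open>iso_SG_72_43\<close>, where the
  action of an outer element is compared on generators.\<close>

lemma obtain_alt_group_4_hom:
  assumes "s \<in> carrier G" "t \<in> carrier G" "r \<in> carrier G"
    and "s \<otimes> s = \<one>" "t \<otimes> t = \<one>" "t \<otimes> s = s \<otimes> t"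
    and "r \<otimes> (r \<otimes> r) = \<one>" "r \<otimes> s = t \<otimes> r" "r \<otimes> t = s \<otimes> (t \<otimes> r)"
    and "s \<noteq> \<one>" "t \<noteq> \<one>" "s \<noteq> t"
  obtains f where "f \<in> hom (alt_group 4) G" "inj_on f (carrier (alt_group 4))"
    "f ` carrier (alt_group 4) =
      (\<lambda>((i, j), k). (s [^] i \<otimes> t [^] j) \<otimes> r [^] k) ` (({0, 1::int} \<times> {0, 1::int}) \<times> {0, 1, 2::int})"
    "f v1 = s" "f v2 = t" "f rho = r"
proof -
  let ?h = "\<lambda>((i, j), k). (s [^] i \<otimes> t [^] j) \<otimes> r [^] k"
  let ?F = "\<lambda>((i, j), k). (v1 [^]\<^bsub>alt_group 4\<^esub> i \<otimes>\<^bsub>alt_group 4\<^esub> v2 [^]\<^bsub>alt_group 4\<^esub> j)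
     \<otimes>\<^bsub>alt_group 4\<^esub> rho [^]\<^bsub>alt_group 4\<^esub> k"
  interpret A: group "alt_group 4" by (rule alt_group_is_group)
  obtain f where f: "f \<in> hom (alt_group 4) G" "\<And>p. p \<in> carrier A4_model \<Longrightarrow> f (?F p) = ?h p"
    "inj_on ?h (carrier A4_model) \<Longrightarrow> inj_on f (carrier (alt_group 4))"
    using hom_extend_along_iso[OF group_A4_model iso_alt_group_4 hom_A4_model[OF assms(1-9)]] by blast
  have c: "((1, 0), 0) \<in> carrier A4_model" "((0, 1), 0) \<in> carrier A4_model" "((0, 0), 1) \<in> carrier A4_model"
    by (auto simp: A4_model_def carrier_Zn)
  have gens: "f v1 = s" "f v2 = t" "f rho = r"
    using c[THEN f(2)] assms perm_in_carrier by (simp_all add: int_pow_numerals A.int_pow_numerals)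
  have "carrier (alt_group 4) = ?F ` carrier A4_model"
    using iso_alt_group_4 by (simp add: iso_def bij_betw_def)
  then have "f ` carrier (alt_group 4) = (\<lambda>p. f (?F p)) ` carrier A4_model"
    by (simp add: image_image)
  also have "\<dots> = ?h ` carrier A4_model"
    using f(2) by (rule image_cong[OF refl])
  also have "\<dots> = (\<lambda>((i, j), k). (s [^] i \<otimes> t [^] j) \<otimes> r [^] k) ` (({0, 1::int} \<times> {0, 1::int}) \<times> {0, 1, 2::int})"
    by (simp add: A4_model_def carrier_Zn)
  finally show ?thesis
    using that f inj_A4_model[OF assms] gens by blast
qed

end

text \<open>Every even permutation of four points is a word \<open>v1^i v2^j rho^k\<close>, so a
  property stable under composition only has to be checked on the generators and the
  identity.\<close>

lemma alt_group_4_induct [consumes 1, case_names id v1 v2 rho comp]: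
  assumes p: "p \<in> carrier (alt_group 4)" and gens: "P id" "P v1" "P v2" "P rho"
    and comp: "\<And>p q. p \<in> carrier (alt_group 4) \<Longrightarrow> q \<in> carrier (alt_group 4) \<Longrightarrow> P p \<Longrightarrow> P q \<Longrightarrow> P (p \<circ> q)"
  shows "P p"
proof -
  interpret A: group "alt_group 4" by (rule alt_group_is_group)
  have pow: "a [^]\<^bsub>alt_group 4\<^esub> i \<in> carrier (alt_group 4) \<and> P (a [^]\<^bsub>alt_group 4\<^esub> i)"
    if "i \<in> {0, 1, 2::int}" "a \<in> carrier (alt_group 4)" "P a" for a i
    using that comp[of a a] gens(1) by (auto simp: A.int_pow_numerals alt_group_mult alt_group_one)
  \<comment> \<open>All three exponents get the common range up to 2, so that \<open>pow\<close>
    applies to each of them alike.\<close>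
  obtain i j k where "i \<in> {0, 1, 2::int}" "j \<in> {0, 1, 2::int}" "k \<in> {0, 1, 2::int}"
    "p = (v1 [^]\<^bsub>alt_group 4\<^esub> i \<otimes>\<^bsub>alt_group 4\<^esub> v2 [^]\<^bsub>alt_group 4\<^esub> j) \<otimes>\<^bsub>alt_group 4\<^esub> rho [^]\<^bsub>alt_group 4\<^esub> k"
  proof -
    have "p \<in> (\<lambda>((i, j), k). (v1 [^]\<^bsub>alt_group 4\<^esub> (i::int) \<otimes>\<^bsub>alt_group 4\<^esub> v2 [^]\<^bsub>alt_group 4\<^esub> (j::int))
     \<otimes>\<^bsub>alt_group 4\<^esub> rho [^]\<^bsub>alt_group 4\<^esub> (k::int)) ` carrier A4_model"
      using p iso_alt_group_4 by (simp add: iso_def bij_betw_def)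
    then obtain w where "w \<in> carrier A4_model" and
      "p = (\<lambda>((i, j), k). (v1 [^]\<^bsub>alt_group 4\<^esub> (i::int) \<otimes>\<^bsub>alt_group 4\<^esub> v2 [^]\<^bsub>alt_group 4\<^esub> (j::int))
     \<otimes>\<^bsub>alt_group 4\<^esub> rho [^]\<^bsub>alt_group 4\<^esub> (k::int)) w"
      by blast
    then show ?thesis using that by (auto simp: A4_model_def carrier_Zn)
  qed
  then show ?thesis
    using pow[of i v1] pow[of j v2] pow[of k rho] gens perm_in_carrier A.m_closed
      comp by (metis alt_group_mult)
qed

section \<open>Three involutions centralising an element of order 3\<close>

context group
begin

lemma pow_numerals_order_2:
  assumes "a \<in> carrier G" "a \<otimes> a = \<one>"
  shows "a [^] (2::nat) = \<one>" "a [^] (3::nat) = a" "a [^] (4::nat) = \<one>" "a [^] (6::nat) = \<one>"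
  using assms by (simp_all add: numeral_eq_Suc)

lemma pow_numerals_order_3:
  assumes "a \<in> carrier G" "a \<otimes> (a \<otimes> a) = \<one>"
  shows "a [^] (2::nat) = a \<otimes> a" "a [^] (3::nat) = \<one>" "a [^] (4::nat) = a" "a [^] (6::nat) = \<one>"
  using assms by (simp_all add: numeral_eq_Suc m_assoc)

lemma conj_pow:
  assumes "g \<in> carrier G" "y \<in> carrier G" "y' \<in> carrier G" "g \<otimes> y = y' \<otimes> g"
  shows "g \<otimes> y [^] (n::nat) = y' [^] n \<otimes> g"
proof (induction n)
  case (Suc n)
  have "g \<otimes> y [^] Suc n = (g \<otimes> y [^] n) \<otimes> y" using assms by (simp add: m_assoc)
  also have "\<dots> = y' [^] n \<otimes> (g \<otimes> y)" using assms(1-3) by (simp add: Suc m_assoc)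
  also have "\<dots> = y' [^] Suc n \<otimes> g" unfolding assms(4) using assms(1-3) by (simp add: m_assoc)
  finally show ?case .
qed (use assms in simp)

lemma conj_one_iff:
  assumes "g \<in> carrier G" "y \<in> carrier G" "y' \<in> carrier G" "g \<otimes> y = y' \<otimes> g"
  shows "y' = \<one> \<longleftrightarrow> y = \<one>"
  using assms by (metis l_one r_one left_cancel right_cancel one_closed)

end

text \<open>The hypotheses on \<open>G\<close> in terms of powers. Element orders 1, 2, 3, 4, 6 are
  those dividing 4 or 6, whence \<open>exponent\<close>. In \<open>order_6\<close>, the two elements
  offered for each \<open>x\<close> are the two generators of the cyclic group of
  \<open>z \<otimes> x\<close>, namely \<open>z \<otimes> x\<close> and its inverse. Whether the
  three involutions commute is left open; that is the main case distinction.\<close>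

locale three_involutions = group +
  fixes z s t u
  assumes exponent: "y \<in> carrier G \<Longrightarrow> y [^] (4::nat) = \<one> \<or> y [^] (6::nat) = \<one>"
    and z_closed [simp]: "z \<in> carrier G" and z3: "z \<otimes> (z \<otimes> z) = \<one>" and z_ne: "z \<noteq> \<one>"
    and T_closed: "{s, t, u} \<subseteq> carrier G"
    and T_sq: "x \<in> {s, t, u} \<Longrightarrow> x \<otimes> x = \<one>" and T_ne: "x \<in> {s, t, u} \<Longrightarrow> x \<noteq> \<one>"
    and T_comm: "x \<in> {s, t, u} \<Longrightarrow> x \<otimes> z = z \<otimes> x"
    and distinct: "s \<noteq> t" "s \<noteq> u" "t \<noteq> u"
    and order_6: "y \<in> carrier G \<Longrightarrow> y [^] (6::nat) = \<one> \<Longrightarrow> y [^] (2::nat) \<noteq> \<one> \<Longrightarrow> y [^] (3::nat) \<noteq> \<one> \<Longrightarrow>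
      \<exists>x \<in> {s, t, u}. y = z \<otimes> x \<or> y = z \<otimes> (z \<otimes> x)"
begin

abbreviation "T \<equiv> {s, t, u}"

lemma stu_closed [simp]: "s \<in> carrier G" "t \<in> carrier G" "u \<in> carrier G"
  using T_closed by auto

lemma T_closed' [simp]: "x \<in> T \<Longrightarrow> x \<in> carrier G"
  using T_closed by blast

lemma zz_ne: "z \<otimes> z \<noteq> \<one>" "z \<otimes> z \<noteq> z"
  using z3 z_ne by (metis r_one z_closed, metis r_cancel_one z_closed)

lemmas z_pow = pow_numerals_order_3[OF z_closed z3]

text \<open>Third and fourth powers split an element of order 6 into its involution and its part of
  order 3.\<close>

lemma order_6_pow:
  assumes "x \<in> T" "y = z \<otimes> x \<or> y = z \<otimes> (z \<otimes> x)"
  shows "y [^] (2::nat) \<noteq> \<one>" "y [^] (3::nat) = x" "y [^] (4::nat) \<in> {z, z \<otimes> z}"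
    "y [^] (6::nat) = \<one>"
proof -
  note x = pow_numerals_order_2[OF T_closed' T_sq, OF assms(1) assms(1)]
  have xc: "x \<in> carrier G" and xz: "x \<otimes> z = z \<otimes> x"
    using assms(1) by (rule T_closed', rule T_comm)
  have 1: "(z \<otimes> x) [^] n = z [^] n \<otimes> x [^] n" for n :: nat
    by (rule pow_mult_distrib) (simp_all add: xc xz)
  have 2: "(z \<otimes> (z \<otimes> x)) [^] n = z [^] n \<otimes> (z [^] n \<otimes> x [^] n)" for n :: nat
    unfolding 1[symmetric] by (rule pow_mult_distrib) (simp_all add: xc xz m_assoc)
  show "y [^] (2::nat) \<noteq> \<one>" "y [^] (3::nat) = x" "y [^] (4::nat) \<in> {z, z \<otimes> z}" "y [^] (6::nat) = \<one>"
    using assms(2) zz_ne z_ne by (auto simp: 1 2 x z_pow m_assoc z3 cube_cancel[OF z3] xc)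
qed

text \<open>If \<open>c\<close> had order 4, then \<open>zc\<close> would have order 12.\<close>

lemma centralizer_pow_6:
  assumes "c \<in> carrier G" "c \<otimes> z = z \<otimes> c"
  shows "c [^] (6::nat) = \<one>"
proof (rule ccontr)
  assume c6: "c [^] (6::nat) \<noteq> \<one>"
  have p: "(z \<otimes> c) [^] (n::nat) = z [^] n \<otimes> c [^] n" for n
    using assms by (simp add: pow_mult_distrib)
  from c6 exponent[of c] assms have "c [^] (4::nat) = \<one>" by blast
  then have "(z \<otimes> c) [^] (4::nat) \<noteq> \<one>" "(z \<otimes> c) [^] (6::nat) = c [^] (6::nat)"
    using assms z_ne by (auto simp: p z_pow)
  then show False using exponent[of "z \<otimes> c"] c6 assms by auto
qed

text \<open>The product \<open>z \<otimes> c\<close> has order 6, hence is one of the six listed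
  elements; its cube is \<open>c\<close> on one side and a member of \<open>T\<close> on the
  other.\<close>

lemma centralizer_involution:
  assumes "c \<in> carrier G" "c \<otimes> z = z \<otimes> c" "c \<otimes> c = \<one>" "c \<noteq> \<one>"
  shows "c \<in> T"
proof -
  have p: "(z \<otimes> c) [^] (n::nat) = z [^] n \<otimes> c [^] n" for n
    using assms by (simp add: pow_mult_distrib)
  note c = pow_numerals_order_2[OF assms(1,3)]
  obtain x where x: "x \<in> T" "z \<otimes> c = z \<otimes> x \<or> z \<otimes> c = z \<otimes> (z \<otimes> x)"
    using order_6[of "z \<otimes> c"] assms zz_ne by (auto simp: p z_pow c)
  have "(z \<otimes> c) [^] (3::nat) = x" by (rule order_6_pow(2)[OF x])
  with x assms show ?thesis by (simp add: p z_pow c)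
qed

text \<open>Otherwise \<open>yx\<close> would be a further element of order 6.\<close>

lemma order_3_commuting_with_T:
  assumes "y \<in> carrier G" "y \<otimes> (y \<otimes> y) = \<one>" "x \<in> T" "y \<otimes> x = x \<otimes> y"
  shows "y \<in> {\<one>, z, z \<otimes> z}"
proof (cases "y = \<one>")
  case False
  have p: "(y \<otimes> x) [^] n = y [^] n \<otimes> x [^] n" for n :: nat
    using assms(4,1) T_closed'[OF assms(3)] by (rule pow_mult_distrib)
  have y2: "y \<otimes> y \<noteq> \<one>" using False assms by (metis r_one)
  note y = pow_numerals_order_3[OF assms(1,2)]
    and x = pow_numerals_order_2[OF T_closed' T_sq, OF assms(3) assms(3)]
  have xc: "x \<in> carrier G" and xne: "x \<noteq> \<one>"
    using assms(3) by (rule T_closed', rule T_ne)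
  have "(y \<otimes> x) [^] (6::nat) = \<one>" "(y \<otimes> x) [^] (2::nat) \<noteq> \<one>" "(y \<otimes> x) [^] (3::nat) \<noteq> \<one>"
    using xc xne y2 assms(1) by (simp_all add: p y x)
  then obtain x' where x': "x' \<in> T" "y \<otimes> x = z \<otimes> x' \<or> y \<otimes> x = z \<otimes> (z \<otimes> x')"
    using order_6[of "y \<otimes> x"] xc assms(1) by blast
  have "(y \<otimes> x) [^] (4::nat) \<in> {z, z \<otimes> z}" by (rule order_6_pow(3)[OF x'])
  moreover have "(y \<otimes> x) [^] (4::nat) = y" using xc assms(1) by (simp add: p y x)
  ultimately show ?thesis by simp
qed simp

text \<open>Conjugation preserves the conditions in \<open>order_6\<close>. The equation with
  \<open>y\<close> is kept explicit so that \<open>conj_pow\<close> can raise it to the third or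
  fourth power.\<close>

lemma conj_order_6:
  assumes "g \<in> carrier G" "x \<in> T"
  obtains y x' where "y \<in> carrier G" "x' \<in> T" "y = z \<otimes> x' \<or> y = z \<otimes> (z \<otimes> x')"
    "g \<otimes> (z \<otimes> x) = y \<otimes> g"
proof -
  let ?y = "g \<otimes> (z \<otimes> x) \<otimes> inv g"
  have y: "?y \<in> carrier G" "g \<otimes> (z \<otimes> x) = ?y \<otimes> g" using assms by (simp_all add: m_assoc)
  have "?y [^] n = \<one> \<longleftrightarrow> (z \<otimes> x) [^] n = \<one>" for n :: nat
    using conj_one_iff[OF _ _ _ conj_pow[OF assms(1) _ y(1,2)]] assms y(1) by simp
  moreover note order_6_pow[OF assms(2) disjI1[OF refl]] T_ne[OF assms(2)]
  ultimately obtain x' where "x' \<in> T" "?y = z \<otimes> x' \<or> ?y = z \<otimes> (z \<otimes> x')"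
    using order_6[OF y(1)] by auto
  with y that show ?thesis by blast
qed

lemma conj_z:
  assumes "g \<in> carrier G"
  shows "g \<otimes> z = z \<otimes> g \<or> g \<otimes> z = z \<otimes> (z \<otimes> g)"
proof -
  obtain y x' where y: "y \<in> carrier G" "x' \<in> T" "y = z \<otimes> x' \<or> y = z \<otimes> (z \<otimes> x')"
    "g \<otimes> (z \<otimes> s) = y \<otimes> g" using conj_order_6[OF assms, of s] by blast
  \<comment> \<open>Fourth powers remove the involutions from the conjugation equation and leave
    only \<open>z\<close> and its square.\<close>
  have "(z \<otimes> s) [^] (4::nat) = z"
    using T_comm[of s] pow_numerals_order_2[OF _ T_sq[of s]] by (simp add: pow_mult_distrib z_pow)
  moreover have "g \<otimes> (z \<otimes> s) [^] (4::nat) = y [^] (4::nat) \<otimes> g"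
    by (rule conj_pow) (use y assms in auto)
  ultimately show ?thesis
    using order_6_pow(3)[OF y(2,3)] assms by (auto simp: m_assoc)
qed

lemma conj_T:
  assumes "g \<in> carrier G" "x \<in> T"
  obtains x' where "x' \<in> T" "g \<otimes> x = x' \<otimes> g"
proof -
  obtain y x' where y: "y \<in> carrier G" "x' \<in> T" "y = z \<otimes> x' \<or> y = z \<otimes> (z \<otimes> x')"
    "g \<otimes> (z \<otimes> x) = y \<otimes> g" using conj_order_6[OF assms] by blast
  \<comment> \<open>Cubes remove \<open>z\<close> and leave only the involutions.\<close>
  have "g \<otimes> (z \<otimes> x) [^] (3::nat) = y [^] (3::nat) \<otimes> g"
    by (rule conj_pow) (use y assms in auto)
  then have "g \<otimes> x = x' \<otimes> g"
    using order_6_pow(2)[OF y(2,3)] order_6_pow(2)[OF assms(2) disjI1[OF refl]] by simp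
  with y that show ?thesis by blast
qed

text \<open>Otherwise \<open>x^6 = \<one>\<close>. Order 3 is impossible, since an inversion
  performed three times is an inversion and not the identity; order 6 is impossible, since the
  listed elements of order 6 centralise \<open>z\<close>.\<close>

lemma inverting_pow_4:
  assumes x: "x \<in> carrier G" and xz: "x \<otimes> z = z \<otimes> (z \<otimes> x)"
  shows "x [^] (4::nat) = \<one>"
proof (rule ccontr)
  assume x4: "x [^] (4::nat) \<noteq> \<one>"
  then have x6: "x [^] (6::nat) = \<one>" using exponent x by blast
  have x2: "x [^] (2::nat) \<noteq> \<one>"
    using x4 x nat_pow_pow[of x 2 2] by auto
  have zx: "x \<otimes> (z \<otimes> w) = z \<otimes> (z \<otimes> (x \<otimes> w))" if "w \<in> carrier G" for w
    using m_assoc_subst[OF xz] x that by (simp add: m_assoc)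
  have x3: "x [^] (3::nat) \<noteq> \<one>"
  proof
    assume "x [^] (3::nat) = \<one>"
    then have "x \<otimes> (x \<otimes> x) = \<one>" using x by (simp add: numeral_eq_Suc m_assoc)
    then have "z = x \<otimes> (x \<otimes> (x \<otimes> z))" using x cube_cancel by simp
    also have "\<dots> = z \<otimes> (z \<otimes> (x \<otimes> (x \<otimes> x)))"
      using x by (simp add: xz zx cube_cancel[OF z3])
    finally show False using \<open>x \<otimes> (x \<otimes> x) = \<one>\<close> zz_ne by simp
  qed
  obtain y where y: "y \<in> T" "x = z \<otimes> y \<or> x = z \<otimes> (z \<otimes> y)"
    using order_6[OF x x6 x2 x3] by blast
  then have "x \<otimes> z = z \<otimes> x" using T_comm[OF y(1)] by (auto simp: m_assoc)
  with xz have "z \<otimes> x = z \<otimes> (z \<otimes> x)" by simp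
  then show False using x z_ne by (simp add: left_cancel)
qed

lemma centralizer_cases:
  assumes "c \<in> carrier G" "c \<otimes> z = z \<otimes> c"
  obtains "c = \<one>" | "c \<in> T" | "c \<otimes> (c \<otimes> c) = \<one>"
    | x where "x \<in> T" "c = z \<otimes> x \<or> c = z \<otimes> (z \<otimes> x)"
proof -
  consider "c [^] (2::nat) = \<one>" | "c [^] (3::nat) = \<one>" | "c [^] (2::nat) \<noteq> \<one>" "c [^] (3::nat) \<noteq> \<one>"
    by blast
  then show ?thesis
  proof cases
    case 1
    then have "c \<otimes> c = \<one>" using assms by (simp add: numeral_eq_Suc)
    then show ?thesis using centralizer_involution assms that by blast
  next
    case 2
    then have "c \<otimes> (c \<otimes> c) = \<one>" using assms by (simp add: numeral_eq_Suc m_assoc)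
    then show ?thesis using that by blast
  next
    case 3
    then show ?thesis using order_6[OF assms(1) centralizer_pow_6[OF assms]] that by blast
  qed
qed

end

section \<open>Recognising the seven groups\<close>

context group
begin

text \<open>Used for trivial kernels: a word that conjugates \<open>a\<close> to something else is
  not the identity.\<close>

lemma ne_one_if_conj:
  "g \<in> carrier G \<Longrightarrow> a \<in> carrier G \<Longrightarrow> b \<in> carrier G \<Longrightarrow> g \<otimes> a = b \<otimes> g \<Longrightarrow> a \<noteq> b \<Longrightarrow> g \<noteq> \<one>"
  by auto

lemma PV_ne:
  assumes [simp]: "z \<in> carrier G" "s \<in> carrier G" "t \<in> carrier G"
    and z: "z \<otimes> (z \<otimes> z) = \<one>" and s: "s \<otimes> s = \<one>" and t: "t \<otimes> t = \<one>"
    and sz: "s \<otimes> z = z \<otimes> s" and tz: "t \<otimes> z = z \<otimes> t" and ts: "t \<otimes> s = s \<otimes> t"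
    and ne: "z \<noteq> \<one>" "s \<noteq> \<one>" "t \<noteq> \<one>" "s \<noteq> t"
  shows "z \<otimes> z \<noteq> \<one>" "s \<otimes> t \<noteq> \<one>" "z \<otimes> s \<noteq> \<one>" "z \<otimes> t \<noteq> \<one>" "z \<otimes> (s \<otimes> t) \<noteq> \<one>"
    "z \<otimes> (z \<otimes> s) \<noteq> \<one>" "z \<otimes> (z \<otimes> t) \<noteq> \<one>" "z \<otimes> (z \<otimes> (s \<otimes> t)) \<noteq> \<one>"
proof -
  have zz: "z \<otimes> z \<noteq> \<one>" using z ne by auto
  have "w \<otimes> v \<noteq> \<one>" if "v \<in> {s, t, s \<otimes> t}" "w \<in> {z, z \<otimes> z}" for v w
  proof
    assume "w \<otimes> v = \<one>"
    \<comment> \<open>Squaring kills the involution \<open>v\<close> and leaves the square of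
      \<open>w\<close>, which is not trivial as \<open>w\<close> has order 3.\<close>
    moreover have "(w \<otimes> v) \<otimes> (w \<otimes> v) = w \<otimes> w"
      using that by (auto simp: m_assoc s t sz tz ts m_assoc_subst[OF s] m_assoc_subst[OF t]
          m_assoc_subst[OF sz] m_assoc_subst[OF tz] m_assoc_subst[OF ts])
    ultimately have "w \<otimes> w = \<one>" by simp
    then show False using that zz z ne by (auto simp: m_assoc)
  qed
  from this[of s z] this[of t z] this[of "s \<otimes> t" z]
    this[of s "z \<otimes> z"] this[of t "z \<otimes> z"] this[of "s \<otimes> t" "z \<otimes> z"]
  show "z \<otimes> s \<noteq> \<one>" "z \<otimes> t \<noteq> \<one>" "z \<otimes> (s \<otimes> t) \<noteq> \<one>" 
    "z \<otimes> (z \<otimes> s) \<noteq> \<one>" "z \<otimes> (z \<otimes> t) \<noteq> \<one>" "z \<otimes> (z \<otimes> (s \<otimes> t)) \<noteq> \<one>"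
    by (simp_all add: m_assoc)
  show "s \<otimes> t \<noteq> \<one>" using s ne by (metis assms(2,3) left_cancel)
qed (use z ne in auto)

lemma hom_eq_one_imp:
  assumes "group A" "f \<in> hom A G" "inj_on f (carrier A)" "p \<in> carrier A" "f p = \<one>"
  shows "p = \<one>\<^bsub>A\<^esub>"
proof -
  interpret A: group A by fact
  have "f \<one>\<^bsub>A\<^esub> = \<one>" by (rule hom_one) (fact assms group_axioms)+
  then show ?thesis using inj_onD[OF assms(3), of p "\<one>\<^bsub>A\<^esub>"] assms by simp
qed

lemma image_mult_elim:
  assumes "f ` C = (\<lambda>(q, m). q \<otimes> m) ` (Q \<times> M)" "p \<in> C"
  shows "\<exists>q \<in> Q. \<exists>m \<in> M. f p = q \<otimes> m"
proof -
  have "f p \<in> (\<lambda>(q, m). q \<otimes> m) ` (Q \<times> M)" using assms by blast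
  then show ?thesis by force
qed

lemma image_mult_intro:
  assumes "f ` C = (\<lambda>(q, m). q \<otimes> m) ` (Q \<times> M)" "q \<in> Q" "m \<in> M"
  shows "\<exists>p \<in> C. q \<otimes> m = f p"
proof -
  have "q \<otimes> m \<in> f ` C" unfolding assms(1) using assms(2,3) by blast
  then show ?thesis by blast
qed

lemma image_Zn:
  assumes "a \<in> carrier G"
  shows "p \<in> {\<one>, a} \<Longrightarrow> \<exists>i \<in> carrier (Zn 2). p = a [^] i"
    "p \<in> {\<one>, a, a \<otimes> a} \<Longrightarrow> \<exists>i \<in> carrier (Zn 3). p = a [^] i"
  using assms by (auto simp: carrier_Zn int_pow_numerals)

lemma pow_Zn_3_eq_one:
  assumes "a \<in> carrier G" "a \<otimes> (a \<otimes> a) = \<one>" "a \<noteq> \<one>" "i \<in> carrier (Zn 3)" "a [^] i = \<one>"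
  shows "i = 0"
proof -
  have "a \<otimes> a \<noteq> \<one>" using assms(1-3) by auto
  with assms show ?thesis by (auto simp: carrier_Zn int_pow_numerals)
qed

lemma iso_SG_12_5:
  assumes [simp]: "z \<in> carrier G" "s \<in> carrier G" "t \<in> carrier G"
    and z: "z \<otimes> (z \<otimes> z) = \<one>" and s: "s \<otimes> s = \<one>" and t: "t \<otimes> t = \<one>"
    and sz: "s \<otimes> z = z \<otimes> s" and tz: "t \<otimes> z = z \<otimes> t" and ts: "t \<otimes> s = s \<otimes> t"
    and ne: "z \<noteq> \<one>" "s \<noteq> \<one>" "t \<noteq> \<one>" "s \<noteq> t"
    and cover: "\<And>y. y \<in> carrier G \<Longrightarrow> \<exists>p \<in> {\<one>, z, z \<otimes> z}. \<exists>v \<in> {\<one>, s, t, s \<otimes> t}. y = p \<otimes> v"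
  shows "G \<cong> SG_12_5"
proof -
  note rels = s t sz tz ts
  note rew = rels rels[THEN m_assoc_subst] m_assoc z cube_cancel[OF z] int_pow_numerals
  note ne' = ne PV_ne[OF assms(1-13)]
  show ?thesis
    unfolding SG_12_5_def DirProd_eq_semidirect_prod
  proof (rule is_iso_semidirect_prod)
    \<comment> \<open>The factor of order 6 is generated by \<open>z \<otimes> t\<close>: its cube
      is \<open>t\<close> and its fourth power is \<open>z\<close>.\<close>
    show "(\<lambda>i. s [^] i) \<in> hom (Zn 2) G" "(\<lambda>i. (z \<otimes> t) [^] i) \<in> hom (Zn 6) G"
      by (rule hom_Zn; simp add: numeral_eq_Suc rew)+
  next
    fix y assume "y \<in> carrier G"
    from cover[OF this] show "\<exists>n\<in>carrier (Zn 2). \<exists>h\<in>carrier (Zn 6). y = s [^] n \<otimes> (z \<otimes> t) [^] h"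
      by (elim bexE insertE emptyE; simp add: carrier_Zn rew)
  next
    fix i j assume "i \<in> carrier (Zn 2)" "j \<in> carrier (Zn 6)" "s [^] i \<otimes> (z \<otimes> t) [^] j = \<one>"
    then show "i = \<one>\<^bsub>Zn 2\<^esub> \<and> j = \<one>\<^bsub>Zn 6\<^esub>"
      by (simp add: carrier_Zn, elim disjE; simp add: rew ne')
  qed (auto simp: carrier_Zn rew)
qed

lemma iso_SG_18_3:
  assumes [simp]: "z \<in> carrier G" "r \<in> carrier G" "x \<in> carrier G"
    and z: "z \<otimes> (z \<otimes> z) = \<one>" and r: "r \<otimes> (r \<otimes> r) = \<one>" and x: "x \<otimes> x = \<one>"
    and rz: "r \<otimes> z = z \<otimes> r" and xz: "x \<otimes> z = z \<otimes> x" and xr: "x \<otimes> r = r \<otimes> (r \<otimes> x)"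
    and ne: "z \<noteq> \<one>" "r \<noteq> \<one>" "x \<noteq> \<one>"
    and cover: "\<And>y. y \<in> carrier G \<Longrightarrow>
      \<exists>p \<in> {\<one>, z, z \<otimes> z}. \<exists>q \<in> {\<one>, r, r \<otimes> r}. \<exists>m \<in> {\<one>, x}. y = p \<otimes> (q \<otimes> m)"
  shows "G \<cong> SG_18_3"
proof -
  note rels = x rz xz xr
  note rew = rels rels[THEN m_assoc_subst] m_assoc z r cube_cancel[OF z] cube_cancel[OF r] int_pow_numerals
  have rr: "r \<otimes> r \<noteq> \<one>" using r ne by auto
  have zz: "z \<otimes> z \<noteq> \<one>" using z ne by auto
  have ker: "p = \<one> \<and> q = \<one> \<and> m = \<one>"
    if "p \<in> {\<one>, z, z \<otimes> z}" "q \<in> {\<one>, r, r \<otimes> r}" "m \<in> {\<one>, x}" and eq: "p \<otimes> (q \<otimes> m) = \<one>" for p q m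
  proof -
    have cl: "p \<otimes> (q \<otimes> m) \<in> carrier G" using that by auto
    \<comment> \<open>A word ending in \<open>x\<close> inverts \<open>r\<close>, which the identity
      does not.\<close>
    have "(p \<otimes> (q \<otimes> m)) \<otimes> r = (r \<otimes> r) \<otimes> (p \<otimes> (q \<otimes> m))" if "m = x"
      using \<open>p \<in> _\<close> \<open>q \<in> _\<close> that by (elim insertE emptyE; simp add: rew)
    then have m: "m = \<one>"
      using ne_one_if_conj[OF cl, of r "r \<otimes> r"] eq that(3) ne by auto
    \<comment> \<open>With \<open>m = \<one>\<close> the word conjugates \<open>x\<close> to
      \<open>q^2 x\<close>, because \<open>p\<close> commutes with \<open>q\<close> and
      \<open>x\<close>, and \<open>x\<close> inverts \<open>q\<close>. Being the identity, it forces
      \<open>q^2 = \<one>\<close> and thus \<open>q = \<one>\<close>.\<close>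
    have "(p \<otimes> (q \<otimes> m)) \<otimes> x = (q \<otimes> (q \<otimes> x)) \<otimes> (p \<otimes> (q \<otimes> m))"
      using that(1,2) m by (elim insertE emptyE; simp add: rew)
    then have "x = q \<otimes> (q \<otimes> x)"
      using ne_one_if_conj[OF cl, of x "q \<otimes> (q \<otimes> x)"] eq that(2) by auto
    then have q: "q = \<one>" using that(2) rr ne r
      using r_cancel_one'[of x] by (elim insertE emptyE; simp flip: m_assoc)
    show ?thesis using m q eq that(1) by auto
  qed
  obtain f where f: "f \<in> hom (sym_group 3) G" "inj_on f (carrier (sym_group 3))"
    and im: "f ` carrier (sym_group 3) = (\<lambda>(i, j). r [^] i \<otimes> x [^] j) ` ({0, 1, 2::int} \<times> {0, 1::int})"
    using obtain_sym_group_3_hom[OF assms(2,3) r x xr ne(2,3)] by blast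
  have im': "f ` carrier (sym_group 3) = (\<lambda>(q, m). q \<otimes> m) ` ({\<one>, r, r \<otimes> r} \<times> {\<one>, x})"
    unfolding im by (simp add: rew insert_Times_insert)
  have f_im: "\<exists>q \<in> {\<one>, r, r \<otimes> r}. \<exists>m \<in> {\<one>, x}. f p = q \<otimes> m" if "p \<in> carrier (sym_group 3)" for p
    using im' that by (rule image_mult_elim)
  show ?thesis
    unfolding SG_18_3_def DirProd_eq_semidirect_prod
  proof (rule is_iso_semidirect_prod)
    show "(\<lambda>i. z [^] i) \<in> hom (Zn 3) G"
      by (rule hom_Zn; simp add: numeral_eq_Suc rew)
  next
    fix y assume "y \<in> carrier G"
    from cover[OF this] obtain p q m where y: "y = p \<otimes> (q \<otimes> m)" "p \<in> {\<one>, z, z \<otimes> z}" "q \<in> {\<one>, r, r \<otimes> r}" "m \<in> {\<one>, x}"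
      by (elim bexE) (rule that)
    from image_mult_intro[OF im' y(3,4)] show "\<exists>n\<in>carrier (Zn 3). \<exists>h\<in>carrier (sym_group 3). y = z [^] n \<otimes> f h"
      using y(1) image_Zn(2)[OF assms(1) y(2)] by (elim bexE) (simp, blast)
  next
    fix i p assume i: "i \<in> carrier (Zn 3)" and p: "p \<in> carrier (sym_group 3)" and eq: "z [^] i \<otimes> f p = \<one>"
    obtain q m where qm: "q \<in> {\<one>, r, r \<otimes> r}" "m \<in> {\<one>, x}" "f p = q \<otimes> m"
      using f_im[OF p] by (elim bexE) (rule that)
    have zi: "z [^] i \<in> {\<one>, z, z \<otimes> z}" using i by (auto simp: carrier_Zn int_pow_numerals)
    have 1: "z [^] i = \<one> \<and> q = \<one> \<and> m = \<one>"
      by (rule ker[OF zi qm(1,2)]) (use eq qm(3) in simp)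
    then have "p = \<one>\<^bsub>sym_group 3\<^esub>"
      by (intro hom_eq_one_imp[OF sym_group_is_group f p]) (simp add: qm(3))
    moreover have "i = 0" using 1 by (intro pow_Zn_3_eq_one[OF _ z ne(1) i]) simp_all
    ultimately show "i = \<one>\<^bsub>Zn 3\<^esub> \<and> p = \<one>\<^bsub>sym_group 3\<^esub>" by simp
  next
    fix i p assume i: "i \<in> carrier (Zn 3)" and p: "p \<in> carrier (sym_group 3)"
    obtain q m where qm: "q \<in> {\<one>, r, r \<otimes> r}" "m \<in> {\<one>, x}" "f p = q \<otimes> m"
      using f_im[OF p] by (elim bexE) (rule that)
    from qm(1,2) i show "f p \<otimes> z [^] i = z [^] i \<otimes> f p"
      unfolding qm(3) by (simp only: carrier_Zn, elim insertE emptyE; simp add: rew)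
  qed (auto simp: f sym_group_is_group)
qed

lemma iso_SG_24_7:
  assumes [simp]: "z \<in> carrier G" "s \<in> carrier G" "t \<in> carrier G" and xc [simp]: "x \<in> carrier G"
    and z: "z \<otimes> (z \<otimes> z) = \<one>" and s: "s \<otimes> s = \<one>" and t: "t \<otimes> t = \<one>"
    and sz: "s \<otimes> z = z \<otimes> s" and tz: "t \<otimes> z = z \<otimes> t" and ts: "t \<otimes> s = s \<otimes> t"
    and ne: "z \<noteq> \<one>" "s \<noteq> \<one>" "t \<noteq> \<one>" "s \<noteq> t"
    and x: "x \<otimes> x = t" and xz: "x \<otimes> z = z \<otimes> (z \<otimes> x)" and xs: "x \<otimes> s = s \<otimes> x" and xt: "x \<otimes> t = t \<otimes> x"
    and cover: "\<And>y. y \<in> carrier G \<Longrightarrow>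
      \<exists>p \<in> {\<one>, z, z \<otimes> z}. \<exists>v \<in> {\<one>, s, t, s \<otimes> t}. \<exists>m \<in> {\<one>, x}. y = p \<otimes> (v \<otimes> m)"
  shows "G \<cong> SG_24_7"
proof -
  note rels = s t sz tz ts x xz xs xt
  note rew = rels rels[THEN m_assoc_subst] m_assoc z cube_cancel[OF z] int_pow_numerals
  note ne' = ne PV_ne[OF assms(1-3) z s t sz tz ts ne]
  \<comment> \<open>\<open>Dic3\<close> is the subgroup of \<open>z\<close> and \<open>x\<close>,
    with \<open>x\<close> of order 4 and square \<open>t\<close>; \<open>s\<close> spans the
    complementary direct factor.\<close>
  let ?g = "\<lambda>(i, k). z [^] i \<otimes> x [^] k"
  have g: "?g \<in> hom Dic3 G"
    unfolding Dic3_def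
  proof (rule hom_semidirect_prod)
    show "(\<lambda>i. z [^] i) \<in> hom (Zn 3) G" "(\<lambda>i. x [^] i) \<in> hom (Zn 4) G"
      by (rule hom_Zn; simp add: numeral_eq_Suc rew)+
  next
    fix i k assume "i \<in> carrier (Zn 3)" "k \<in> carrier (Zn 4)"
    then show "x [^] k \<otimes> z [^] i = z [^] (if even k then i else (- i) mod 3) \<otimes> x [^] k"
      by (simp only: carrier_Zn, elim insertE emptyE; simp add: rew)
  qed (auto simp: carrier_Zn)
  show ?thesis
    unfolding SG_24_7_def DirProd_eq_semidirect_prod
  proof (rule is_iso_semidirect_prod)
    show "(\<lambda>i. s [^] i) \<in> hom (Zn 2) G"
      by (rule hom_Zn; simp add: numeral_eq_Suc rew)
    show "?g \<in> hom Dic3 G" by (rule g)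
  next
    fix y assume "y \<in> carrier G"
    from cover[OF this] obtain p v m where y: "p \<in> {\<one>, z, z \<otimes> z}" "v \<in> {\<one>, s, t, s \<otimes> t}" "m \<in> {\<one>, x}" "y = p \<otimes> (v \<otimes> m)"
      by (elim bexE) (rule that)
    obtain j k where jk: "j \<in> carrier (Zn 2)" "k \<in> carrier (Zn 4)" "v \<otimes> m = s [^] j \<otimes> x [^] k"
    proof -
      have "\<exists>j\<in>carrier (Zn 2). \<exists>k\<in>carrier (Zn 4). v \<otimes> m = s [^] j \<otimes> x [^] k"
        using y(2,3) by (elim insertE emptyE; simp add: carrier_Zn rew)
      then show ?thesis using that by blast
    qed
    obtain i where i: "i \<in> carrier (Zn 3)" "p = z [^] i" using image_Zn(2)[OF _ y(1)] by auto
    have "z [^] i \<otimes> s [^] j = s [^] j \<otimes> z [^] i"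
      using i jk(1) by (simp only: carrier_Zn, elim insertE emptyE; simp add: rew)
    then have "y = s [^] j \<otimes> ?g (i, k)"
      unfolding y(4) jk(3) i(2) by (simp add: m_assoc flip: m_assoc[of "z [^] i"])
    then show "\<exists>n\<in>carrier (Zn 2). \<exists>h\<in>carrier Dic3. y = s [^] n \<otimes> ?g h"
      using i jk by (intro bexI[of _ j] bexI[of _ "(i, k)"]) (simp_all add: Dic3_def)
  next
    fix j h assume j: "j \<in> carrier (Zn 2)" and h: "h \<in> carrier Dic3" and eq: "s [^] j \<otimes> ?g h = \<one>"
    obtain i k where ik: "h = (i, k)" "i \<in> carrier (Zn 3)" "k \<in> carrier (Zn 4)" using h by (auto simp: Dic3_def)
    have cl: "s [^] j \<otimes> ?g h \<in> carrier G" by (simp add: ik)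
    \<comment> \<open>Odd powers of \<open>x\<close> invert \<open>z\<close>. Once \<open>k\<close>
      is even, the word lies in the product of \<open>P\<close> and \<open>V\<close>, where
      \<open>PV_ne\<close> decides.\<close>
    have "(s [^] j \<otimes> ?g h) \<otimes> z = (z \<otimes> z) \<otimes> (s [^] j \<otimes> ?g h)" if "odd k"
      using j ik that by (simp only: carrier_Zn, elim insertE emptyE; simp add: rew)
    then have "even k" using ne_one_if_conj[OF cl, of z "z \<otimes> z"] eq ne by auto
    with j ik(2,3) eq have "i = 0 \<and> j = 0 \<and> k = 0"
      unfolding ik(1) by (simp only: carrier_Zn, elim insertE emptyE; simp add: rew ne')
    then show "j = \<one>\<^bsub>Zn 2\<^esub> \<and> h = \<one>\<^bsub>Dic3\<^esub>" by (simp add: ik Dic3_def)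
  next
    fix j h assume "j \<in> carrier (Zn 2)" "h \<in> carrier Dic3"
    then show "?g h \<otimes> s [^] j = s [^] j \<otimes> ?g h"
      by (simp only: carrier_Zn Dic3_def carrier_semidirect_prod, elim insertE SigmaE emptyE; simp add: rew)
  qed (auto simp: group_Dic3)
qed

lemma iso_SG_24_8:
  assumes [simp]: "z \<in> carrier G" "s \<in> carrier G" "t \<in> carrier G" and xc [simp]: "x \<in> carrier G"
    and z: "z \<otimes> (z \<otimes> z) = \<one>" and s: "s \<otimes> s = \<one>" and t: "t \<otimes> t = \<one>"
    and sz: "s \<otimes> z = z \<otimes> s" and tz: "t \<otimes> z = z \<otimes> t" and ts: "t \<otimes> s = s \<otimes> t"
    and ne: "z \<noteq> \<one>" "s \<noteq> \<one>" "t \<noteq> \<one>" "s \<noteq> t"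
    and x: "x \<otimes> x = \<one>" and xz: "x \<otimes> z = z \<otimes> (z \<otimes> x)" and xs: "x \<otimes> s = s \<otimes> x"
    and xt: "x \<otimes> t = s \<otimes> (t \<otimes> x)"
    and cover: "\<And>y. y \<in> carrier G \<Longrightarrow>
      \<exists>p \<in> {\<one>, z, z \<otimes> z}. \<exists>v \<in> {\<one>, s, t, s \<otimes> t}. \<exists>m \<in> {\<one>, x}. y = p \<otimes> (v \<otimes> m)"
  shows "G \<cong> SG_24_8"
proof -
  note rels = s t sz tz ts x xz xs xt
  note rew = rels rels[THEN m_assoc_subst] m_assoc z cube_cancel[OF z] int_pow_numerals
  note ne' = ne PV_ne[OF assms(1-3) z s t sz tz ts ne]
  \<comment> \<open>With \<open>(1, 0)\<close> sent to \<open>z \<otimes> t\<close> and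
    \<open>(0, 1)\<close> to \<open>s\<close>, conjugation by \<open>x\<close> takes
    \<open>z \<otimes> t\<close> to \<open>z^2 s t = (z t)^5 s\<close> and fixes \<open>s\<close>.
    This is the automorphism \<open>(u, v) \<mapsto> (-u, v + u)\<close> of
    \<open>SG_24_8\<close>.\<close>
  let ?f = "\<lambda>(a, b). (z \<otimes> t) [^] a \<otimes> s [^] b"
  have f: "?f \<in> hom (Zn 6 \<times>\<times> Zn 2) G"
    unfolding DirProd_eq_semidirect_prod
  proof (rule hom_semidirect_prod)
    show "(\<lambda>i. (z \<otimes> t) [^] i) \<in> hom (Zn 6) G" "(\<lambda>i. s [^] i) \<in> hom (Zn 2) G"
      by (rule hom_Zn; simp add: numeral_eq_Suc rew)+
  qed (auto simp: carrier_Zn rew)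
  show ?thesis
    unfolding SG_24_8_def
  proof (rule is_iso_semidirect_prod)
    show "(\<lambda>i. x [^] i) \<in> hom (Zn 2) G"
      by (rule hom_Zn; simp add: numeral_eq_Suc rew)
    show "?f \<in> hom (Zn 6 \<times>\<times> Zn 2) G" by (rule f)
  next
    fix y assume "y \<in> carrier G"
    from cover[OF this] obtain p v m where y: "p \<in> {\<one>, z, z \<otimes> z}" "v \<in> {\<one>, s, t, s \<otimes> t}" "m \<in> {\<one>, x}" "y = p \<otimes> (v \<otimes> m)"
      by (elim bexE) (rule that)
    obtain a b where ab: "a \<in> carrier (Zn 6)" "b \<in> carrier (Zn 2)" "p \<otimes> v = ?f (a, b)"
    proof -
      have "\<exists>a\<in>carrier (Zn 6). \<exists>b\<in>carrier (Zn 2). p \<otimes> v = ?f (a, b)"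
        using y(1,2) by (elim insertE emptyE; simp add: carrier_Zn rew)
      then show ?thesis using that by blast
    qed
    obtain k where k: "k \<in> carrier (Zn 2)" "m = x [^] k" using image_Zn(1)[OF _ y(3)] by auto
    have "y = (p \<otimes> v) \<otimes> m" using y by (elim insertE emptyE; simp add: m_assoc)
    then show "\<exists>n\<in>carrier (Zn 6 \<times>\<times> Zn 2). \<exists>h\<in>carrier (Zn 2). y = ?f n \<otimes> x [^] h"
      unfolding ab(3) k(2) using ab k by (intro bexI[of _ "(a, b)"] bexI[of _ k]) simp_all
  next
    fix n k assume n: "n \<in> carrier (Zn 6 \<times>\<times> Zn 2)" and k: "k \<in> carrier (Zn 2)" and eq: "?f n \<otimes> x [^] k = \<one>"
    obtain a b where ab: "n = (a, b)" "a \<in> carrier (Zn 6)" "b \<in> carrier (Zn 2)" using n by auto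
    have cl: "?f n \<otimes> x [^] k \<in> carrier G" by (simp add: ab)
    have "(?f n \<otimes> x [^] k) \<otimes> z = (z \<otimes> z) \<otimes> (?f n \<otimes> x [^] k)" if "k = 1"
      using ab that by (simp only: carrier_Zn, elim insertE emptyE; simp add: rew)
    then have k0: "k = 0" using ne_one_if_conj[OF cl, of z "z \<otimes> z"] eq ne k by (auto simp: carrier_Zn)
    with ab(2,3) eq have "a = 0 \<and> b = 0"
      unfolding ab(1) by (simp only: carrier_Zn, elim insertE emptyE; simp add: rew ne')
    then show "n = \<one>\<^bsub>Zn 6 \<times>\<times> Zn 2\<^esub> \<and> k = \<one>\<^bsub>Zn 2\<^esub>" by (simp add: ab k0)
  next
    fix n k assume n: "n \<in> carrier (Zn 6 \<times>\<times> Zn 2)" and k: "k \<in> carrier (Zn 2)"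
    obtain a b where ab: "n = (a, b)" "a \<in> carrier (Zn 6)" "b \<in> carrier (Zn 2)" using n by auto
    from ab(2,3) k show "x [^] k \<otimes> ?f n = ?f ((\<lambda>(u, v). if k = 0 then (u, v) else ((- u) mod 6, (v + u) mod 2)) n) \<otimes> x [^] k"
      unfolding ab(1) by (simp only: carrier_Zn, elim insertE emptyE; simp add: rew)
  qed (auto simp: DirProd_group carrier_Zn)
qed

lemma iso_SG_24_14:
  assumes [simp]: "z \<in> carrier G" "s \<in> carrier G" "t \<in> carrier G" and xc [simp]: "x \<in> carrier G"
    and z: "z \<otimes> (z \<otimes> z) = \<one>" and s: "s \<otimes> s = \<one>" and t: "t \<otimes> t = \<one>"
    and sz: "s \<otimes> z = z \<otimes> s" and tz: "t \<otimes> z = z \<otimes> t" and ts: "t \<otimes> s = s \<otimes> t"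
    and ne: "z \<noteq> \<one>" "s \<noteq> \<one>" "t \<noteq> \<one>" "s \<noteq> t"
    and x: "x \<otimes> x = \<one>" and xz: "x \<otimes> z = z \<otimes> (z \<otimes> x)" and xs: "x \<otimes> s = s \<otimes> x"
    and xt: "x \<otimes> t = t \<otimes> x"
    and cover: "\<And>y. y \<in> carrier G \<Longrightarrow>
      \<exists>p \<in> {\<one>, z, z \<otimes> z}. \<exists>v \<in> {\<one>, s, t, s \<otimes> t}. \<exists>m \<in> {\<one>, x}. y = p \<otimes> (v \<otimes> m)"
  shows "G \<cong> SG_24_14"
proof -
  note rels = s t sz tz ts x xz xs xt
  note rew = rels rels[THEN m_assoc_subst] m_assoc z cube_cancel[OF z] int_pow_numerals
  note ne' = ne PV_ne[OF assms(1-3) z s t sz tz ts ne]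
  have xne: "x \<noteq> \<one>" using xz ne by auto
  \<comment> \<open>The symmetric factor is generated by \<open>z\<close> and the involution
    \<open>x\<close> inverting it; \<open>s\<close> and \<open>t\<close> commute with both.\<close>
  obtain g where g: "g \<in> hom (sym_group 3) G" "inj_on g (carrier (sym_group 3))"
    and im: "g ` carrier (sym_group 3) = (\<lambda>(i, j). z [^] i \<otimes> x [^] j) ` ({0, 1, 2::int} \<times> {0, 1::int})"
    using obtain_sym_group_3_hom[OF assms(1) xc z x xz ne(1) xne] by blast
  have im': "g ` carrier (sym_group 3) = (\<lambda>(q, m). q \<otimes> m) ` ({\<one>, z, z \<otimes> z} \<times> {\<one>, x})"
    unfolding im by (simp add: rew insert_Times_insert)
  have g_im: "\<exists>q \<in> {\<one>, z, z \<otimes> z}. \<exists>m \<in> {\<one>, x}. g p = q \<otimes> m" if "p \<in> carrier (sym_group 3)" for p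
    using im' that by (rule image_mult_elim)
  let ?f = "\<lambda>(i, j). s [^] i \<otimes> t [^] j"
  show ?thesis
    unfolding SG_24_14_def DirProd_eq_semidirect_prod[of "Zn 2 \<times>\<times> Zn 2"]
  proof (rule is_iso_semidirect_prod)
    show "?f \<in> hom (Zn 2 \<times>\<times> Zn 2) G" by (rule hom_V4) (simp_all add: rew)
  next
    fix y assume "y \<in> carrier G"
    from cover[OF this] obtain p v m where y: "p \<in> {\<one>, z, z \<otimes> z}" "v \<in> {\<one>, s, t, s \<otimes> t}" "m \<in> {\<one>, x}" "y = p \<otimes> (v \<otimes> m)"
      by (elim bexE) (rule that)
    obtain i j where ij: "i \<in> carrier (Zn 2)" "j \<in> carrier (Zn 2)" "v = ?f (i, j)"
    proof -
      have "\<exists>i\<in>carrier (Zn 2). \<exists>j\<in>carrier (Zn 2). v = ?f (i, j)"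
        using y(2) by (elim insertE emptyE; simp add: carrier_Zn rew)
      then show ?thesis using that by blast
    qed
    from image_mult_intro[OF im' y(1,3)]
    obtain h where h: "h \<in> carrier (sym_group 3)" "p \<otimes> m = g h" by (elim bexE)
    have "y = v \<otimes> (p \<otimes> m)" using y by (elim insertE emptyE; simp add: rew)
    then show "\<exists>n\<in>carrier (Zn 2 \<times>\<times> Zn 2). \<exists>h\<in>carrier (sym_group 3). y = ?f n \<otimes> g h"
      unfolding ij(3) h(2) using ij h by (intro bexI[of _ "(i, j)"] bexI[of _ h]) simp_all
  next
    fix n p assume n: "n \<in> carrier (Zn 2 \<times>\<times> Zn 2)" and p: "p \<in> carrier (sym_group 3)" and eq: "?f n \<otimes> g p = \<one>"
    obtain i j where ij: "n = (i, j)" "i \<in> carrier (Zn 2)" "j \<in> carrier (Zn 2)" using n by auto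
    obtain q m where qm: "q \<in> {\<one>, z, z \<otimes> z}" "m \<in> {\<one>, x}" "g p = q \<otimes> m"
      using g_im[OF p] by (elim bexE) (rule that)
    let ?w = "s [^] i \<otimes> t [^] j \<otimes> (q \<otimes> x)"
    have m: "m = \<one>"
    proof (rule ccontr)
      assume "m \<noteq> \<one>"
      then have "?w = \<one>" using qm(2) eq by (simp add: qm(3) ij(1))
      moreover from ij(2,3) qm(1) have "?w \<otimes> z = (z \<otimes> z) \<otimes> ?w"
        by (simp only: carrier_Zn) (elim insertE emptyE, simp_all add: rew)
      ultimately have "\<one> \<otimes> z = (z \<otimes> z) \<otimes> \<one>" by (simp only:)
      then show False using ne by simp
    qed
    from ij(2,3) qm(1) eq have "i = 0 \<and> j = 0 \<and> q = \<one>"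
      unfolding ij(1) qm(3) m by (simp only: carrier_Zn) (elim insertE emptyE, simp_all add: rew ne')
    then show "n = \<one>\<^bsub>Zn 2 \<times>\<times> Zn 2\<^esub> \<and> p = \<one>\<^bsub>sym_group 3\<^esub>"
      using m qm(3) hom_eq_one_imp[OF sym_group_is_group g p] by (simp add: ij)
  next
    fix n p assume n: "n \<in> carrier (Zn 2 \<times>\<times> Zn 2)" and p: "p \<in> carrier (sym_group 3)"
    obtain i j where ij: "n = (i, j)" "i \<in> carrier (Zn 2)" "j \<in> carrier (Zn 2)" using n by auto
    obtain q m where qm: "q \<in> {\<one>, z, z \<otimes> z}" "m \<in> {\<one>, x}" "g p = q \<otimes> m"
      using g_im[OF p] by (elim bexE) (rule that)
    from ij(2,3) qm(1,2) show "g p \<otimes> ?f n = ?f n \<otimes> g p"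
      unfolding ij(1) qm(3) by (simp only: carrier_Zn) (elim insertE emptyE, simp_all add: rew)
  qed (auto simp: g DirProd_group sym_group_is_group)
qed

text \<open>The factors \<open>p\<close> and \<open>v\<close> centralise \<open>s\<close> and
  \<open>t\<close>, so the word acts on \<open>s\<close> as \<open>q\<close> does: \<open>r\<close>
  moves it to \<open>t\<close> and \<open>r^2\<close> to \<open>s \<otimes> t\<close>. Hence
  \<open>q = \<one>\<close>, and the rest lies in the product of \<open>P\<close> and
  \<open>V\<close>.\<close>

lemma three_cycle_word_eq_one:
  assumes [simp]: "z \<in> carrier G" "s \<in> carrier G" "t \<in> carrier G" and rc [simp]: "r \<in> carrier G"
    and z: "z \<otimes> (z \<otimes> z) = \<one>" and s: "s \<otimes> s = \<one>" and t: "t \<otimes> t = \<one>"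
    and sz: "s \<otimes> z = z \<otimes> s" and tz: "t \<otimes> z = z \<otimes> t" and ts: "t \<otimes> s = s \<otimes> t"
    and ne: "z \<noteq> \<one>" "s \<noteq> \<one>" "t \<noteq> \<one>" "s \<noteq> t"
    and rs: "r \<otimes> s = t \<otimes> r" and rt: "r \<otimes> t = s \<otimes> (t \<otimes> r)"
    and p: "p \<in> {\<one>, z, z \<otimes> z}" and v: "v \<in> {\<one>, s, t, s \<otimes> t}" and q: "q \<in> {\<one>, r, r \<otimes> r}"
    and eq: "p \<otimes> (v \<otimes> q) = \<one>"
  shows "p = \<one> \<and> v = \<one> \<and> q = \<one>"
proof -
  note rels = s t sz tz ts
  note rew = rels rels[THEN m_assoc_subst] m_assoc z cube_cancel[OF z]
  note ne' = ne PV_ne[OF assms(1-3) z s t sz tz ts ne]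
  have [simp]: "p \<in> carrier G" "v \<in> carrier G" using p v by auto
  have comm: "p \<otimes> (v \<otimes> (t \<otimes> d)) = t \<otimes> (p \<otimes> (v \<otimes> d))" "p \<otimes> (v \<otimes> (s \<otimes> d)) = s \<otimes> (p \<otimes> (v \<otimes> d))" if "d \<in> carrier G" for d
    using p v that by (elim insertE emptyE, simp_all add: rew)+
  have "q = \<one>"
  proof (rule ccontr)
    assume "q \<noteq> \<one>"
    then consider "q = r" | "q = r \<otimes> r" using q by blast
    then have "(p \<otimes> (v \<otimes> q)) \<otimes> s = t \<otimes> (p \<otimes> (v \<otimes> q)) \<or> (p \<otimes> (v \<otimes> q)) \<otimes> s = s \<otimes> (t \<otimes> (p \<otimes> (v \<otimes> q)))"
      by cases (simp_all add: m_assoc rs rt comm m_assoc_subst[OF rs] m_assoc_subst[OF rt])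
    then have "s = t \<or> s = s \<otimes> t" unfolding eq by simp
    then show False using ne by simp
  qed
  moreover from this p v eq have "p = \<one> \<and> v = \<one>"
    by (elim insertE emptyE, simp_all add: rew ne')
  ultimately show ?thesis by simp
qed

lemma iso_SG_36_11:
  assumes [simp]: "z \<in> carrier G" "s \<in> carrier G" "t \<in> carrier G" and rc [simp]: "r \<in> carrier G"
    and z: "z \<otimes> (z \<otimes> z) = \<one>" and s: "s \<otimes> s = \<one>" and t: "t \<otimes> t = \<one>"
    and sz: "s \<otimes> z = z \<otimes> s" and tz: "t \<otimes> z = z \<otimes> t" and ts: "t \<otimes> s = s \<otimes> t"
    and ne: "z \<noteq> \<one>" "s \<noteq> \<one>" "t \<noteq> \<one>" "s \<noteq> t"
    and r: "r \<otimes> (r \<otimes> r) = \<one>" and rz: "r \<otimes> z = z \<otimes> r" and rs: "r \<otimes> s = t \<otimes> r"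
    and rt: "r \<otimes> t = s \<otimes> (t \<otimes> r)"
    and cover: "\<And>y. y \<in> carrier G \<Longrightarrow>
      \<exists>p \<in> {\<one>, z, z \<otimes> z}. \<exists>v \<in> {\<one>, s, t, s \<otimes> t}. \<exists>q \<in> {\<one>, r, r \<otimes> r}. y = p \<otimes> (v \<otimes> q)"
  shows "G \<cong> SG_36_11"
proof -
  note rels = s t sz tz ts rz rs rt
  note rew = rels rels[THEN m_assoc_subst] m_assoc z r cube_cancel[OF z] cube_cancel[OF r] int_pow_numerals
  obtain g where g: "g \<in> hom (alt_group 4) G" "inj_on g (carrier (alt_group 4))"
    and im: "g ` carrier (alt_group 4) = (\<lambda>((i, j), k). (s [^] i \<otimes> t [^] j) \<otimes> r [^] k) `
      (({0, 1::int} \<times> {0, 1::int}) \<times> {0, 1, 2::int})"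
    and gens: "g v1 = s" "g v2 = t" "g rho = r"
    using obtain_alt_group_4_hom[OF assms(2,3) rc s t ts r rs rt ne(2-4)] by blast
  have im': "g ` carrier (alt_group 4) = (\<lambda>(v, q). v \<otimes> q) ` ({\<one>, s, t, s \<otimes> t} \<times> {\<one>, r, r \<otimes> r})"
    unfolding im by (simp add: rew insert_Times_insert insert_commute)
  have g_im: "\<exists>v \<in> {\<one>, s, t, s \<otimes> t}. \<exists>q \<in> {\<one>, r, r \<otimes> r}. g p = v \<otimes> q" if "p \<in> carrier (alt_group 4)" for p
    using im' that by (rule image_mult_elim)
  note ker = three_cycle_word_eq_one[OF assms(1-3) rc z s t sz tz ts ne rs rt]
  show ?thesis
    unfolding SG_36_11_def DirProd_eq_semidirect_prod
  proof (rule is_iso_semidirect_prod)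
    show "(\<lambda>i. z [^] i) \<in> hom (Zn 3) G"
      by (rule hom_Zn; simp add: numeral_eq_Suc rew)
  next
    fix y assume "y \<in> carrier G"
    from cover[OF this] obtain p v q where y: "p \<in> {\<one>, z, z \<otimes> z}" "v \<in> {\<one>, s, t, s \<otimes> t}" "q \<in> {\<one>, r, r \<otimes> r}" "y = p \<otimes> (v \<otimes> q)"
      by (elim bexE) (rule that)
    from image_mult_intro[OF im' y(2,3)] show "\<exists>n\<in>carrier (Zn 3). \<exists>h\<in>carrier (alt_group 4). y = z [^] n \<otimes> g h"
      using y(4) image_Zn(2)[OF assms(1) y(1)] by (elim bexE) (simp, blast)
  next
    fix i p assume i: "i \<in> carrier (Zn 3)" and p: "p \<in> carrier (alt_group 4)" and eq: "z [^] i \<otimes> g p = \<one>"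
    obtain v q where vq: "v \<in> {\<one>, s, t, s \<otimes> t}" "q \<in> {\<one>, r, r \<otimes> r}" "g p = v \<otimes> q"
      using g_im[OF p] by (elim bexE) (rule that)
    have zi: "z [^] i \<in> {\<one>, z, z \<otimes> z}" using i by (auto simp: carrier_Zn int_pow_numerals)
    have 1: "z [^] i = \<one> \<and> v = \<one> \<and> q = \<one>"
      by (rule ker[OF zi vq(1,2)]) (use eq vq(3) in simp)
    then have "p = \<one>\<^bsub>alt_group 4\<^esub>"
      by (intro hom_eq_one_imp[OF alt_group_is_group g p]) (simp add: vq(3))
    moreover have "i = 0" using 1 by (intro pow_Zn_3_eq_one[OF _ z ne(1) i]) simp_all
    ultimately show "i = \<one>\<^bsub>Zn 3\<^esub> \<and> p = \<one>\<^bsub>alt_group 4\<^esub>" by simp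
  next
    fix i p assume i: "i \<in> carrier (Zn 3)" and p: "p \<in> carrier (alt_group 4)"
    obtain v q where vq: "v \<in> {\<one>, s, t, s \<otimes> t}" "q \<in> {\<one>, r, r \<otimes> r}" "g p = v \<otimes> q"
      using g_im[OF p] by (elim bexE) (rule that)
    from vq(1,2) i show "g p \<otimes> z [^] i = z [^] i \<otimes> g p"
      unfolding vq(3) by (simp only: carrier_Zn) (elim insertE emptyE, simp_all add: rew)
  qed (auto simp: g alt_group_is_group)
qed

end

section \<open>Conjugation of the alternating group by a transposition\<close>

lemma transpose_conj_gens:
  "tau \<circ> v1 \<circ> tau = v1" "tau \<circ> v2 \<circ> tau = v1 \<circ> v2" "tau \<circ> rho \<circ> tau = rho \<circ> rho"
  by (auto simp: rho_def tau_def v1_def v2_def fun_eq_iff transpose_def)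

lemma transpose_conj_comp: "tau \<circ> (p \<circ> q) \<circ> tau = (tau \<circ> p \<circ> tau) \<circ> (tau \<circ> q \<circ> tau)"
  using perm_relations(2) by (simp add: fun_eq_iff)

lemma transpose_conj_alt_group: "p \<in> carrier (alt_group 4) \<Longrightarrow> tau \<circ> p \<circ> tau \<in> carrier (alt_group 4)"
proof -
  assume p: "p \<in> carrier (alt_group 4)"
  have tau: "tau permutes {1..4}" "permutation tau" "\<not> evenperm tau"
    by (auto simp: tau_def evenperm_swap permutation_swap_id intro: permutes_swap_id)
  have "tau \<circ> p \<circ> tau permutes {1..4}"
    using p tau by (auto simp: alt_group_carrier intro: permutes_compose)
  moreover have "evenperm (tau \<circ> p \<circ> tau)"
    using p tau alt_group_carrier'[OF p] by (simp add: alt_group_carrier evenperm_comp permutation_compose)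
  ultimately show ?thesis by (simp add: alt_group_carrier)
qed

context group
begin

lemma iso_SG_72_43:
  assumes [simp]: "z \<in> carrier G" "s \<in> carrier G" "t \<in> carrier G" and rc [simp]: "r \<in> carrier G"
    and xc [simp]: "x \<in> carrier G"
    and z: "z \<otimes> (z \<otimes> z) = \<one>" and s: "s \<otimes> s = \<one>" and t: "t \<otimes> t = \<one>"
    and sz: "s \<otimes> z = z \<otimes> s" and tz: "t \<otimes> z = z \<otimes> t" and ts: "t \<otimes> s = s \<otimes> t"
    and ne: "z \<noteq> \<one>" "s \<noteq> \<one>" "t \<noteq> \<one>" "s \<noteq> t"
    and r: "r \<otimes> (r \<otimes> r) = \<one>" and rz: "r \<otimes> z = z \<otimes> r" and rs: "r \<otimes> s = t \<otimes> r"
    and rt: "r \<otimes> t = s \<otimes> (t \<otimes> r)"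
    and x: "x \<otimes> x = \<one>" and xz: "x \<otimes> z = z \<otimes> (z \<otimes> x)" and xs: "x \<otimes> s = s \<otimes> x"
    and xt: "x \<otimes> t = s \<otimes> (t \<otimes> x)" and xr: "x \<otimes> r = r \<otimes> (r \<otimes> x)"
    and cover: "\<And>y. y \<in> carrier G \<Longrightarrow>
      \<exists>p \<in> {\<one>, z, z \<otimes> z}. \<exists>v \<in> {\<one>, s, t, s \<otimes> t}. \<exists>q \<in> {\<one>, r, r \<otimes> r}. \<exists>m \<in> {\<one>, x}.
        y = (p \<otimes> (v \<otimes> q)) \<otimes> m"
  shows "G \<cong> SG_72_43"
proof -
  note rels = s t sz tz ts rz rs rt
  note rew = rels rels[THEN m_assoc_subst] m_assoc z r cube_cancel[OF z] cube_cancel[OF r] int_pow_numerals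
  obtain g where g: "g \<in> hom (alt_group 4) G" "inj_on g (carrier (alt_group 4))"
    and im: "g ` carrier (alt_group 4) = (\<lambda>((i, j), k). (s [^] i \<otimes> t [^] j) \<otimes> r [^] k) `
      (({0, 1::int} \<times> {0, 1::int}) \<times> {0, 1, 2::int})"
    and gens: "g v1 = s" "g v2 = t" "g rho = r"
    using obtain_alt_group_4_hom[OF assms(2,3) rc s t ts r rs rt ne(2-4)] by blast
  have im': "g ` carrier (alt_group 4) = (\<lambda>(v, q). v \<otimes> q) ` ({\<one>, s, t, s \<otimes> t} \<times> {\<one>, r, r \<otimes> r})"
    unfolding im by (simp add: rew insert_Times_insert insert_commute)
  have g_im: "\<exists>v \<in> {\<one>, s, t, s \<otimes> t}. \<exists>q \<in> {\<one>, r, r \<otimes> r}. g p = v \<otimes> q" if "p \<in> carrier (alt_group 4)" for p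
    using im' that by (rule image_mult_elim)
  note ker = three_cycle_word_eq_one[OF assms(1-3) rc z s t sz tz ts ne rs rt]
  have gc [simp]: "g p \<in> carrier G" if "p \<in> carrier (alt_group 4)" for p
    using that g(1) by (auto simp: hom_def)
  have gm: "g (p \<circ> q) = g p \<otimes> g q" if "p \<in> carrier (alt_group 4)" "q \<in> carrier (alt_group 4)" for p q
    using hom_mult[OF g(1) that] by (simp add: alt_group_mult)
  \<comment> \<open>Conjugation by \<open>x\<close> and conjugation by \<open>tau\<close> correspond
    under \<open>g\<close>: they do so on the generators, by \<open>xs\<close>, \<open>xt\<close>
    and \<open>xr\<close>, and both are multiplicative.\<close>
  have xg: "x \<otimes> g p = g (tau \<circ> p \<circ> tau) \<otimes> x" if "p \<in> carrier (alt_group 4)" for p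
    using that
  proof (induction p rule: alt_group_4_induct)
    case id
    have "g id = \<one>"
      using hom_one[OF g(1) alt_group_is_group group_axioms] by (simp add: alt_group_one)
    moreover have "tau \<circ> id \<circ> tau = id" using perm_relations(2) by simp
    ultimately show ?case by (simp only: l_one r_one xc)
  next
    case (comp p q)
    have "x \<otimes> (g p \<otimes> g q) = (x \<otimes> g p) \<otimes> g q" using comp(1,2) by (simp add: m_assoc)
    also have "\<dots> = g (tau \<circ> p \<circ> tau) \<otimes> (x \<otimes> g q)"
      unfolding comp(3) using comp(1,2) transpose_conj_alt_group by (simp add: m_assoc)
    also have "\<dots> = (g (tau \<circ> p \<circ> tau) \<otimes> g (tau \<circ> q \<circ> tau)) \<otimes> x"
      unfolding comp(4) using comp(1,2) transpose_conj_alt_group by (simp add: m_assoc)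
    finally show ?case
      unfolding transpose_conj_comp by (simp only: gm comp(1,2) transpose_conj_alt_group)
  qed (simp_all only: transpose_conj_gens gm perm_in_carrier gens xs xt xr, simp_all add: m_assoc)
  have gz: "g p \<otimes> z [^] i = z [^] i \<otimes> g p" if i: "i \<in> carrier (Zn 3)" and p: "p \<in> carrier (alt_group 4)" for i p
  proof -
    obtain v q where vq: "v \<in> {\<one>, s, t, s \<otimes> t}" "q \<in> {\<one>, r, r \<otimes> r}" "g p = v \<otimes> q"
      using g_im[OF p] by (elim bexE) (rule that)
    from vq(1,2) i show "g p \<otimes> z [^] i = z [^] i \<otimes> g p"
      unfolding vq(3) by (simp only: carrier_Zn) (elim insertE emptyE, simp_all add: rew)
  qed
  let ?F = "\<lambda>(i, p). z [^] i \<otimes> g p"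
  have F: "?F \<in> hom (Zn 3 \<times>\<times> alt_group 4) G"
    unfolding DirProd_eq_semidirect_prod
  proof (rule hom_semidirect_prod)
    show "(\<lambda>i. z [^] i) \<in> hom (Zn 3) G"
      by (rule hom_Zn; simp add: numeral_eq_Suc rew)
  qed (simp_all add: g gz)
  show ?thesis
    unfolding SG_72_43_def tau_def[symmetric]
  proof (rule is_iso_semidirect_prod)
    show "?F \<in> hom (Zn 3 \<times>\<times> alt_group 4) G" by (rule F)
    show "(\<lambda>i. x [^] i) \<in> hom (Zn 2) G"
      by (rule hom_Zn; simp add: numeral_eq_Suc x)
  next
    fix y assume "y \<in> carrier G"
    from cover[OF this] obtain p v q m where y: "p \<in> {\<one>, z, z \<otimes> z}" "v \<in> {\<one>, s, t, s \<otimes> t}"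
      "q \<in> {\<one>, r, r \<otimes> r}" "m \<in> {\<one>, x}" "y = p \<otimes> (v \<otimes> q) \<otimes> m"
      by (elim bexE) (rule that)
    obtain h where h: "h \<in> carrier (alt_group 4)" "v \<otimes> q = g h"
      using image_mult_intro[OF im' y(2,3)] by (elim bexE)
    obtain i where i: "i \<in> carrier (Zn 3)" "p = z [^] i" using image_Zn(2)[OF assms(1) y(1)] by (elim bexE)
    obtain k where k: "k \<in> carrier (Zn 2)" "m = x [^] k" using image_Zn(1)[OF xc y(4)] by (elim bexE)
    have "y = ?F (i, h) \<otimes> x [^] k" unfolding y(5) h(2) i(2) k(2) by simp
    then show "\<exists>n\<in>carrier (Zn 3 \<times>\<times> alt_group 4). \<exists>h\<in>carrier (Zn 2). y = ?F n \<otimes> x [^] h"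
      using i(1) h(1) k(1) by (intro bexI[of _ "(i, h)"] bexI[of _ k]) simp_all
  next
    fix n k assume n: "n \<in> carrier (Zn 3 \<times>\<times> alt_group 4)" and k: "k \<in> carrier (Zn 2)" and eq: "?F n \<otimes> x [^] k = \<one>"
    obtain i p where ip: "n = (i, p)" "i \<in> carrier (Zn 3)" "p \<in> carrier (alt_group 4)" using n by auto
    have k0: "k = 0"
    proof (rule ccontr)
      assume "k \<noteq> 0"
      then have k1: "k = 1" using k by (auto simp: carrier_Zn)
      have gz1: "g p \<otimes> (z \<otimes> d) = z \<otimes> (g p \<otimes> d)" if "d \<in> carrier G" for d
        using gz[OF _ ip(3), of 1] that ip(3) by (simp add: carrier_Zn int_pow_numerals flip: m_assoc)
      \<comment> \<open>A word ending in \<open>x\<close> inverts \<open>z\<close>, since the other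
        factors centralise it; so it is not the identity.\<close>
      have "(?F n \<otimes> x) \<otimes> z = z [^] i \<otimes> (z \<otimes> z) \<otimes> (g p \<otimes> x)"
        using ip(3) by (simp add: ip(1) m_assoc xz gz1)
      also have "z [^] i \<otimes> (z \<otimes> z) = (z \<otimes> z) \<otimes> z [^] i"
        using ip(2) by (auto simp: carrier_Zn int_pow_numerals m_assoc)
      finally have "(?F n \<otimes> x) \<otimes> z = (z \<otimes> z) \<otimes> (?F n \<otimes> x)"
        using ip(3) by (simp add: ip(1) m_assoc)
      moreover have "?F n \<otimes> x = \<one>" using eq k1 by (simp add: int_pow_numerals)
      ultimately have "\<one> \<otimes> z = (z \<otimes> z) \<otimes> \<one>" by (simp only:)
      then show False using ne by simp
    qed
    obtain v q where vq: "v \<in> {\<one>, s, t, s \<otimes> t}" "q \<in> {\<one>, r, r \<otimes> r}" "g p = v \<otimes> q"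
      using g_im[OF ip(3)] by (elim bexE) (rule that)
    have zi: "z [^] i \<in> {\<one>, z, z \<otimes> z}" using ip(2) by (auto simp: carrier_Zn int_pow_numerals)
    have "z [^] i \<otimes> g p = \<one>" using eq ip(3) by (simp add: k0 ip(1))
    then have 1: "z [^] i = \<one> \<and> v = \<one> \<and> q = \<one>"
      by (intro ker[OF zi vq(1,2)]) (simp add: vq(3))
    then have "p = \<one>\<^bsub>alt_group 4\<^esub>"
      by (intro hom_eq_one_imp[OF alt_group_is_group g ip(3)]) (simp add: vq(3))
    moreover have "i = 0" using 1 by (intro pow_Zn_3_eq_one[OF _ z ne(1) ip(2)]) simp_all
    ultimately show "n = \<one>\<^bsub>Zn 3 \<times>\<times> alt_group 4\<^esub> \<and> k = \<one>\<^bsub>Zn 2\<^esub>" by (simp add: k0 ip(1))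
  next
    fix n k assume n: "n \<in> carrier (Zn 3 \<times>\<times> alt_group 4)" and k: "k \<in> carrier (Zn 2)"
    obtain i p where ip: "n = (i, p)" "i \<in> carrier (Zn 3)" "p \<in> carrier (alt_group 4)" using n by auto
    have xzi: "x \<otimes> z [^] i = z [^] ((- i) mod 3) \<otimes> x"
      using ip(2) by (simp only: carrier_Zn)
        (elim insertE emptyE, simp_all add: m_assoc xz int_pow_numerals m_assoc_subst[OF xz] cube_cancel[OF z])
    show "x [^] k \<otimes> ?F n = ?F ((\<lambda>(a, p). if k = 0 then (a, p) else ((- a) mod 3, tau \<circ> p \<circ> tau)) n) \<otimes> x [^] k"
    proof (cases "k = 0")
      case False
      then have k1: "k = 1" using k by (auto simp: carrier_Zn)
      have "x \<otimes> (z [^] i \<otimes> g p) = z [^] ((- i) mod 3) \<otimes> (x \<otimes> g p)"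
        using m_assoc_subst[OF xzi] ip(3) by (simp add: m_assoc)
      then show ?thesis
        using ip(3) transpose_conj_alt_group by (simp add: k1 ip(1) int_pow_numerals xg m_assoc)
    qed (use ip in simp)
    show "(\<lambda>(a, p). if k = 0 then (a, p) else ((- a) mod 3, tau \<circ> p \<circ> tau)) n \<in> carrier (Zn 3 \<times>\<times> alt_group 4)"
      using ip transpose_conj_alt_group by (auto simp: carrier_integer_mod_group)
  qed (simp_all add: DirProd_group alt_group_is_group)
qed

end

section \<open>Non-commuting involutions\<close>

context three_involutions
begin

text \<open>A transposition and a rotation generate all relabellings of \<open>s\<close>,
  \<open>t\<close>, \<open>u\<close>, so later cases are treated for one labelling only. Apart from
  distinctness, the hypotheses mention the three only through the set \<open>T\<close>.\<close>

lemma swap_st: "three_involutions G z t s u"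
proof -
  have e: "{t, s, u} = T" by auto
  show ?thesis
    by (unfold_locales, unfold e)
      (fact exponent z_closed z3 z_ne T_closed T_sq T_ne T_comm order_6 | use distinct in simp)+
qed

lemma rotate_stu: "three_involutions G z t u s"
proof -
  have e: "{t, u, s} = T" by auto
  show ?thesis
    by (unfold_locales, unfold e)
      (fact exponent z_closed z3 z_ne T_closed T_sq T_ne T_comm order_6 | use distinct in simp)+
qed

text \<open>By cancellation, conjugation is injective on \<open>T\<close>, hence one of six
  permutations: the identity, three transpositions, two 3-cycles, in this order.\<close>

lemma conj_T_cases:
  assumes g: "g \<in> carrier G"
  obtains "g \<otimes> s = s \<otimes> g" "g \<otimes> t = t \<otimes> g" "g \<otimes> u = u \<otimes> g"
    | "g \<otimes> s = s \<otimes> g" "g \<otimes> t = u \<otimes> g" "g \<otimes> u = t \<otimes> g"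
    | "g \<otimes> s = t \<otimes> g" "g \<otimes> t = s \<otimes> g" "g \<otimes> u = u \<otimes> g"
    | "g \<otimes> s = u \<otimes> g" "g \<otimes> t = t \<otimes> g" "g \<otimes> u = s \<otimes> g"
    | "g \<otimes> s = t \<otimes> g" "g \<otimes> t = u \<otimes> g" "g \<otimes> u = s \<otimes> g"
    | "g \<otimes> s = u \<otimes> g" "g \<otimes> t = s \<otimes> g" "g \<otimes> u = t \<otimes> g"
proof -
  obtain a where a: "a \<in> T" "g \<otimes> s = a \<otimes> g" using conj_T[OF g, of s] by blast
  obtain b where b: "b \<in> T" "g \<otimes> t = b \<otimes> g" using conj_T[OF g, of t] by blast
  obtain c where c: "c \<in> T" "g \<otimes> u = c \<otimes> g" using conj_T[OF g, of u] by blast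
  have "x = y" if "g \<otimes> x = d \<otimes> g" "g \<otimes> y = d \<otimes> g" "x \<in> T" "y \<in> T" for x y d
    using that g by (metis T_closed' left_cancel)
  then have "a \<noteq> b" "a \<noteq> c" "b \<noteq> c"
    using distinct a(2) b(2) c(2) by blast+
  then have "a = s \<and> b = t \<and> c = u \<or>
    a = s \<and> b = u \<and> c = t \<or>
    a = t \<and> b = s \<and> c = u \<or>
    a = u \<and> b = t \<and> c = s \<or>
    a = t \<and> b = u \<and> c = s \<or>
    a = u \<and> b = s \<and> c = t"
    using a(1) b(1) c(1) by auto
  then show ?thesis
  proof (elim disjE conjE)
    assume "a = s" "b = t" "c = u"
    then show ?thesis using a(2) b(2) c(2) by (intro that(1)) simp_all
  next
    assume "a = s" "b = u" "c = t"
    then show ?thesis using a(2) b(2) c(2) by (intro that(2)) simp_all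
  next
    assume "a = t" "b = s" "c = u"
    then show ?thesis using a(2) b(2) c(2) by (intro that(3)) simp_all
  next
    assume "a = u" "b = t" "c = s"
    then show ?thesis using a(2) b(2) c(2) by (intro that(4)) simp_all
  next
    assume "a = t" "b = u" "c = s"
    then show ?thesis using a(2) b(2) c(2) by (intro that(5)) simp_all
  next
    assume "a = u" "b = s" "c = t"
    then show ?thesis using a(2) b(2) c(2) by (intro that(6)) simp_all
  qed
qed

lemma mult_mult_cancel:
  assumes "a \<in> carrier G" "b \<in> carrier G" "a \<otimes> z = z \<otimes> (z \<otimes> a)" "b \<otimes> z = z \<otimes> (z \<otimes> b)"
  shows "(a \<otimes> b) \<otimes> z = z \<otimes> (a \<otimes> b)"
  using assms by (simp add: m_assoc m_assoc_subst[OF assms(3)] cube_cancel[OF z3])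

lemma inverting_inv:
  assumes "x \<in> carrier G" "x \<otimes> z = z \<otimes> (z \<otimes> x)"
  shows "inv x \<otimes> z = z \<otimes> (z \<otimes> inv x)"
proof -
  have "x \<otimes> (z \<otimes> (z \<otimes> inv x)) = z"
    using assms by (simp add: m_assoc_subst[OF assms(2)] m_assoc cube_cancel[OF z3])
  then show ?thesis
    using assms(1) by (metis inv_solve_left m_closed inv_closed z_closed)
qed

text \<open>Here \<open>T\<close> consists of the three involutions of a subgroup
  \<open>S\<^sub>3\<close> generated by \<open>r\<close> and \<open>s\<close>, and this subgroup
  induces all permutations of \<open>T\<close>. Any \<open>y\<close> can therefore be multiplied by
  some \<open>e\<close> of it so as to centralise \<open>s\<close> and \<open>t\<close>;
  \<open>central\<close> puts the result into \<open>P\<close>.\<close>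

lemma iso_SG_18_3_if_noncommuting:
  assumes nc: "s \<otimes> t \<noteq> t \<otimes> s"
  shows "G \<cong> SG_18_3"
proof -
  have sq: "s \<otimes> s = \<one>" "t \<otimes> t = \<one>" "u \<otimes> u = \<one>" using T_sq by auto
  have zc: "s \<otimes> z = z \<otimes> s" "t \<otimes> z = z \<otimes> t" using T_comm by auto
  \<comment> \<open>Conjugation by \<open>s\<close> fixes \<open>s\<close> but not \<open>t\<close>,
    so it swaps \<open>t\<close> and \<open>u\<close>.\<close>
  have 1: "s \<otimes> t = u \<otimes> s"
    using conj_T_cases[OF stu_closed(1)] nc distinct sq by (metis stu_closed right_cancel left_cancel)
  have 2: "t \<otimes> s = u \<otimes> t"
    using conj_T_cases[OF stu_closed(2)] nc distinct sq by (metis stu_closed right_cancel left_cancel)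
  define r where "r = s \<otimes> t"
  have r [simp]: "r \<in> carrier G" by (simp add: r_def)
  have sr: "s \<otimes> r = t" by (simp add: r_def m_assoc_subst[OF sq(1)])
  have us: "u = s \<otimes> (t \<otimes> s)" using 1 sq
    by (metis m_assoc r_one stu_closed)
  have ut: "u = t \<otimes> (s \<otimes> t)" using 2 sq
    by (metis m_assoc r_one stu_closed)
  have "r \<otimes> (r \<otimes> r) = (s \<otimes> (t \<otimes> s)) \<otimes> (t \<otimes> (s \<otimes> t))"
    by (simp add: r_def m_assoc)
  also have "\<dots> = \<one>" using us ut sq(3) by simp
  finally have r3: "r \<otimes> (r \<otimes> r) = \<one>" .
  have rz: "r \<otimes> z = z \<otimes> r" by (simp add: r_def m_assoc zc m_assoc_subst[OF zc(1)])
  have srr: "s \<otimes> r = r \<otimes> (r \<otimes> s)"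
  proof -
    have "r \<otimes> (s \<otimes> r) = s" by (simp add: sr) (simp add: r_def m_assoc sq)
    then have "r \<otimes> (r \<otimes> (r \<otimes> (s \<otimes> r))) = r \<otimes> (r \<otimes> s)" by simp
    then show ?thesis by (simp add: cube_cancel[OF r3])
  qed
  have t_eq: "t = r \<otimes> (r \<otimes> s)" using sr srr by simp
  have u_eq: "u = r \<otimes> s" unfolding r_def using us by (simp add: m_assoc)
  have rne: "r \<noteq> \<one>" using nc sq by (metis r_def stu_closed left_cancel)
  note rew = m_assoc srr r3 sq(1) cube_cancel[OF r3] m_assoc_subst[OF srr] m_assoc_subst[OF sq(1)]
  have central: "c \<in> {\<one>, z, z \<otimes> z}"
    if c: "c \<in> carrier G" and cs: "c \<otimes> s = s \<otimes> c" and ct: "c \<otimes> t = t \<otimes> c" for c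
  proof -
    have cr: "c \<otimes> r = r \<otimes> c"
      using c by (simp add: r_def ct m_assoc m_assoc_subst[OF cs] flip: ct)
    have noT: "x \<otimes> s \<noteq> s \<otimes> x \<or> x \<otimes> t \<noteq> t \<otimes> x" if "x \<in> T" for x
    proof -
      have "u \<otimes> s \<noteq> s \<otimes> u" using 1 distinct(3) left_cancel[of s t u] by auto
      then show ?thesis using that nc by auto
    qed
    show ?thesis
    proof (cases "c \<otimes> z = z \<otimes> c")
      case cz: True
      show ?thesis
      proof (rule centralizer_cases[OF c cz])
        assume "c \<otimes> (c \<otimes> c) = \<one>"
        then show ?thesis using order_3_commuting_with_T[OF c _ _ cs] by simp
      next
        fix x assume x: "x \<in> T" "c = z \<otimes> x \<or> c = z \<otimes> (z \<otimes> x)"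
        have xz: "x \<otimes> z = z \<otimes> x" and [simp]: "x \<in> carrier G" using T_comm x(1) T_closed' by auto
        \<comment> \<open>The powers of \<open>z\<close> in \<open>c\<close> can be cancelled, so
          \<open>x\<close> inherits the commutation of \<open>c\<close> with \<open>s\<close> and
          \<open>t\<close>; no member of \<open>T\<close> commutes with both.\<close>
        have "x \<otimes> w = w \<otimes> x" if w: "w \<in> carrier G" "w \<otimes> z = z \<otimes> w" "c \<otimes> w = w \<otimes> c" for w
        proof -
          have "c \<otimes> w = z \<otimes> (x \<otimes> w) \<and> w \<otimes> c = z \<otimes> (w \<otimes> x) \<or>
            c \<otimes> w = z \<otimes> (z \<otimes> (x \<otimes> w)) \<and> w \<otimes> c = z \<otimes> (z \<otimes> (w \<otimes> x))"
            using x(2) w(1) by (auto simp: m_assoc w(2) m_assoc_subst[OF w(2)])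
          then show ?thesis using w by (auto simp: left_cancel)
        qed
        then have "x \<otimes> s = s \<otimes> x" "x \<otimes> t = t \<otimes> x" using cs ct zc by auto
        then show ?thesis using noT[OF x(1)] by blast
      qed (use noT cs ct in auto)
    next
      case False
      then have cz: "c \<otimes> z = z \<otimes> (z \<otimes> c)" using conj_z[OF c] by blast
      \<comment> \<open>If \<open>c\<close> inverts \<open>z\<close>, so does
        \<open>r \<otimes> c\<close>, and both have trivial fourth power. As \<open>r\<close> and
        \<open>c\<close> commute, \<open>r^4 = r\<close> would be trivial.\<close>
      have "(r \<otimes> c) \<otimes> z = z \<otimes> (z \<otimes> (r \<otimes> c))"
        using c by (simp add: m_assoc cz m_assoc_subst[OF rz])
      then have "(r \<otimes> c) [^] (4::nat) = \<one>" using inverting_pow_4 c by simp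
      moreover have "(r \<otimes> c) [^] (4::nat) = r [^] (4::nat) \<otimes> c [^] (4::nat)"
        by (rule pow_mult_distrib) (simp_all add: cr c)
      ultimately have "r = \<one>"
        using inverting_pow_4[OF c cz] pow_numerals_order_3[OF r r3] by simp
      then show ?thesis using rne by simp
    qed
  qed
  show ?thesis
  proof (rule iso_SG_18_3[of z r s])
    fix y assume y: "y \<in> carrier G"
    have act: "(e \<otimes> y) \<otimes> a = b \<otimes> (e \<otimes> y)"
      if "y \<otimes> a = a' \<otimes> y" "e \<otimes> a' = b \<otimes> e" "e \<in> carrier G" "a \<in> T" "a' \<in> T" "b \<in> T" for e a a' b
    proof -
      have "(e \<otimes> y) \<otimes> a = e \<otimes> (a' \<otimes> y)"
        using that y T_closed'[OF that(4)] by (simp add: m_assoc)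
      also have "\<dots> = b \<otimes> (e \<otimes> y)"
        using m_assoc_subst[OF that(2)] that(3) y T_closed'[OF that(5)] T_closed'[OF that(6)]
        by (simp add: m_assoc)
      finally show ?thesis .
    qed
    \<comment> \<open>In each of the six cases \<open>e\<close> undoes the permutation that
      \<open>y\<close> induces on \<open>T\<close>.\<close>
    obtain e where e: "e \<in> {\<one>, r, r \<otimes> r, s, r \<otimes> s, r \<otimes> (r \<otimes> s)}"
      "(e \<otimes> y) \<otimes> s = s \<otimes> (e \<otimes> y)" "(e \<otimes> y) \<otimes> t = t \<otimes> (e \<otimes> y)"
    proof (rule conj_T_cases[OF y])
      assume h: "y \<otimes> s = s \<otimes> y" "y \<otimes> t = t \<otimes> y"
      show thesis by (rule that[of \<one>, OF _ act[OF h(1)] act[OF h(2)]]) (simp_all add: rew t_eq u_eq)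
    next
      assume h: "y \<otimes> s = s \<otimes> y" "y \<otimes> t = u \<otimes> y"
      show thesis by (rule that[of s, OF _ act[OF h(1)] act[OF h(2)]]) (simp_all add: rew t_eq u_eq)
    next
      assume h: "y \<otimes> s = t \<otimes> y" "y \<otimes> t = s \<otimes> y"
      show thesis by (rule that[of "r \<otimes> s", OF _ act[OF h(1)] act[OF h(2)]]) (simp_all add: rew t_eq u_eq)
    next
      assume h: "y \<otimes> s = u \<otimes> y" "y \<otimes> t = t \<otimes> y"
      show thesis by (rule that[of "r \<otimes> (r \<otimes> s)", OF _ act[OF h(1)] act[OF h(2)]]) (simp_all add: rew t_eq u_eq)
    next
      assume h: "y \<otimes> s = t \<otimes> y" "y \<otimes> t = u \<otimes> y"
      show thesis by (rule that[of "r \<otimes> r", OF _ act[OF h(1)] act[OF h(2)]]) (simp_all add: rew t_eq u_eq)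
    next
      assume h: "y \<otimes> s = u \<otimes> y" "y \<otimes> t = s \<otimes> y"
      show thesis by (rule that[of r, OF _ act[OF h(1)] act[OF h(2)]]) (simp_all add: rew t_eq u_eq)
    qed
    have ec: "e \<in> carrier G" using e(1) by auto
    have p: "e \<otimes> y \<in> {\<one>, z, z \<otimes> z}" by (rule central) (use e ec y in auto)
    have "\<exists>q \<in> {\<one>, r, r \<otimes> r}. \<exists>m \<in> {\<one>, s}. (q \<otimes> m) \<otimes> e = \<one>"
      using e(1) by (elim insertE emptyE) (simp_all add: rew)
    then obtain q m where qm: "q \<in> {\<one>, r, r \<otimes> r}" "m \<in> {\<one>, s}" "(q \<otimes> m) \<otimes> e = \<one>" by (elim bexE)
    have qc: "q \<in> carrier G" "m \<in> carrier G" using qm by auto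
    have "y = ((q \<otimes> m) \<otimes> e) \<otimes> y" using qm(3) y by simp
    also have "\<dots> = (q \<otimes> m) \<otimes> (e \<otimes> y)" using qc ec y by (simp add: m_assoc)
    also have "\<dots> = (e \<otimes> y) \<otimes> (q \<otimes> m)"
      using p qm(1,2) by (elim insertE emptyE) (simp_all add: m_assoc rz zc m_assoc_subst[OF rz] m_assoc_subst[OF zc(1)])
    finally show "\<exists>p \<in> {\<one>, z, z \<otimes> z}. \<exists>q \<in> {\<one>, r, r \<otimes> r}. \<exists>m \<in> {\<one>, s}. y = p \<otimes> (q \<otimes> m)"
      using p qm(1,2) by blast
  qed (simp_all add: z3 r3 sq rz zc z_ne rne T_ne, rule srr)
qed

end

section \<open>Commuting involutions\<close>

locale commuting_involutions = three_involutions +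
  assumes ts: "t \<otimes> s = s \<otimes> t"
begin

text \<open>The product of \<open>s\<close> and \<open>t\<close> is an involution centralising
  \<open>z\<close>, so it is in \<open>T\<close> by \<open>centralizer_involution\<close>, and it is
  neither \<open>s\<close> nor \<open>t\<close>.\<close>

lemma u_eq: "u = s \<otimes> t"
proof -
  have sq: "s \<otimes> s = \<one>" "t \<otimes> t = \<one>" using T_sq by auto
  have zc: "s \<otimes> z = z \<otimes> s" "t \<otimes> z = z \<otimes> t" using T_comm by auto
  have "s \<otimes> t \<in> T"
  proof (rule centralizer_involution)
    show "s \<otimes> t \<otimes> z = z \<otimes> (s \<otimes> t)" by (simp add: m_assoc zc m_assoc_subst[OF zc(1)])
    show "s \<otimes> t \<otimes> (s \<otimes> t) = \<one>"
      by (simp add: m_assoc m_assoc_subst[OF ts] sq m_assoc_subst[OF sq(1)] m_assoc_subst[OF sq(2)])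
    show "s \<otimes> t \<noteq> \<one>" using sq(1) distinct(1) left_cancel[of s t s] by auto
  qed simp
  moreover have "s \<otimes> t \<noteq> s" "s \<otimes> t \<noteq> t" using T_ne by auto
  ultimately show ?thesis by auto
qed

lemma relations:
  shows s2: "s \<otimes> s = \<one>" and t2: "t \<otimes> t = \<one>" and u2: "u \<otimes> u = \<one>"
    and sz: "s \<otimes> z = z \<otimes> s" and tz: "t \<otimes> z = z \<otimes> t" and uz: "u \<otimes> z = z \<otimes> u"
    and st: "s \<otimes> t = u" and su: "s \<otimes> u = t" and us: "u \<otimes> s = t" and tu: "t \<otimes> u = s" and ut: "u \<otimes> t = s"
proof -
  show s2: "s \<otimes> s = \<one>" and t2: "t \<otimes> t = \<one>" and "u \<otimes> u = \<one>" using T_sq by auto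
  show "s \<otimes> z = z \<otimes> s" "t \<otimes> z = z \<otimes> t" "u \<otimes> z = z \<otimes> u" using T_comm by auto
  show "s \<otimes> t = u" by (simp add: u_eq)
  show "s \<otimes> u = t" by (simp add: u_eq m_assoc_subst[OF s2])
  show "u \<otimes> t = s" by (simp add: u_eq m_assoc t2)
  show "u \<otimes> s = t" by (simp add: u_eq m_assoc ts m_assoc_subst[OF s2])
  show "t \<otimes> u = s" by (simp add: u_eq m_assoc_subst[OF ts]) (simp add: m_assoc t2)
qed

lemma commuting_swap: "commuting_involutions G z t s u"
  using swap_st ts by (simp add: commuting_involutions_def commuting_involutions_axioms_def)

lemma commuting_rotate: "commuting_involutions G z t u s"
  using rotate_stu by (simp add: commuting_involutions_def commuting_involutions_axioms_def tu ut)

lemma generators_ne [simp]: "z \<noteq> \<one>" "s \<noteq> \<one>" "t \<noteq> \<one>" "s \<noteq> t"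
  using T_ne distinct z_ne by auto

text \<open>Commutation with a member of \<open>T\<close> matters for elements of order 3 only: it
  separates those in \<open>P\<close> from possible 3-cycles on \<open>T\<close>.\<close>

lemma cover_PV:
  assumes c: "c \<in> carrier G" and cz: "c \<otimes> z = z \<otimes> c" and x: "x \<in> T" and cx: "c \<otimes> x = x \<otimes> c"
  shows "\<exists>p \<in> {\<one>, z, z \<otimes> z}. \<exists>v \<in> {\<one>, s, t, s \<otimes> t}. c = p \<otimes> v"
proof (rule centralizer_cases[OF c cz])
  assume "c \<otimes> (c \<otimes> c) = \<one>"
  then have "c \<in> {\<one>, z, z \<otimes> z}" using order_3_commuting_with_T[OF c _ x cx] by simp
  then show ?thesis using c by (intro bexI[of _ c] bexI[of _ \<one>]) simp_all
next
  assume "c \<in> T"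
  then show ?thesis using c by (intro bexI[of _ \<one>] bexI[of _ c]) (auto simp: u_eq)
next
  fix y assume y: "y \<in> T" "c = z \<otimes> y \<or> c = z \<otimes> (z \<otimes> y)"
  have "y \<in> {\<one>, s, t, s \<otimes> t}" using y(1) by (auto simp: u_eq)
  moreover have "\<exists>p \<in> {\<one>, z, z \<otimes> z}. c = p \<otimes> y" using y T_closed'[OF y(1)] by (auto simp: m_assoc)
  ultimately show ?thesis by (elim bexE) (intro bexI)
qed (intro bexI[of _ \<one>], simp_all)

lemma inverting_square:
  assumes x: "x \<in> carrier G" and xz: "x \<otimes> z = z \<otimes> (z \<otimes> x)"
  shows "x \<otimes> x = \<one> \<or> x \<otimes> x \<in> T"
proof -
  have "(x \<otimes> x) \<otimes> z = z \<otimes> (x \<otimes> x)" by (rule mult_mult_cancel) (fact x xz)+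
  moreover have "(x \<otimes> x) \<otimes> (x \<otimes> x) = \<one>"
    using inverting_pow_4[OF x xz] x by (simp add: numeral_eq_Suc m_assoc)
  ultimately show ?thesis using centralizer_involution x by blast
qed

text \<open>A nontrivial square of \<open>x\<close> lies in \<open>T\<close> and commutes with
  \<open>x\<close>, so it is \<open>s\<close>. Then \<open>x \<otimes> t\<close> acts on
  \<open>z\<close> and \<open>T\<close> as \<open>x\<close> does, and
  \<open>x t x t = u x x t = u s t = u u = \<one>\<close>.\<close>

lemma obtain_inverting_involution:
  assumes x: "x \<in> carrier G" and xz: "x \<otimes> z = z \<otimes> (z \<otimes> x)" and xs: "x \<otimes> s = s \<otimes> x"
    and xt: "x \<otimes> t = u \<otimes> x" and xu: "x \<otimes> u = t \<otimes> x"
  obtains y where "y \<in> carrier G" "y \<otimes> z = z \<otimes> (z \<otimes> y)" "y \<otimes> s = s \<otimes> y" "y \<otimes> t = u \<otimes> y"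
    "y \<otimes> u = t \<otimes> y" "y \<otimes> y = \<one>"
proof (cases "x \<otimes> x = \<one>")
  case True
  with that assms show ?thesis by blast
next
  case False
  then have xx: "x \<otimes> x \<in> T" using inverting_square[OF x xz] by blast
  have "x \<otimes> (x \<otimes> x) = (x \<otimes> x) \<otimes> x" using x by (simp add: m_assoc)
  moreover have "x \<otimes> t \<noteq> t \<otimes> x" "x \<otimes> u \<noteq> u \<otimes> x" using xt xu distinct x by auto
  ultimately have xx: "x \<otimes> x = s" using xx by auto
  note rels = xz xs xt xu sz tz uz
  note rew = rels rels[THEN m_assoc_subst] m_assoc
  show ?thesis
  proof (rule that[of "x \<otimes> t"])
    show "x \<otimes> t \<otimes> z = z \<otimes> (z \<otimes> (x \<otimes> t))" using x by (simp add: rew)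
    show "x \<otimes> t \<otimes> s = s \<otimes> (x \<otimes> t)" using x by (simp add: m_assoc ts xs m_assoc_subst[OF xs])
    show "x \<otimes> t \<otimes> t = u \<otimes> (x \<otimes> t)" using x by (simp add: rew)
    show "x \<otimes> t \<otimes> u = t \<otimes> (x \<otimes> t)" using x by (simp add: m_assoc tu xs xt xu m_assoc_subst[OF tu] m_assoc_subst[OF ut])
    have "(x \<otimes> t) \<otimes> (x \<otimes> t) = u \<otimes> ((x \<otimes> x) \<otimes> t)" using x by (simp add: m_assoc m_assoc_subst[OF xt])
    also have "\<dots> = \<one>" by (simp add: xx st u2)
    finally show "x \<otimes> t \<otimes> (x \<otimes> t) = \<one>" .
  qed (use x in simp)
qed

lemma inverting_not_3_cycle:
  assumes y: "y \<in> carrier G" and yz: "y \<otimes> z = z \<otimes> (z \<otimes> y)"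
    and ys: "y \<otimes> s = t \<otimes> y" and yt: "y \<otimes> t = u \<otimes> y" and yu: "y \<otimes> u = s \<otimes> y"
  shows False
proof -
  have y4: "y \<otimes> (y \<otimes> (y \<otimes> y)) = \<one>"
    using inverting_pow_4[OF y yz] y by (simp add: numeral_eq_Suc m_assoc)
  \<comment> \<open>The fourth power of a 3-cycle is the 3-cycle itself.\<close>
  have "(y \<otimes> (y \<otimes> (y \<otimes> y))) \<otimes> s = t \<otimes> (y \<otimes> (y \<otimes> (y \<otimes> y)))"
    using y by (simp add: m_assoc ys yt yu m_assoc_subst[OF ys] m_assoc_subst[OF yt] m_assoc_subst[OF yu])
  then show False using y4 by simp
qed

text \<open>All other kinds of elements in \<open>centralizer_cases\<close> commute with
  \<open>s\<close>, because \<open>V\<close> is abelian, whereas \<open>r\<close> does not.\<close>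

lemma three_cycle_order_3:
  assumes r: "r \<in> carrier G" and rz: "r \<otimes> z = z \<otimes> r" and rs: "r \<otimes> s = t \<otimes> r"
  shows "r \<otimes> (r \<otimes> r) = \<one>"
proof (rule ccontr)
  have ne: "r \<otimes> s \<noteq> s \<otimes> r" using rs r distinct(1) not_sym[OF distinct(1)] by simp
  assume r3: "r \<otimes> (r \<otimes> r) \<noteq> \<one>"
  have T_s: "y \<otimes> s = s \<otimes> y" if "y \<in> T" for y
    using that by (auto simp: ts us su)
  have "r \<otimes> s = s \<otimes> r"
  proof (rule centralizer_cases[OF r rz])
    fix y assume y: "y \<in> T" "r = z \<otimes> y \<or> r = z \<otimes> (z \<otimes> y)"
    note T_closed'[OF y(1)]
    with y(2) show ?thesis by (auto simp: m_assoc T_s[OF y(1)] sz m_assoc_subst[OF sz])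
  qed (use r3 T_s in simp_all)
  then show False using ne by simp
qed

text \<open>The centraliser of \<open>z\<close> has index 2 and \<open>x\<close> represents the
  other coset: two inversions compose to the identity on \<open>P\<close>.\<close>

lemma cover_with_inverting:
  assumes x: "x \<in> carrier G" and xz: "x \<otimes> z = z \<otimes> (z \<otimes> x)" and y: "y \<in> carrier G"
  shows "\<exists>k \<in> carrier G. k \<otimes> z = z \<otimes> k \<and> (\<exists>m \<in> {\<one>, x}. y = k \<otimes> m)"
proof (cases "y \<otimes> z = z \<otimes> y")
  case True
  then show ?thesis using y by (intro bexI[of _ y] conjI bexI[of _ \<one>]) simp_all
next
  case False
  then have yz: "y \<otimes> z = z \<otimes> (z \<otimes> y)" using conj_z[OF y] by blast
  have "(y \<otimes> inv x) \<otimes> z = z \<otimes> (y \<otimes> inv x)"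
    using x y by (intro mult_mult_cancel yz inverting_inv xz) simp_all
  then show ?thesis
    using x y by (intro bexI[of _ "y \<otimes> inv x"] conjI bexI[of _ x]) (simp_all add: m_assoc)
qed

lemma cover_PV_inverting:
  assumes "x \<in> carrier G" "x \<otimes> z = z \<otimes> (z \<otimes> x)" and y: "y \<in> carrier G"
    and C: "\<forall>c \<in> carrier G. c \<otimes> z = z \<otimes> c \<longrightarrow> c \<otimes> s = s \<otimes> c"
  shows "\<exists>p \<in> {\<one>, z, z \<otimes> z}. \<exists>v \<in> {\<one>, s, t, s \<otimes> t}. \<exists>m \<in> {\<one>, x}. y = p \<otimes> (v \<otimes> m)"
proof -
  obtain k where k: "k \<in> carrier G" "k \<otimes> z = z \<otimes> k" "\<exists>m \<in> {\<one>, x}. y = k \<otimes> m"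
    using cover_with_inverting[OF assms(1-3)] by blast
  then obtain m where m: "m \<in> {\<one>, x}" "y = k \<otimes> m" by (elim bexE)
  obtain p v where pv: "p \<in> {\<one>, z, z \<otimes> z}" "v \<in> {\<one>, s, t, s \<otimes> t}" "k = p \<otimes> v"
    using cover_PV[OF k(1,2) insertI1 C[rule_format, OF k(1,2)]] by (elim bexE) (rule that)
  have "p \<in> carrier G" "v \<in> carrier G" "m \<in> carrier G" using pv m assms(1) by auto
  then have "y = p \<otimes> (v \<otimes> m)" by (simp add: m(2) pv(3) m_assoc)
  then show ?thesis using pv(1,2) m(1) by (intro bexI)
qed

lemma iso_SG_24_7_if_square:
  assumes x: "x \<in> carrier G" and xz: "x \<otimes> z = z \<otimes> (z \<otimes> x)"
    and C: "\<forall>c \<in> carrier G. c \<otimes> z = z \<otimes> c \<longrightarrow> c \<otimes> s = s \<otimes> c"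
    and xs: "x \<otimes> s = s \<otimes> x" and xx: "x \<otimes> x = t"
  shows "G \<cong> SG_24_7"
proof (rule iso_SG_24_7[of z s t x])
  show "x \<otimes> t = t \<otimes> x" unfolding xx[symmetric] using x by (simp add: m_assoc)
  show "\<exists>p \<in> {\<one>, z, z \<otimes> z}. \<exists>v \<in> {\<one>, s, t, s \<otimes> t}. \<exists>m \<in> {\<one>, x}. y = p \<otimes> (v \<otimes> m)"
    if "y \<in> carrier G" for y using cover_PV_inverting[OF x xz that C] .
qed (simp_all add: x xz xs xx z3 s2 t2 sz tz ts)

lemma iso_SG_24_14_if_square:
  assumes x: "x \<in> carrier G" and xz: "x \<otimes> z = z \<otimes> (z \<otimes> x)"
    and C: "\<forall>c \<in> carrier G. c \<otimes> z = z \<otimes> c \<longrightarrow> c \<otimes> s = s \<otimes> c"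
    and xs: "x \<otimes> s = s \<otimes> x" and xt: "x \<otimes> t = t \<otimes> x" and xx: "x \<otimes> x = \<one>"
  shows "G \<cong> SG_24_14"
proof (rule iso_SG_24_14[of z s t x])
  show "\<exists>p \<in> {\<one>, z, z \<otimes> z}. \<exists>v \<in> {\<one>, s, t, s \<otimes> t}. \<exists>m \<in> {\<one>, x}. y = p \<otimes> (v \<otimes> m)"
    if "y \<in> carrier G" for y using cover_PV_inverting[OF x xz that C] .
qed (simp_all add: x xz xs xx xt z3 s2 t2 sz tz ts)

lemma iso_SG_24_8_if_transposition:
  assumes "x \<in> carrier G" "x \<otimes> z = z \<otimes> (z \<otimes> x)"
    and C: "\<forall>c \<in> carrier G. c \<otimes> z = z \<otimes> c \<longrightarrow> c \<otimes> s = s \<otimes> c"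
    and "x \<otimes> s = s \<otimes> x" "x \<otimes> t = u \<otimes> x" "x \<otimes> u = t \<otimes> x"
  shows "G \<cong> SG_24_8"
proof -
  obtain y where y: "y \<in> carrier G" and yz: "y \<otimes> z = z \<otimes> (z \<otimes> y)" and "y \<otimes> s = s \<otimes> y" "y \<otimes> t = u \<otimes> y"
    "y \<otimes> y = \<one>"
    using obtain_inverting_involution[OF assms(1,2,4-6)] .
  show ?thesis
  proof (rule iso_SG_24_8[of z s t y])
    show "y \<otimes> t = s \<otimes> (t \<otimes> y)" using \<open>y \<otimes> t = u \<otimes> y\<close> y by (simp add: u_eq m_assoc)
    show "\<exists>p \<in> {\<one>, z, z \<otimes> z}. \<exists>v \<in> {\<one>, s, t, s \<otimes> t}. \<exists>m \<in> {\<one>, y}. w = p \<otimes> (v \<otimes> m)"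
      if "w \<in> carrier G" for w using cover_PV_inverting[OF y yz that C] .
  qed (simp_all add: y yz \<open>y \<otimes> s = s \<otimes> y\<close> \<open>y \<otimes> y = \<one>\<close> z3 s2 t2 sz tz ts)
qed

lemma iso_if_no_3_cycle:
  assumes C: "\<And>c x. c \<in> carrier G \<Longrightarrow> c \<otimes> z = z \<otimes> c \<Longrightarrow> x \<in> T \<Longrightarrow> c \<otimes> x = x \<otimes> c"
  shows "G \<cong> SG_12_5 \<or> G \<cong> SG_24_7 \<or> G \<cong> SG_24_8 \<or> G \<cong> SG_24_14"
proof (cases "\<forall>y \<in> carrier G. y \<otimes> z = z \<otimes> y")
  case True
  have "G \<cong> SG_12_5"
  proof (rule iso_SG_12_5[of z s t])
    show "\<exists>p \<in> {\<one>, z, z \<otimes> z}. \<exists>v \<in> {\<one>, s, t, s \<otimes> t}. y = p \<otimes> v" if y: "y \<in> carrier G" for y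
    proof -
      have yz: "y \<otimes> z = z \<otimes> y" using True y by blast
      show ?thesis by (rule cover_PV[OF y yz insertI1 C[OF y yz insertI1]])
    qed
  qed (simp_all add: z3 s2 t2 sz tz ts)
  then show ?thesis by simp
next
  case False
  then obtain x where x: "x \<in> carrier G" and "x \<otimes> z \<noteq> z \<otimes> x" by blast
  then have xz: "x \<otimes> z = z \<otimes> (z \<otimes> x)" using conj_z[OF x] by blast
  \<comment> \<open>The relabellings bring a given member into its standard role: \<open>t\<close>
    is the square of \<open>x\<close> for \<open>SG_24_7\<close>, and \<open>s\<close> is the fixed
    member for \<open>SG_24_8\<close>.\<close>
  interpret TS: commuting_involutions G z t s u by (rule commuting_swap)
  interpret TU: commuting_involutions G z t u s by (rule commuting_rotate)
  interpret US: commuting_involutions G z u s t by (rule TU.commuting_rotate)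
  have Cs: "\<forall>c \<in> carrier G. c \<otimes> z = z \<otimes> c \<longrightarrow> c \<otimes> y = y \<otimes> c" if "y \<in> T" for y
    using C that by blast
  note C_s = Cs[of s, simplified] and C_t = Cs[of t, simplified] and C_u = Cs[of u, simplified]
  have xx: "(x \<otimes> x) \<otimes> z = z \<otimes> (x \<otimes> x)" by (rule mult_mult_cancel) (fact x xz)+
  show ?thesis
  proof (rule conj_T_cases[OF x])
    assume h: "x \<otimes> s = s \<otimes> x" "x \<otimes> t = t \<otimes> x" "x \<otimes> u = u \<otimes> x"
    consider "x \<otimes> x = \<one>" | "x \<otimes> x = s" | "x \<otimes> x = t" | "x \<otimes> x = u"
      using inverting_square[OF x xz] by blast
    then show ?thesis
    proof cases
      case 1
      then show ?thesis using iso_SG_24_14_if_square[OF x xz C_s h(1,2)] by simp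
    next
      case 2
      then show ?thesis using TS.iso_SG_24_7_if_square[OF x xz C_t h(2)] by simp
    next
      case 3
      then show ?thesis using iso_SG_24_7_if_square[OF x xz C_s h(1)] by simp
    next
      case 4
      then show ?thesis using TU.iso_SG_24_7_if_square[OF x xz C_t h(2)] by simp
    qed
  next
    assume h: "x \<otimes> s = s \<otimes> x" "x \<otimes> t = u \<otimes> x" "x \<otimes> u = t \<otimes> x"
    show ?thesis using iso_SG_24_8_if_transposition[OF x xz C_s h] by simp
  next
    assume h: "x \<otimes> s = t \<otimes> x" "x \<otimes> t = s \<otimes> x" "x \<otimes> u = u \<otimes> x"
    show ?thesis using US.iso_SG_24_8_if_transposition[OF x xz C_u h(3,1,2)] by simp
  next
    assume h: "x \<otimes> s = u \<otimes> x" "x \<otimes> t = t \<otimes> x" "x \<otimes> u = s \<otimes> x"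
    show ?thesis using TU.iso_SG_24_8_if_transposition[OF x xz C_t h(2,3,1)] by simp
  next
    assume h: "x \<otimes> s = t \<otimes> x" "x \<otimes> t = u \<otimes> x"
    \<comment> \<open>If \<open>x\<close> were a 3-cycle on \<open>T\<close>, so would be its
      square, which centralises \<open>z\<close>; this contradicts \<open>C\<close>.\<close>
    have "(x \<otimes> x) \<otimes> s = u \<otimes> (x \<otimes> x)" using x by (simp add: m_assoc h h[THEN m_assoc_subst])
    then show ?thesis using C_s[rule_format, OF _ xx] x distinct by auto
  next
    assume h: "x \<otimes> s = u \<otimes> x" "x \<otimes> u = t \<otimes> x"
    have "(x \<otimes> x) \<otimes> s = t \<otimes> (x \<otimes> x)" using x by (simp add: m_assoc h h[THEN m_assoc_subst])
    then show ?thesis using C_s[rule_format, OF _ xx] x distinct by auto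
  qed
qed

text \<open>Multiplied by a suitable power of \<open>r\<close>, the element \<open>c\<close> fixes a
  member of \<open>T\<close>, and \<open>cover_PV\<close> applies. Identity and transpositions
  already fix one, so only the two 3-cycles need a correction.\<close>

lemma cover_with_3_cycle:
  assumes r: "r \<in> carrier G" and rz: "r \<otimes> z = z \<otimes> r"
    and rs: "r \<otimes> s = t \<otimes> r" and rt: "r \<otimes> t = u \<otimes> r" and ru: "r \<otimes> u = s \<otimes> r"
    and c: "c \<in> carrier G" and cz: "c \<otimes> z = z \<otimes> c"
  shows "\<exists>p \<in> {\<one>, z, z \<otimes> z}. \<exists>v \<in> {\<one>, s, t, s \<otimes> t}. \<exists>q \<in> {\<one>, r, r \<otimes> r}. c = p \<otimes> (v \<otimes> q)"
proof -
  have r3: "r \<otimes> (r \<otimes> r) = \<one>" by (rule three_cycle_order_3) (fact r rz rs)+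
  have ex: ?thesis if k: "k \<in> carrier G" "k \<otimes> z = z \<otimes> k" "x \<in> T" "k \<otimes> x = x \<otimes> k" and q: "q \<in> {\<one>, r, r \<otimes> r}" "c = k \<otimes> q"
    for k x q
  proof -
    obtain p v where pv: "p \<in> {\<one>, z, z \<otimes> z}" "v \<in> {\<one>, s, t, s \<otimes> t}" "k = p \<otimes> v"
      using cover_PV[OF k] by (elim bexE) (rule that)
    have "p \<in> carrier G" "v \<in> carrier G" "q \<in> carrier G" using pv q r by auto
    then have "c = p \<otimes> (v \<otimes> q)" by (simp add: q(2) pv(3) m_assoc)
    then show ?thesis using pv(1,2) q(1) by (intro bexI)
  qed
  note rels = rz rs rt ru cz
  note rew = rels rels[THEN m_assoc_subst] m_assoc
  have m1: "c = (c \<otimes> (r \<otimes> r)) \<otimes> r" "c = (c \<otimes> r) \<otimes> (r \<otimes> r)"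
    using r c by (simp_all add: m_assoc r3)
  have z1: "(c \<otimes> (r \<otimes> r)) \<otimes> z = z \<otimes> (c \<otimes> (r \<otimes> r))" "(c \<otimes> r) \<otimes> z = z \<otimes> (c \<otimes> r)"
    using r c by (simp_all add: rew)
  show ?thesis
  proof (rule conj_T_cases[OF c])
    assume "c \<otimes> s = s \<otimes> c"
    then show ?thesis using c cz by (intro ex[of c s \<one>]) simp_all
  next
    assume "c \<otimes> s = s \<otimes> c"
    then show ?thesis using c cz by (intro ex[of c s \<one>]) simp_all
  next
    assume "c \<otimes> u = u \<otimes> c"
    then show ?thesis using c cz by (intro ex[of c u \<one>]) simp_all
  next
    assume "c \<otimes> t = t \<otimes> c"
    then show ?thesis using c cz by (intro ex[of c t \<one>]) simp_all
  next
    assume h: "c \<otimes> s = t \<otimes> c" "c \<otimes> t = u \<otimes> c" "c \<otimes> u = s \<otimes> c"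
    have "(c \<otimes> (r \<otimes> r)) \<otimes> s = s \<otimes> (c \<otimes> (r \<otimes> r))"
      using r c by (simp add: rew h h[THEN m_assoc_subst])
    then show ?thesis using r c by (intro ex[OF _ z1(1) _ _ _ m1(1), of s]) simp_all
  next
    assume h: "c \<otimes> s = u \<otimes> c" "c \<otimes> t = s \<otimes> c" "c \<otimes> u = t \<otimes> c"
    have "(c \<otimes> r) \<otimes> s = s \<otimes> (c \<otimes> r)"
      using r c by (simp add: rew h h[THEN m_assoc_subst])
    then show ?thesis using r c by (intro ex[OF _ z1(2) _ _ _ m1(2), of s]) simp_all
  qed
qed

text \<open>An inverting \<open>x\<close> is not a 3-cycle on \<open>T\<close>, nor the identity, as
  then \<open>r \<otimes> x\<close> would be an inverting 3-cycle. So it is a transposition, and a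
  power of \<open>r\<close> in front turns it into the one fixing \<open>s\<close>.\<close>

lemma obtain_inverting_transposition:
  assumes r: "r \<in> carrier G" and rz: "r \<otimes> z = z \<otimes> r"
    and rs: "r \<otimes> s = t \<otimes> r" and rt: "r \<otimes> t = u \<otimes> r" and ru: "r \<otimes> u = s \<otimes> r"
    and x: "x \<in> carrier G" and xz: "x \<otimes> z = z \<otimes> (z \<otimes> x)"
  obtains y where "y \<in> carrier G" "y \<otimes> z = z \<otimes> (z \<otimes> y)" "y \<otimes> s = s \<otimes> y" "y \<otimes> t = u \<otimes> y"
    "y \<otimes> u = t \<otimes> y" "y \<otimes> y = \<one>"
proof -
  note rels = rz rs rt ru xz
  note rew = rels rels[THEN m_assoc_subst] m_assoc
  \<comment> \<open>In the order \<open>s\<close>, \<open>u\<close>, \<open>t\<close> the second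
    3-cycle becomes the one that \<open>inverting_not_3_cycle\<close> excludes.\<close>
  interpret TS: commuting_involutions G z s u t
    by (rule commuting_involutions.commuting_rotate[OF commuting_swap])
  have "\<exists>y \<in> carrier G. y \<otimes> z = z \<otimes> (z \<otimes> y) \<and> y \<otimes> s = s \<otimes> y \<and> y \<otimes> t = u \<otimes> y \<and> y \<otimes> u = t \<otimes> y"
  proof (rule conj_T_cases[OF x])
    assume h: "x \<otimes> s = s \<otimes> x" "x \<otimes> t = t \<otimes> x" "x \<otimes> u = u \<otimes> x"
    have "False" by (rule inverting_not_3_cycle[of "r \<otimes> x"])
      (use r x in \<open>simp_all add: rew h\<close>)
    then show ?thesis ..
  next
    assume h: "x \<otimes> s = s \<otimes> x" "x \<otimes> t = u \<otimes> x" "x \<otimes> u = t \<otimes> x"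
    then show ?thesis using x xz by blast
  next
    assume h: "x \<otimes> s = t \<otimes> x" "x \<otimes> t = s \<otimes> x" "x \<otimes> u = u \<otimes> x"
    show ?thesis using r x by (intro bexI[of _ "r \<otimes> (r \<otimes> x)"]) (simp_all add: rew h)
  next
    assume h: "x \<otimes> s = u \<otimes> x" "x \<otimes> t = t \<otimes> x" "x \<otimes> u = s \<otimes> x"
    show ?thesis using r x by (intro bexI[of _ "r \<otimes> x"]) (simp_all add: rew h)
  next
    assume h: "x \<otimes> s = t \<otimes> x" "x \<otimes> t = u \<otimes> x" "x \<otimes> u = s \<otimes> x"
    show ?thesis using inverting_not_3_cycle[OF x xz h] ..
  next
    assume h: "x \<otimes> s = u \<otimes> x" "x \<otimes> t = s \<otimes> x" "x \<otimes> u = t \<otimes> x"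
    show ?thesis using TS.inverting_not_3_cycle[OF x xz h(1,3,2)] ..
  qed
  then obtain y where y: "y \<in> carrier G" "y \<otimes> z = z \<otimes> (z \<otimes> y)" "y \<otimes> s = s \<otimes> y" "y \<otimes> t = u \<otimes> y"
    "y \<otimes> u = t \<otimes> y" by blast
  show ?thesis by (rule obtain_inverting_involution[OF y]) (rule that)
qed

text \<open>When some \<open>x\<close> inverts \<open>z\<close>, the elements
  \<open>x \<otimes> r\<close> and \<open>r \<otimes> (r \<otimes> x)\<close> act alike on
  \<open>z\<close> and \<open>T\<close>, but may differ by a factor from \<open>P\<close> and
  \<open>V\<close>. The target needs equality, so \<open>r\<close> is replaced by
  \<open>q\<close>.\<close>

lemma iso_if_3_cycle:
  assumes r: "r \<in> carrier G" and rz: "r \<otimes> z = z \<otimes> r"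
    and rs: "r \<otimes> s = t \<otimes> r" and rt: "r \<otimes> t = u \<otimes> r" and ru: "r \<otimes> u = s \<otimes> r"
  shows "G \<cong> SG_36_11 \<or> G \<cong> SG_72_43"
proof (cases "\<forall>y \<in> carrier G. y \<otimes> z = z \<otimes> y")
  case True
  have "G \<cong> SG_36_11"
  proof (rule iso_SG_36_11[of z s t r])
    show "\<exists>p \<in> {\<one>, z, z \<otimes> z}. \<exists>v \<in> {\<one>, s, t, s \<otimes> t}. \<exists>q \<in> {\<one>, r, r \<otimes> r}. y = p \<otimes> (v \<otimes> q)"
      if y: "y \<in> carrier G" for y
      by (rule cover_with_3_cycle[OF assms y]) (use True y in blast)
    show "r \<otimes> (r \<otimes> r) = \<one>" by (rule three_cycle_order_3) (fact r rz rs)+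
    show "r \<otimes> t = s \<otimes> (t \<otimes> r)" using r by (simp add: rt u_eq m_assoc)
  qed (simp_all add: z3 s2 t2 sz tz ts r rz rs)
  then show ?thesis by simp
next
  case False
  then obtain x0 where "x0 \<in> carrier G" "x0 \<otimes> z \<noteq> z \<otimes> x0" by blast
  then have x0: "x0 \<in> carrier G" "x0 \<otimes> z = z \<otimes> (z \<otimes> x0)" using conj_z[of x0] by blast+
  obtain x where x: "x \<in> carrier G" and xz: "x \<otimes> z = z \<otimes> (z \<otimes> x)" and xs: "x \<otimes> s = s \<otimes> x"
    and xt: "x \<otimes> t = u \<otimes> x" and xu: "x \<otimes> u = t \<otimes> x" and xx: "x \<otimes> x = \<one>"
    using obtain_inverting_transposition[OF assms x0] .
  have r3: "r \<otimes> (r \<otimes> r) = \<one>" by (rule three_cycle_order_3) (fact r rz rs)+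
  note rels = rz rs rt ru xz xs xt xu
  note rew = rels rels[THEN m_assoc_subst] m_assoc cube_cancel[OF z3]
  \<comment> \<open>The product of the involutions \<open>x\<close> and \<open>r x r\<^sup>-\<^sup>1\<close> is automatically inverted by \<open>x\<close>.\<close>
  define q where "q = x \<otimes> (r \<otimes> (x \<otimes> (r \<otimes> r)))"
  have q: "q \<in> carrier G" using r x by (simp add: q_def)
  \<comment> \<open>On \<open>T\<close>, \<open>x r x\<close> acts as the inverse of
    \<open>r\<close>, so \<open>q\<close> acts as \<open>r\<close> itself; the two factors
    \<open>x\<close> make it centralise \<open>z\<close>.\<close>
  have qz: "q \<otimes> z = z \<otimes> q" and qs: "q \<otimes> s = t \<otimes> q" and qt: "q \<otimes> t = u \<otimes> q" and qu: "q \<otimes> u = s \<otimes> q"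
    unfolding q_def using r x by (simp_all add: rew)
  have q3: "q \<otimes> (q \<otimes> q) = \<one>" by (rule three_cycle_order_3) (fact q qz qs)+
  have xq: "x \<otimes> q = q \<otimes> (q \<otimes> x)"
  proof -
    have "q \<otimes> (x \<otimes> q) = x"
      using r x by (simp add: q_def m_assoc m_assoc_subst[OF xx] r3 cube_cancel[OF r3])
    then have "q \<otimes> (q \<otimes> (q \<otimes> (x \<otimes> q))) = q \<otimes> (q \<otimes> x)" by simp
    then show ?thesis using cube_cancel[OF q3 q, of "x \<otimes> q"] q x by simp
  qed
  have "G \<cong> SG_72_43"
  proof (rule iso_SG_72_43[of z s t q x])
    show "\<exists>p \<in> {\<one>, z, z \<otimes> z}. \<exists>v \<in> {\<one>, s, t, s \<otimes> t}. \<exists>l \<in> {\<one>, q, q \<otimes> q}. \<exists>m \<in> {\<one>, x}. y = (p \<otimes> (v \<otimes> l)) \<otimes> m"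
      if "y \<in> carrier G" for y
    proof -
      obtain k where k: "k \<in> carrier G" "k \<otimes> z = z \<otimes> k" "\<exists>m \<in> {\<one>, x}. y = k \<otimes> m"
        using cover_with_inverting[OF x xz \<open>y \<in> carrier G\<close>] by blast
      then obtain m where m: "m \<in> {\<one>, x}" "y = k \<otimes> m" by (elim bexE)
      obtain p v l where pv: "p \<in> {\<one>, z, z \<otimes> z}" "v \<in> {\<one>, s, t, s \<otimes> t}" "l \<in> {\<one>, q, q \<otimes> q}" "k = p \<otimes> (v \<otimes> l)"
        using cover_with_3_cycle[OF q qz qs qt qu k(1,2)] by (elim bexE) (rule that)
      show ?thesis using pv(1-3) m(1) by (intro bexI) (simp_all only: m(2) pv(4))
    qed
    show "q \<otimes> t = s \<otimes> (t \<otimes> q)" using q by (simp add: qt u_eq m_assoc)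
    show "x \<otimes> t = s \<otimes> (t \<otimes> x)" using x by (simp add: xt u_eq m_assoc)
    show "x \<otimes> q = q \<otimes> (q \<otimes> x)" by (rule xq)
    show "q \<otimes> (q \<otimes> q) = \<one>" by (rule q3)
  qed (simp_all add: z3 s2 t2 sz tz ts q qz qs x xz xs xx)
  then show ?thesis by simp
qed

text \<open>If \<open>C(z)\<close> has no 3-cycle in the given direction, it has none in the other,
  whose square would be one. Each \<open>c\<close> in \<open>C(z)\<close> then fixes some member of
  \<open>T\<close>, hence lies in the product of \<open>P\<close> and the abelian group
  \<open>V\<close> and centralises all of \<open>T\<close>.\<close>

lemma classification_if_commuting:
  "G \<cong> SG_12_5 \<or> G \<cong> SG_24_7 \<or> G \<cong> SG_24_8 \<or> G \<cong> SG_24_14 \<or> G \<cong> SG_36_11 \<or> G \<cong> SG_72_43"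
proof (cases "\<exists>r \<in> carrier G. r \<otimes> z = z \<otimes> r \<and> r \<otimes> s = t \<otimes> r \<and> r \<otimes> t = u \<otimes> r \<and> r \<otimes> u = s \<otimes> r")
  case True
  then show ?thesis using iso_if_3_cycle by blast
next
  case no_cycle: False
  have "c \<otimes> x = x \<otimes> c" if c: "c \<in> carrier G" "c \<otimes> z = z \<otimes> c" and x: "x \<in> T" for c x
  proof -
    have "\<exists>y \<in> T. c \<otimes> y = y \<otimes> c"
    proof (rule conj_T_cases[OF c(1)])
      assume "c \<otimes> s = t \<otimes> c" "c \<otimes> t = u \<otimes> c" "c \<otimes> u = s \<otimes> c"
      then show ?thesis using no_cycle c by blast
    next
      assume h: "c \<otimes> s = u \<otimes> c" "c \<otimes> t = s \<otimes> c" "c \<otimes> u = t \<otimes> c"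
      have "(c \<otimes> c) \<otimes> z = z \<otimes> (c \<otimes> c)" "(c \<otimes> c) \<otimes> s = t \<otimes> (c \<otimes> c)"
        "(c \<otimes> c) \<otimes> t = u \<otimes> (c \<otimes> c)" "(c \<otimes> c) \<otimes> u = s \<otimes> (c \<otimes> c)"
        using c(1) by (simp_all add: m_assoc c(2) h m_assoc_subst[OF c(2)] h[THEN m_assoc_subst])
      then show ?thesis using no_cycle c by blast
    qed auto
    then obtain y where y: "y \<in> T" "c \<otimes> y = y \<otimes> c" by (elim bexE)
    obtain p v where pv: "p \<in> {\<one>, z, z \<otimes> z}" "v \<in> {\<one>, s, t, s \<otimes> t}" "c = p \<otimes> v"
      using cover_PV[OF c y] by (elim bexE) (rule that)
    have vc: "v \<otimes> x = x \<otimes> v" and [simp]: "v \<in> carrier G" using pv(2) x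
      by (auto simp: st su us ts tu ut)
    have pc: "p \<otimes> x = x \<otimes> p" and [simp]: "p \<in> carrier G" using pv(1) T_comm[OF x] T_closed'[OF x]
      by (auto simp: m_assoc m_assoc_subst[OF T_comm[OF x]])
    show ?thesis using T_closed'[OF x] by (simp add: pv(3) m_assoc vc m_assoc_subst[OF pc])
  qed
  then show ?thesis using iso_if_no_3_cycle by blast
qed

end

context three_involutions
begin

lemma classification:
  "G \<cong> SG_12_5 \<or> G \<cong> SG_18_3 \<or> G \<cong> SG_24_7 \<or> G \<cong> SG_24_8 \<or>
   G \<cong> SG_24_14 \<or> G \<cong> SG_36_11 \<or> G \<cong> SG_72_43"
proof (cases "s \<otimes> t = t \<otimes> s")
  case True
  then interpret commuting_involutions G z s t u by unfold_locales simp
  show ?thesis using classification_if_commuting by blast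
qed (use iso_SG_18_3_if_noncommuting in simp)

end

section \<open>Cyclic subgroups of order 6\<close>

context group
begin

lemma ord_6_iff:
  assumes "a \<in> carrier G"
  shows "ord a = 6 \<longleftrightarrow> a [^] (6::nat) = \<one> \<and> a [^] (2::nat) \<noteq> \<one> \<and> a [^] (3::nat) \<noteq> \<one>"
proof -
  have "n = 6" if "n dvd 6" "\<not> n dvd 2" "\<not> n dvd 3" for n :: nat
  proof -
    have "n \<le> 6" using that(1) by (simp add: dvd_imp_le)
    then have "n \<in> {0, 1, 2, 3, 4, 5, 6}" by auto
    then show ?thesis using that by auto
  qed
  then show ?thesis using assms by (auto simp: pow_eq_id)
qed

lemma cyclic_subgroups_of_order_iff:
  assumes "n > 0"
  shows "H \<in> cyclic_subgroups_of_order G n \<longleftrightarrow> (\<exists>a \<in> carrier G. ord a = n \<and> H = generate G {a})"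
proof
  assume H: "H \<in> cyclic_subgroups_of_order G n"
  then have sub: "subgroup H G" and cyc: "cyclic_group (G\<lparr>carrier := H\<rparr>)" and card: "card H = n"
    by (auto simp: cyclic_subgroups_of_order_def)
  interpret H: group "G\<lparr>carrier := H\<rparr>" by (rule subgroup_imp_group[OF sub])
  obtain a where a: "a \<in> H" and "H = range (\<lambda>k::int. a [^]\<^bsub>G\<lparr>carrier := H\<rparr>\<^esub> k)"
    using cyc unfolding H.cyclic_group by auto
  moreover have ac: "a \<in> carrier G" using a subgroup.subset[OF sub] by blast
  ultimately have "H = generate G {a}"
    using int_pow_consistent[OF sub a] by (auto simp: generate_pow)
  then show "\<exists>a \<in> carrier G. ord a = n \<and> H = generate G {a}"
    using ac card by (auto simp: generate_pow_card)
next
  assume "\<exists>a \<in> carrier G. ord a = n \<and> H = generate G {a}"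
  then obtain a where a: "a \<in> carrier G" "ord a = n" "H = generate G {a}" by blast
  have sub: "subgroup H G" unfolding a(3) using a(1) by (intro generate_is_subgroup) simp
  have aH: "a \<in> H" unfolding a(3) by (rule generate.incl) simp
  interpret H: group "G\<lparr>carrier := H\<rparr>" by (rule subgroup_imp_group[OF sub])
  have "H = range (\<lambda>k::int. a [^] k)"
    using a by (auto simp: generate_pow)
  then have "cyclic_group (G\<lparr>carrier := H\<rparr>)"
    unfolding H.cyclic_group using aH int_pow_consistent[OF sub aH] by auto
  then show "H \<in> cyclic_subgroups_of_order G n"
    using sub a by (auto simp: cyclic_subgroups_of_order_def generate_pow_card)
qed

lemma generate_order_6:
  assumes z: "z \<in> carrier G" "z \<otimes> (z \<otimes> z) = \<one>" "z \<noteq> \<one>"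
    and s: "s \<in> carrier G" "s \<otimes> s = \<one>" "s \<noteq> \<one>" and sz: "s \<otimes> z = z \<otimes> s"
  shows "ord (z \<otimes> s) = 6"
    and "generate G {z \<otimes> s} = {\<one>, z, z \<otimes> z, s, z \<otimes> s, z \<otimes> (z \<otimes> s)}"
proof -
  note pz = pow_numerals_order_3[OF z(1,2)] and ps = pow_numerals_order_2[OF s(1,2)]
  have p: "(z \<otimes> s) [^] n = z [^] n \<otimes> s [^] n" for n :: nat
    by (rule pow_mult_distrib) (simp_all add: z s sz)
  have zz: "z \<otimes> z \<noteq> \<one>" using z by auto
  show o6: "ord (z \<otimes> s) = 6"
    using z s zz by (simp add: ord_6_iff p pz ps)
  have "generate G {z \<otimes> s} = {(z \<otimes> s) [^] k | k. k \<in> {0..5::nat}}"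
    using generate_pow_nat[of "z \<otimes> s"] ord_elems_inf_carrier[of "z \<otimes> s"] z(1) s(1) o6 by simp
  also have "\<dots> = (\<lambda>k. (z \<otimes> s) [^] k) ` {0..5::nat}"
    by blast
  also have "{0..5::nat} = {0, 1, 2, 3, 4, 5}"
    by auto
  also have "(\<lambda>k. (z \<otimes> s) [^] k) ` {0, 1, 2, 3, 4, 5::nat} = {\<one>, z \<otimes> s, z \<otimes> z, s, z, z \<otimes> (z \<otimes> s)}"
  proof -
    have "z [^] (5::nat) = z \<otimes> z" "s [^] (5::nat) = s"
      using z s by (simp_all add: numeral_eq_Suc m_assoc cube_cancel)
    then show ?thesis using z(1) s(1) by (simp add: p pz ps m_assoc)
  qed
  finally show "generate G {z \<otimes> s} = {\<one>, z, z \<otimes> z, s, z \<otimes> s, z \<otimes> (z \<otimes> s)}"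
    by (simp add: insert_commute)
qed

text \<open>The nontrivial elements other than \<open>s\<close> square to \<open>z\<close> or
  \<open>z \<otimes> z\<close>. Hence distinct involutions yield distinct cyclic subgroups.\<close>

lemma generate_order_6_involution:
  assumes z: "z \<in> carrier G" "z \<otimes> (z \<otimes> z) = \<one>" "z \<noteq> \<one>"
    and s: "s \<in> carrier G" "s \<otimes> s = \<one>" "s \<noteq> \<one>" "s \<otimes> z = z \<otimes> s"
    and t: "t \<in> generate G {z \<otimes> s}" "t \<otimes> t = \<one>" "t \<noteq> \<one>"
  shows "t = s"
proof -
  have "z \<otimes> z \<noteq> \<one>" using z by auto
  moreover have "(z \<otimes> s) \<otimes> (z \<otimes> s) = z \<otimes> z"
    "(z \<otimes> (z \<otimes> s)) \<otimes> (z \<otimes> (z \<otimes> s)) = z" "(z \<otimes> z) \<otimes> (z \<otimes> z) = z"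
    using z(1) s(1) by (simp_all add: m_assoc s(2,4) m_assoc_subst[OF s(4)] m_assoc_subst[OF s(2)]
      cube_cancel[OF z(2)] z(2))
  moreover have "t \<in> {\<one>, z, z \<otimes> z, s, z \<otimes> s, z \<otimes> (z \<otimes> s)}"
    using t(1) generate_order_6(2)[OF z s] by simp
  ultimately show ?thesis using t(2,3) z(3) by (elim insertE) simp_all
qed

lemma inter_cyclic_order_6:
  assumes z: "z \<in> carrier G" "z \<otimes> (z \<otimes> z) = \<one>" "z \<noteq> \<one>"
    and s: "s \<in> carrier G" "s \<otimes> s = \<one>" "s \<noteq> \<one>" "s \<otimes> z = z \<otimes> s"
    and t: "t \<in> carrier G" "t \<otimes> t = \<one>" "t \<noteq> \<one>" "t \<otimes> z = z \<otimes> t"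
    and st: "s \<noteq> t"
  shows "\<exists>H \<in> cyclic_subgroups_of_order G 6. \<exists>K \<in> cyclic_subgroups_of_order G 6. card (H \<inter> K) = 3"
proof -
  let ?H = "generate G {z \<otimes> s}" and ?K = "generate G {z \<otimes> t}"
  have HK: "?H \<in> cyclic_subgroups_of_order G 6" "?K \<in> cyclic_subgroups_of_order G 6"
    using z(1) s(1) t(1) generate_order_6(1)[OF z s] generate_order_6(1)[OF z t]
    by (auto simp: cyclic_subgroups_of_order_iff)
  have subH: "subgroup ?H G" and subK: "subgroup ?K G"
    using z(1) s(1) t(1) by (simp_all add: generate_is_subgroup)
  have zH: "z \<in> ?H" "z \<otimes> z \<in> ?H" "\<one> \<in> ?H" "s \<in> ?H" and zK: "z \<in> ?K" "z \<otimes> z \<in> ?K" "\<one> \<in> ?K"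
    using generate_order_6(2)[OF z s] generate_order_6(2)[OF z t] by simp_all
  have sK: "s \<notin> ?K"
    using generate_order_6_involution[OF z t _ s(2,3)] st by blast
  have "z \<otimes> s \<notin> ?K" "z \<otimes> (z \<otimes> s) \<notin> ?K"
  proof -
    \<comment> \<open>An element of the intersection outside \<open>P\<close> could be stripped of
      its power of \<open>z\<close>, leaving \<open>s\<close> in \<open>?K\<close>, whose only
      involution is \<open>t\<close>.\<close>
    have *: "s \<in> ?K" if "p \<otimes> s \<in> ?K" "p \<in> ?K" "p \<in> carrier G" for p
    proof -
      have "inv p \<otimes> (p \<otimes> s) \<in> ?K"
        using that subgroup.m_closed[OF subK] subgroup.m_inv_closed[OF subK] by blast
      then show ?thesis using that(3) s(1) by (simp flip: m_assoc)
    qed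
    show "z \<otimes> s \<notin> ?K" using *[of z] zK sK z(1) by blast
    show "z \<otimes> (z \<otimes> s) \<notin> ?K" using *[of "z \<otimes> z"] zK sK z(1) s(1) by (auto simp: m_assoc)
  qed
  then have "?H \<inter> ?K = {\<one>, z, z \<otimes> z}"
    using generate_order_6(2)[OF z s] zH zK sK by auto
  moreover have "card {\<one>, z, z \<otimes> z} = 3"
  proof -
    have "z \<otimes> z \<noteq> \<one>" using z by auto
    then show ?thesis using z by (simp add: card_insert_if)
  qed
  ultimately show ?thesis using HK by metis
qed

text \<open>The conditions in \<open>S\<close> use products only: \<open>z^4 = z\<close> and
  \<open>z^2 \<noteq> z\<close> in place of \<open>z^3 = \<one>\<close> and
  \<open>z \<noteq> \<one>\<close>. They pull back along any multiplicative bijection, and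
  cancellation in \<open>G\<close> recovers the identity there.\<close>

lemma inter_cyclic_order_6_if_iso:
  assumes "G \<cong> S" and zst: "z \<in> carrier S" "s \<in> carrier S" "t \<in> carrier S"
    and z: "(z \<otimes>\<^bsub>S\<^esub> z) \<otimes>\<^bsub>S\<^esub> (z \<otimes>\<^bsub>S\<^esub> z) = z" "z \<otimes>\<^bsub>S\<^esub> z \<noteq> z"
    and s: "(s \<otimes>\<^bsub>S\<^esub> s) \<otimes>\<^bsub>S\<^esub> s = s" "s \<otimes>\<^bsub>S\<^esub> s \<noteq> s" "s \<otimes>\<^bsub>S\<^esub> z = z \<otimes>\<^bsub>S\<^esub> s"
    and t: "(t \<otimes>\<^bsub>S\<^esub> t) \<otimes>\<^bsub>S\<^esub> t = t" "t \<otimes>\<^bsub>S\<^esub> t \<noteq> t" "t \<otimes>\<^bsub>S\<^esub> z = z \<otimes>\<^bsub>S\<^esub> t"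
    and st: "s \<noteq> t"
  shows "\<exists>H \<in> cyclic_subgroups_of_order G 6. \<exists>K \<in> cyclic_subgroups_of_order G 6. card (H \<inter> K) = 3"
proof -
  obtain f where f: "f \<in> hom G S" and bij: "bij_betw f (carrier G) (carrier S)"
    using assms(1) by (auto simp: is_iso_def iso_def)
  have "\<exists>a \<in> carrier G. f a = b" if "b \<in> carrier S" for b
    using bij that unfolding bij_betw_def by (metis imageE)
  then obtain a b c where a: "a \<in> carrier G" "f a = z" and b: "b \<in> carrier G" "f b = s"
    and c: "c \<in> carrier G" "f c = t"
    using zst by metis
  note hm = hom_mult[OF f]
  have inj: "x = y" if "f x = f y" "x \<in> carrier G" "y \<in> carrier G" for x y
    using bij that by (auto simp: bij_betw_def inj_on_def)
  have "(a \<otimes> a) \<otimes> (a \<otimes> a) = a" by (rule inj) (simp_all add: hm a z)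
  then have a3: "a \<otimes> (a \<otimes> a) = \<one>" using a(1) by (simp add: m_assoc)
  have a1: "a \<noteq> \<one>"
  proof
    assume "a = \<one>"
    then have "a \<otimes> a = a" by simp
    then show False using hm[OF a(1) a(1)] a(2) z(2) by simp
  qed
  have inv: "d \<otimes> d = \<one>" "d \<noteq> \<one>" "d \<otimes> a = a \<otimes> d"
    if d: "d \<in> carrier G" "f d = w" and w: "(w \<otimes>\<^bsub>S\<^esub> w) \<otimes>\<^bsub>S\<^esub> w = w" "w \<otimes>\<^bsub>S\<^esub> w \<noteq> w" "w \<otimes>\<^bsub>S\<^esub> z = z \<otimes>\<^bsub>S\<^esub> w" for d w
  proof -
    have "(d \<otimes> d) \<otimes> d = d" by (rule inj) (simp_all add: hm d w)
    then show "d \<otimes> d = \<one>" using d(1) by simp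
    show "d \<noteq> \<one>"
    proof
      assume "d = \<one>"
      then have "d \<otimes> d = d" by simp
      then show False using hm[OF d(1) d(1)] d(2) w(2) by simp
    qed
    show "d \<otimes> a = a \<otimes> d" by (rule inj) (simp_all add: hm d a w)
  qed
  show ?thesis
    by (rule inter_cyclic_order_6[OF a(1) a3 a1 b(1) inv[OF b s] c(1) inv[OF c t]])
      (use st b(2) c(2) in auto)
qed

text \<open>Any nontrivial \<open>z\<close> in the intersection has order 3; \<open>s\<close> and
  \<open>t\<close> are cubes of generators of \<open>H\<close> and \<open>K\<close>. They differ,
  since a common involution would lie in a group of order 3.\<close>

lemma obtain_common_order_3:
  assumes H: "H \<in> cyclic_subgroups_of_order G 6" and K: "K \<in> cyclic_subgroups_of_order G 6"
    and HK: "card (H \<inter> K) = 3"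
  obtains z s t where "z \<in> carrier G" "z \<otimes> (z \<otimes> z) = \<one>" "z \<noteq> \<one>"
    "s \<in> carrier G" "s \<otimes> s = \<one>" "s \<noteq> \<one>" "s \<otimes> z = z \<otimes> s"
    "t \<in> carrier G" "t \<otimes> t = \<one>" "t \<noteq> \<one>" "t \<otimes> z = z \<otimes> t" "s \<noteq> t"
proof -
  have sub: "subgroup (H \<inter> K) G"
    using H K by (intro subgroups_Inter_pair) (auto simp: cyclic_subgroups_of_order_def)
  interpret I: group "G\<lparr>carrier := H \<inter> K\<rparr>" by (rule subgroup_imp_group[OF sub])
  have cube: "a \<otimes> (a \<otimes> a) = \<one>" and ac: "a \<in> carrier G" if "a \<in> H \<inter> K" for a
  proof -
    show ac: "a \<in> carrier G" using that subgroup.subset[OF sub] by blast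
    have "a [^] (3::nat) = \<one>"
      using I.pow_order_eq_1[of a] that HK by (simp add: order_def flip: nat_pow_consistent)
    then show "a \<otimes> (a \<otimes> a) = \<one>" using ac by (simp add: numeral_eq_Suc m_assoc)
  qed
  have "\<not> H \<inter> K \<subseteq> {\<one>}"
  proof
    assume "H \<inter> K \<subseteq> {\<one>}"
    then have "card (H \<inter> K) \<le> card {\<one>}" by (intro card_mono) simp_all
    then show False using HK by simp
  qed
  then obtain z where z: "z \<in> H \<inter> K" "z \<noteq> \<one>" by blast
  have ex: "\<exists>d \<in> carrier G. d \<in> L \<and> d \<otimes> d = \<one> \<and> d \<noteq> \<one> \<and> d \<otimes> z = z \<otimes> d"
    if L: "L \<in> cyclic_subgroups_of_order G 6" "z \<in> L" for L
  proof -
    obtain a where a: "a \<in> carrier G" "ord a = 6" "L = generate G {a}"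
      using L(1) by (auto simp: cyclic_subgroups_of_order_iff)
    have a6: "a [^] (6::nat) = \<one>" "a [^] (3::nat) \<noteq> \<one>" using a ord_6_iff by auto
    obtain k :: int where k: "z = a [^] k" using L(2) a by (auto simp: generate_pow)
    have "a [^] (3::nat) \<otimes> a [^] (3::nat) = \<one>" using a(1) a6 by (simp add: nat_pow_mult)
    moreover have "a [^] (3::int) = a [^] (3::nat)" using int_pow_int[of G a 3] by simp
    moreover have "a [^] (3::int) \<otimes> z = z \<otimes> a [^] (3::int)"
      unfolding k using a(1) by (simp add: add.commute flip: int_pow_mult)
    moreover have "a [^] (3::int) \<in> L" unfolding a(3) generate_pow[OF a(1)] by blast
    ultimately show ?thesis using a(1) a6(2) by (intro bexI[of _ "a [^] (3::nat)"]) simp_all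
  qed
  obtain s where s: "s \<in> carrier G" "s \<in> H" "s \<otimes> s = \<one>" "s \<noteq> \<one>" "s \<otimes> z = z \<otimes> s" using ex[OF H] z by blast
  obtain t where t: "t \<in> carrier G" "t \<in> K" "t \<otimes> t = \<one>" "t \<noteq> \<one>" "t \<otimes> z = z \<otimes> t" using ex[OF K] z by blast
  have "s \<noteq> t"
  proof
    assume "s = t"
    then have "s \<otimes> (s \<otimes> s) = \<one>" using s t cube by blast
    then show False using s by simp
  qed
  then show ?thesis using that[OF ac[OF z(1)] cube[OF z(1)] z(2)] s t by blast
qed

lemma three_involutions_if_inter:
  assumes orders: "elem_orders G \<subseteq> {1, 2, 3, 4, 6}"
    and three: "card (cyclic_subgroups_of_order G 6) = 3"
    and H: "H \<in> cyclic_subgroups_of_order G 6" and K: "K \<in> cyclic_subgroups_of_order G 6"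
    and HK: "card (H \<inter> K) = 3"
  shows "\<exists>z s t u. three_involutions G z s t u"
proof -
  obtain z s t where z: "z \<in> carrier G" "z \<otimes> (z \<otimes> z) = \<one>" "z \<noteq> \<one>"
    and s: "s \<in> carrier G" "s \<otimes> s = \<one>" "s \<noteq> \<one>" "s \<otimes> z = z \<otimes> s"
    and t: "t \<in> carrier G" "t \<otimes> t = \<one>" "t \<noteq> \<one>" "t \<otimes> z = z \<otimes> t" and st: "s \<noteq> t"
    using obtain_common_order_3[OF H K HK] .
  obtain u where u: "u \<in> carrier G" "u \<otimes> u = \<one>" "u \<noteq> \<one>" "u \<otimes> z = z \<otimes> u" and su: "s \<noteq> u" and tu: "t \<noteq> u"
  proof (cases "t \<otimes> s = s \<otimes> t")
    case ts: True
    show ?thesis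
    proof (rule that[of "s \<otimes> t"])
      show "s \<otimes> t \<otimes> (s \<otimes> t) = \<one>"
        using s(1) t(1) by (simp add: m_assoc m_assoc_subst[OF ts] m_assoc_subst[OF s(2)] m_assoc_subst[OF t(2)] s(2) t(2))
      show "s \<otimes> t \<noteq> \<one>" using s(1,2) t(1) st left_cancel[of s s t] by auto
      show "s \<otimes> t \<otimes> z = z \<otimes> (s \<otimes> t)"
        using s(1) t(1) z(1) by (simp add: m_assoc t(4) m_assoc_subst[OF s(4)])
      show "s \<noteq> s \<otimes> t" "t \<noteq> s \<otimes> t" using s t by simp_all
    qed (use s t in simp)
  next
    case ts: False
    show ?thesis
    proof (rule that[of "s \<otimes> (t \<otimes> s)"])
      show "s \<otimes> (t \<otimes> s) \<otimes> (s \<otimes> (t \<otimes> s)) = \<one>"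
        using s(1) t(1) by (simp add: m_assoc m_assoc_subst[OF s(2)] m_assoc_subst[OF t(2)] s(2) t(2))
      have eq: "s \<otimes> (s \<otimes> (t \<otimes> s)) = t \<otimes> s" using s(1) t(1) by (simp add: m_assoc_subst[OF s(2)])
      show "s \<otimes> (t \<otimes> s) \<noteq> \<one>" "s \<noteq> s \<otimes> (t \<otimes> s)"
        using eq s t st by (metis r_one r_cancel_one right_cancel, metis m_closed right_cancel)
      show "t \<noteq> s \<otimes> (t \<otimes> s)" using eq ts by auto
      show "s \<otimes> (t \<otimes> s) \<otimes> z = z \<otimes> (s \<otimes> (t \<otimes> s))"
        using s(1) t(1) z(1) by (simp add: m_assoc s(4) m_assoc_subst[OF t(4)] m_assoc_subst[OF s(4)])
    qed (use s t in simp)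
  qed
  let ?C = "cyclic_subgroups_of_order G 6"
  let ?g = "\<lambda>x. generate G {z \<otimes> x}"
  have T: "x \<in> carrier G" "x \<otimes> x = \<one>" "x \<noteq> \<one>" "x \<otimes> z = z \<otimes> x" if "x \<in> {s, t, u}" for x
    using that s t u by auto
  \<comment> \<open>The three involutions give three different cyclic subgroups of order 6, so by
    the count these are all of them.\<close>
  have inj: "inj_on ?g {s, t, u}"
  proof (rule inj_onI)
    fix x y assume xy: "x \<in> {s, t, u}" "y \<in> {s, t, u}" "?g x = ?g y"
    then have "x \<in> ?g y" using generate_order_6(2)[OF z T[OF xy(1)]] by auto
    then show "x = y" using generate_order_6_involution[OF z T[OF xy(2)]] T[OF xy(1)] by blast
  qed
  have "?g x \<in> ?C" if "x \<in> {s, t, u}" for x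
    using z(1) T[OF that] generate_order_6(1)[OF z T[OF that]] by (auto simp: cyclic_subgroups_of_order_iff)
  then have "?g ` {s, t, u} \<subseteq> ?C" by blast
  moreover have "card (?g ` {s, t, u}) = card ?C"
    using card_image[OF inj] three st su tu by simp
  moreover have "finite ?C" using three by (metis card.infinite zero_neq_numeral)
  ultimately have C: "?g ` {s, t, u} = ?C" by (intro card_subset_eq)
  have "three_involutions G z s t u"
  proof
    fix y assume y: "y \<in> carrier G"
    then have "ord y \<in> {1, 2, 3, 4, 6}" using orders by (auto simp: elem_orders_def)
    then have "ord y dvd 4 \<or> ord y dvd 6" by auto
    then show "y [^] (4::nat) = \<one> \<or> y [^] (6::nat) = \<one>" using y by (simp add: pow_eq_id)
    assume "y [^] (6::nat) = \<one>" "y [^] (2::nat) \<noteq> \<one>" "y [^] (3::nat) \<noteq> \<one>"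
    then have y6: "ord y = 6" and y2: "y \<otimes> y \<noteq> \<one>" and y3: "y \<otimes> (y \<otimes> y) \<noteq> \<one>"
      using y by (simp_all add: ord_6_iff) (simp_all add: numeral_eq_Suc m_assoc)
    have "generate G {y} \<in> ?C" using y y6 by (auto simp: cyclic_subgroups_of_order_iff)
    then obtain x where x: "x \<in> {s, t, u}" "generate G {y} = ?g x" unfolding C[symmetric] by blast
    have "y \<in> ?g x" unfolding x(2)[symmetric] by (rule generate.incl) simp
    \<comment> \<open>Of these six elements, all but \<open>z \<otimes> x\<close> and
      \<open>z \<otimes> (z \<otimes> x)\<close> have a trivial square or cube.\<close>
    then have "y \<in> {\<one>, z, z \<otimes> z, x, z \<otimes> x, z \<otimes> (z \<otimes> x)}"
      using generate_order_6(2)[OF z T[OF x(1)]] by simp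
    moreover have "(z \<otimes> z) \<otimes> ((z \<otimes> z) \<otimes> (z \<otimes> z)) = \<one>"
      using z by (simp add: m_assoc cube_cancel[OF z(2)])
    ultimately have "y = z \<otimes> x \<or> y = z \<otimes> (z \<otimes> x)"
      using y2 y3 z(2) T[OF x(1)] by (elim insertE) simp_all
    then show "\<exists>x \<in> {s, t, u}. y = z \<otimes> x \<or> y = z \<otimes> (z \<otimes> x)" using x(1) by blast
  qed (use z s t u st su tu in auto)
  then show ?thesis by blast
qed

end

text \<open>In each group the first witness has order 3 and the other two are involutions
  centralising it. They commute with each other except in \<open>SG_18_3\<close>, where they are the
  transpositions \<open>tau\<close> and \<open>sigma\<close>.\<close>

lemma inter_cyclic_order_6_if_classified:
  assumes "group G"
    and "G \<cong> SG_12_5 \<or> G \<cong> SG_18_3 \<or> G \<cong> SG_24_7 \<or> G \<cong> SG_24_8 \<or>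
      G \<cong> SG_24_14 \<or> G \<cong> SG_36_11 \<or> G \<cong> SG_72_43"
  shows "\<exists>H \<in> cyclic_subgroups_of_order G 6. \<exists>K \<in> cyclic_subgroups_of_order G 6. card (H \<inter> K) = 3"
proof -
  interpret group G by fact
  note perm = perm_relations perm_distinct perm_distinct[symmetric] perm_in_carrier
    sym_group_mult alt_group_mult permutes_id
  note id_closed =
    monoid.one_closed[OF group.is_monoid[OF sym_group_is_group[of 3]], unfolded sym_group_one]
    monoid.one_closed[OF group.is_monoid[OF alt_group_is_group[of 4]], unfolded alt_group_one]
  define sigma :: "nat \<Rightarrow> nat" where "sigma = transpose 1 3"
  have sigma: "sigma \<circ> sigma = id" "sigma \<noteq> id" "tau \<noteq> sigma" "sigma \<in> carrier (sym_group 3)"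
  proof -
    have "sigma 1 \<noteq> 1" "tau 1 \<noteq> sigma 1" by (simp_all add: sigma_def tau_def)
    then show "sigma \<noteq> id" "tau \<noteq> sigma" by auto
    show "sigma \<in> carrier (sym_group 3)"
      by (auto simp: sigma_def sym_group_carrier intro: permutes_swap_id)
  qed (simp add: sigma_def)
  have rho: "rho \<circ> rho \<circ> (rho \<circ> rho) = rho" "rho \<circ> rho \<noteq> rho"
  proof -
    show "rho \<circ> rho \<circ> (rho \<circ> rho) = rho"
      using perm_relations(1) by (metis comp_assoc id_o)
    have "(rho \<circ> rho) 1 \<noteq> rho 1" by (simp add: rho_def transpose_def)
    then show "rho \<circ> rho \<noteq> rho" by metis
  qed
  show ?thesis
    using assms(2)
  proof (elim disjE)
    assume "G \<cong> SG_12_5"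
    then show ?thesis
      by (rule inter_cyclic_order_6_if_iso[of _ "(0, 2)" "(1, 0)" "(0, 3)"])
        (simp_all add: SG_12_5_def carrier_Zn)
  next
    assume "G \<cong> SG_18_3"
    then show ?thesis
      by (rule inter_cyclic_order_6_if_iso[of _ "(1, id)" "(0, tau)" "(0, sigma)"])
        (simp_all add: SG_18_3_def carrier_Zn perm sigma sigma(2)[symmetric] id_closed)
  next
    assume "G \<cong> SG_24_7"
    then show ?thesis
      by (rule inter_cyclic_order_6_if_iso[of _ "(0, (1, 0))" "(1, (0, 0))" "(0, (0, 2))"])
        (simp_all add: SG_24_7_def Dic3_def carrier_Zn)
  next
    assume "G \<cong> SG_24_8"
    then show ?thesis
      by (rule inter_cyclic_order_6_if_iso[of _ "((2, 0), 0)" "((3, 0), 0)" "((0, 1), 0)"])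
        (simp_all add: SG_24_8_def carrier_Zn)
  next
    assume "G \<cong> SG_24_14"
    then show ?thesis
      by (rule inter_cyclic_order_6_if_iso[of _ "((0, 0), rho)" "((1, 0), id)" "((0, 1), id)"])
        (simp_all add: SG_24_14_def carrier_Zn perm rho id_closed)
  next
    assume "G \<cong> SG_36_11"
    then show ?thesis
      by (rule inter_cyclic_order_6_if_iso[of _ "(1, id)" "(0, v1)" "(0, v2)"])
        (simp_all add: SG_36_11_def carrier_Zn perm id_closed)
  next
    assume "G \<cong> SG_72_43"
    then show ?thesis
      by (rule inter_cyclic_order_6_if_iso[of _ "((1, id), 0)" "((0, v1), 0)" "((0, v2), 0)"])
        (simp_all add: SG_72_43_def carrier_Zn perm id_closed)
  qed
qed

theorem theorem3p3:
  fixes G :: "('a, 'b) monoid_scheme"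
  assumes "group G" and "finite (carrier G)"
    and "elem_orders G \<subseteq> {1, 2, 3, 4, 6}"
    and "card (cyclic_subgroups_of_order G 6) = 3"
  shows "(\<exists>H \<in> cyclic_subgroups_of_order G 6. \<exists>K \<in> cyclic_subgroups_of_order G 6.
            card (H \<inter> K) = 3)
         \<longleftrightarrow> (G \<cong> SG_12_5 \<or> G \<cong> SG_18_3 \<or> G \<cong> SG_24_7 \<or> G \<cong> SG_24_8 \<or>
              G \<cong> SG_24_14 \<or> G \<cong> SG_36_11 \<or> G \<cong> SG_72_43)"
proof
  interpret group G by fact
  assume "\<exists>H \<in> cyclic_subgroups_of_order G 6. \<exists>K \<in> cyclic_subgroups_of_order G 6. card (H \<inter> K) = 3"
  then obtain z s t u where "three_involutions G z s t u"
    using three_involutions_if_inter[OF assms(3,4)] by blast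
  then show "G \<cong> SG_12_5 \<or> G \<cong> SG_18_3 \<or> G \<cong> SG_24_7 \<or> G \<cong> SG_24_8 \<or>
              G \<cong> SG_24_14 \<or> G \<cong> SG_36_11 \<or> G \<cong> SG_72_43"
    by (rule three_involutions.classification)
qed (rule inter_cyclic_order_6_if_classified[OF assms(1)])

end
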